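(* Let $\tilde P$ be an affine poset, let $c\in\mathbb{R}_{>0}$ be a fixed constant, let $\mathcal{C}(\tilde P)$ be the affine $\tilde P$-cyclohedron with nonempty faces $F_{\mathbf{T}}$ indexed by proper pipings $\mathbf{T}$, and let $\operatorname{Comp}(\tilde P)$ be the associated compactification with strata $\operatorname{Comp}_{\mathbf{T}}(\tilde P)$. Then there exists a stratification-preserving homeomorphism $\mathcal{C}(\tilde P)\to\operatorname{Comp}(\tilde P)$, i.e. a homeomorphism which, for each proper piping $\mathbf{T}$, maps the relative interior of $F_{\mathbf{T}}$ onto $\operatorname{Comp}_{\mathbf{T}}(\tilde P)$.
   Context: Combinatorics. An affine poset of order $n\ge1$ is a poset $\tilde P=(\mathbb{Z},\preceq)$ such that: $i\prec i+n$ for all $i$; $i\preceq j$ iff $i+n\preceq j+n$ for all $i,j$; and for all $i,j$ there is $k\ge0$ with $i\preceq j+kn$. Write $|\tilde P|=n$. A subset $\tau\subseteq\mathbb{Z}$ is convex if $i\prec j\prec k$ with $i,k\in\tau$ implies $j\in\tau$, and connected if the subgraph of the Hasse diagram of $\tilde P$ induced by $\tau$ is connected. A pipe is a nonempty convex connected subset of $\mathbb{Z}$ which either equals $\mathbb{Z}$ (denoted $\tilde P$) or contains at most one element in each residue class modulo $n$. Pipes $\tau$ and $\tau+dn$ ($d\in\mathbb{Z}$) are equivalent. A piping is a collection $\mathbf{T}$ of pipes which is a union of equivalence classes, such that any two pipes in $\mathbf{T}$ are nested or disjoint, and such that the directed graph with vertex set $\mathbf{T}$ and edges $(\tau,\tau')$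 whenever $\tau\cap\tau'=\emptyset$ and $i\prec j$ for some $i\in\tau,j\in\tau'$ has no directed cycles. A pipe $\tau$ is proper if $|\tau|>1$ and $\tau\neq\tilde P$; a piping is proper if all its pipes are proper (the empty collection is allowed). The affine $\tilde P$-cyclohedron. $\mathcal{C}(\tilde P)$ is the polar dual of a simplicial $(n-1)$-dimensional polytope whose boundary complex is isomorphic to the simplicial complex whose vertices are equivalence classes of proper pipes and whose simplices correspond to proper pipings (such a polytope exists). $F_{\mathbf{T}}$ denotes the face dual to the simplex of $\mathbf{T}$, with $F_\emptyset=\mathcal{C}(\tilde P)$ and $F_{\mathbf{T}}\subseteq F_{\mathbf{T}'}$ iff $\mathbf{T}\supseteq\mathbf{T}'$. The compactification. Identify $x\in\mathbb{R}^n$ with the sequence $(\tilde x_i)_{i\in\mathbb{Z}}$ such that $\tilde x_i=x_i$ for $1\le i\le n$ and $\tilde x_{i+n}=\tilde x_i+c$ for all $i$. Let $\mathbb{R}^n_{\Sigma=0}=\{x\in\mathbb{R}^n:\sum x_i=0\}$ (a model of $\mathbb{R}^n/\mathbb{R}(1,\dots,1)$) and set $\mathcal{O}^\circ(\tilde P)=\{x\in\mathbb{R}^n_{\Sigma=0}:\tilde x_i<\tilde x_j\ \forall i\prec j\}$, $\mathcal{O}(\tilde P)=\{x\in\mathbb{R}^n_{\Sigma=0}:\tilde x_i\le\tilde x_j\ \forall i\preceq j\}$. For a pipe $\tau\ne\tilde P$ with $|\tau|>1$, viewed as a finite poset with the induced order, let $\alpha_\tau(y)=\sum_{i\lessdot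 j,\ i,j\in\tau}(y_j-y_i)$ (sum over covering relations) and $\mathcal{O}(\tau)=\{y\in\mathbb{R}^\tau:\sum_{i\in\tau}y_i=0,\ y_i\le y_j\text{ for }i\preceq j\text{ in }\tau,\ \alpha_\tau(y)=1\}$. For $x\in\mathcal{O}^\circ(\tilde P)$ put $x[\tau]=\frac1{\alpha_\tau(\tilde x)}\big(\tilde x_i-\frac1{|\tau|}\sum_{k\in\tau}\tilde x_k\big)_{i\in\tau}\in\mathcal{O}(\tau)$ for $\tau\neq\tilde P$, $|\tau|>1$, and $x[\tilde P]=x$. Let $\overline{\prod}_{|\tau|>1}\mathcal{O}(\tau)$ be the set of points $(x[\tau])_{|\tau|>1}\in\prod_{|\tau|>1}\mathcal{O}(\tau)$ (product over all pipes with $|\tau|>1$, including $\tilde P$) such that $x[\tau]=x[\tau']$ whenever $\tau,\tau'=\tau+dn$ are equivalent (identifying $\mathbb{R}^\tau$ with $\mathbb{R}^{\tau+dn}$ via $i\mapsto i+dn$). Let $\tilde\rho:\mathcal{O}^\circ(\tilde P)\to\overline{\prod}_{|\tau|>1}\mathcal{O}(\tau)$, $x\mapsto(x[\tau])_\tau$. Then $\operatorname{Comp}(\tilde P)$ is the closure of $\tilde\rho(\mathcal{O}^\circ(\tilde P))$. Strata. For a pipe $\tau\ne\tilde P$ with $|\tau|>1$ and $y\in\mathcal{O}(\tau)$, let $\mathbf{B}(y)$ be the collection of maximal by inclusion pipes $\sigma\subseteq\tau$ with $y_i=y_j$ for all $i,j\in\sigma$; for $y\in\mathcal{O}(\tilde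 P)$ let $\mathbf{B}(y)$ be the collection of maximal by inclusion pipes $\sigma$ with $\tilde y_i=\tilde y_j$ for all $i,j\in\sigma$. For $x\in\operatorname{Comp}(\tilde P)$, let $\widehat{\mathbf{T}}(x)$ be the smallest collection of pipes containing $\tilde P$ and such that for each non-singleton $\tau\in\widehat{\mathbf{T}}(x)$ it contains all elements of $\mathbf{B}(x[\tau])$; let $\mathbf{T}(x)$ be the set of proper pipes in $\widehat{\mathbf{T}}(x)$ (this is a proper piping). For a proper piping $\mathbf{T}$, $\operatorname{Comp}_{\mathbf{T}}(\tilde P)=\{x\in\operatorname{Comp}(\tilde P):\mathbf{T}(x)=\mathbf{T}\}$. *)

theory Defs
  imports "HOL-Analysis.Analysis"
begin

section \<open>Affine posets, pipes and pipings\<close>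

definition affine_poset :: "nat \<Rightarrow> (int \<Rightarrow> int \<Rightarrow> bool) \<Rightarrow> bool" where
  "affine_poset n le \<longleftrightarrow>
     1 \<le> n \<and> reflp le \<and> transp le \<and> antisymp le \<and>
     (\<forall>i. le i (i + int n)) \<and>
     (\<forall>i j. le i j \<longleftrightarrow> le (i + int n) (j + int n)) \<and>
     (\<forall>i j. \<exists>k::nat. le i (j + int k * int n))"

definition strict :: "(int \<Rightarrow> int \<Rightarrow> bool) \<Rightarrow> int \<Rightarrow> int \<Rightarrow> bool" where
  "strict le i j \<longleftrightarrow> le i j \<and> i \<noteq> j"

text \<open>Covering relation of the induced order on \<open>A\<close>; for \<open>A = UNIV\<close> it gives the edges of the
  Hasse diagram of the affine poset.\<close>

definition covers_in :: "(int \<Rightarrow> int \<Rightarrow> bool) \<Rightarrow> int set \<Rightarrow> int \<Rightarrow> int \<Rightarrow> bool" where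
  "covers_in le A i j \<longleftrightarrow>
     i \<in> A \<and> j \<in> A \<and> strict le i j \<and> \<not> (\<exists>k\<in>A. strict le i k \<and> strict le k j)"

definition order_convex :: "(int \<Rightarrow> int \<Rightarrow> bool) \<Rightarrow> int set \<Rightarrow> bool" where
  "order_convex le \<tau> \<longleftrightarrow> (\<forall>i\<in>\<tau>. \<forall>k\<in>\<tau>. \<forall>j. strict le i j \<and> strict le j k \<longrightarrow> j \<in> \<tau>)"

definition hasse_connected :: "(int \<Rightarrow> int \<Rightarrow> bool) \<Rightarrow> int set \<Rightarrow> bool" where
  "hasse_connected le \<tau> \<longleftrightarrow>
     (\<forall>i\<in>\<tau>. \<forall>j\<in>\<tau>. (i, j) \<in>
        {(a, b). a \<in> \<tau> \<and> b \<in> \<tau> \<and> (covers_in le UNIV a b \<or> covers_in le UNIV b a)}\<^sup>*)"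

definition pipe :: "nat \<Rightarrow> (int \<Rightarrow> int \<Rightarrow> bool) \<Rightarrow> int set \<Rightarrow> bool" where
  "pipe n le \<tau> \<longleftrightarrow>
     \<tau> \<noteq> {} \<and> order_convex le \<tau> \<and> hasse_connected le \<tau> \<and>
     (\<tau> = UNIV \<or> (\<forall>i\<in>\<tau>. \<forall>j\<in>\<tau>. i mod int n = j mod int n \<longrightarrow> i = j))"

text \<open>The pipes with more than one element, including \<open>UNIV\<close>. This is not written as
  \<open>1 < card \<tau>\<close> because \<open>card UNIV = 0\<close>.\<close>

definition nontriv_pipe :: "nat \<Rightarrow> (int \<Rightarrow> int \<Rightarrow> bool) \<Rightarrow> int set \<Rightarrow> bool" where
  "nontriv_pipe n le \<tau> \<longleftrightarrow> pipe n le \<tau> \<and> \<not> is_singleton \<tau>"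

definition proper_pipe :: "nat \<Rightarrow> (int \<Rightarrow> int \<Rightarrow> bool) \<Rightarrow> int set \<Rightarrow> bool" where
  "proper_pipe n le \<tau> \<longleftrightarrow> nontriv_pipe n le \<tau> \<and> \<tau> \<noteq> UNIV"

definition shift :: "nat \<Rightarrow> int \<Rightarrow> int set \<Rightarrow> int set" where
  "shift n d \<tau> = (\<lambda>i. i + d * int n) ` \<tau>"

definition pipe_class :: "nat \<Rightarrow> int set \<Rightarrow> int set set" where
  "pipe_class n \<tau> = range (\<lambda>d. shift n d \<tau>)"

definition piping :: "nat \<Rightarrow> (int \<Rightarrow> int \<Rightarrow> bool) \<Rightarrow> int set set \<Rightarrow> bool" where
  "piping n le T \<longleftrightarrow>
     (\<forall>\<tau>\<in>T. pipe n le \<tau>) \<and>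
     (\<forall>\<tau>\<in>T. pipe_class n \<tau> \<subseteq> T) \<and>
     (\<forall>\<tau>\<in>T. \<forall>\<tau>'\<in>T. \<tau> \<subseteq> \<tau>' \<or> \<tau>' \<subseteq> \<tau> \<or> \<tau> \<inter> \<tau>' = {}) \<and>
     acyclic {(\<tau>, \<tau>'). \<tau> \<in> T \<and> \<tau>' \<in> T \<and> \<tau> \<inter> \<tau>' = {} \<and> (\<exists>i\<in>\<tau>. \<exists>j\<in>\<tau>'. strict le i j)}"

definition proper_piping :: "nat \<Rightarrow> (int \<Rightarrow> int \<Rightarrow> bool) \<Rightarrow> int set set \<Rightarrow> bool" where
  "proper_piping n le T \<longleftrightarrow> piping n le T \<and> (\<forall>\<tau>\<in>T. proper_pipe n le \<tau>)"

section \<open>The affine cyclohedron\<close>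

definition piping_complex :: "nat \<Rightarrow> (int \<Rightarrow> int \<Rightarrow> bool) \<Rightarrow> int set set set set" where
  "piping_complex n le = {pipe_class n ` T | T. proper_piping n le T}"

definition simplicial_polytope :: "'a::euclidean_space set \<Rightarrow> bool" where
  "simplicial_polytope Q \<longleftrightarrow>
     polytope Q \<and> (\<forall>F. F face_of Q \<and> F \<noteq> Q \<longrightarrow> (\<exists>k. k simplex F))"

text \<open>The boundary complex as an abstract simplicial complex: the vertex sets of the proper faces,
  including the empty face.\<close>

definition boundary_complex :: "'a::euclidean_space set \<Rightarrow> 'a set set" where
  "boundary_complex Q = {{v. v extreme_point_of F} | F. F face_of Q \<and> F \<noteq> Q}"

text \<open>\<open>\<phi>\<close> is an isomorphism from the complex of proper pipings onto the boundary complex of \<open>Q\<close>.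
  The polytope \<open>Q\<close> may sit in a Euclidean space of larger dimension than \<open>n - 1\<close>; since \<open>0\<close> is a
  relative interior point, its affine hull is \<open>span Q\<close>, and polar duality is taken inside
  \<open>span Q\<close>. This covers \<open>n = 1\<close>, where \<open>Q = {0}\<close>.\<close>

definition dual_cyclohedron ::
  "nat \<Rightarrow> (int \<Rightarrow> int \<Rightarrow> bool) \<Rightarrow> 'a::euclidean_space set \<Rightarrow> (int set set \<Rightarrow> 'a) \<Rightarrow> bool" where
  "dual_cyclohedron n le Q \<phi> \<longleftrightarrow>
     simplicial_polytope Q \<and> aff_dim Q = int n - 1 \<and> 0 \<in> rel_interior Q \<and>
     bij_betw \<phi> (pipe_class n ` {\<tau>. proper_pipe n le \<tau>}) (\<Union> (boundary_complex Q)) \<and>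
     (\<lambda>S. \<phi> ` S) ` piping_complex n le = boundary_complex Q"

definition polar_dual :: "'a::euclidean_space set \<Rightarrow> 'a set" where
  "polar_dual Q = {y \<in> span Q. \<forall>x\<in>Q. x \<bullet> y \<le> 1}"

definition dual_face :: "'a::euclidean_space set \<Rightarrow> 'a set \<Rightarrow> 'a set" where
  "dual_face Q G = {y \<in> polar_dual Q. \<forall>x\<in>G. x \<bullet> y = 1}"

definition cyclohedron_face ::
  "nat \<Rightarrow> 'a::euclidean_space set \<Rightarrow> (int set set \<Rightarrow> 'a) \<Rightarrow> int set set \<Rightarrow> 'a set" where
  "cyclohedron_face n Q \<phi> T = dual_face Q (convex hull (\<phi> ` pipe_class n ` T))"

section \<open>The compactification\<close>

text \<open>A vector with coordinate sum zero is represented by its quasi-periodic extension to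
  \<open>\<int>\<close>; the product topology on \<open>int \<Rightarrow> real\<close> induces the usual topology on these.\<close>

definition seq_space :: "nat \<Rightarrow> real \<Rightarrow> (int \<Rightarrow> real) set" where
  "seq_space n c = {x. (\<forall>i. x (i + int n) = x i + c) \<and> (\<Sum>i\<in>{1..int n}. x i) = 0}"

definition O_open :: "nat \<Rightarrow> (int \<Rightarrow> int \<Rightarrow> bool) \<Rightarrow> real \<Rightarrow> (int \<Rightarrow> real) set" where
  "O_open n le c = {x \<in> seq_space n c. \<forall>i j. strict le i j \<longrightarrow> x i < x j}"

definition O_affine :: "nat \<Rightarrow> (int \<Rightarrow> int \<Rightarrow> bool) \<Rightarrow> real \<Rightarrow> (int \<Rightarrow> real) set" where
  "O_affine n le c = {x \<in> seq_space n c. \<forall>i j. le i j \<longrightarrow> x i \<le> x j}"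

definition alpha :: "(int \<Rightarrow> int \<Rightarrow> bool) \<Rightarrow> int set \<Rightarrow> (int \<Rightarrow> real) \<Rightarrow> real" where
  "alpha le \<tau> y = (\<Sum>(i, j)\<in>{(i, j). covers_in le \<tau> i j}. y j - y i)"

text \<open>Points of \<open>\<real>\<^sup>\<tau>\<close> are the functions in \<open>extensional \<tau>\<close>.\<close>

definition O_pipe :: "(int \<Rightarrow> int \<Rightarrow> bool) \<Rightarrow> int set \<Rightarrow> (int \<Rightarrow> real) set" where
  "O_pipe le \<tau> =
     {y \<in> extensional \<tau>. (\<Sum>i\<in>\<tau>. y i) = 0 \<and>
        (\<forall>i\<in>\<tau>. \<forall>j\<in>\<tau>. le i j \<longrightarrow> y i \<le> y j) \<and> alpha le \<tau> y = 1}"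

definition coord :: "(int \<Rightarrow> int \<Rightarrow> bool) \<Rightarrow> (int \<Rightarrow> real) \<Rightarrow> int set \<Rightarrow> (int \<Rightarrow> real)" where
  "coord le x \<tau> =
     (if \<tau> = UNIV then x
      else (\<lambda>i\<in>\<tau>. (x i - (\<Sum>k\<in>\<tau>. x k) / real (card \<tau>)) / alpha le \<tau> x))"

text \<open>The compatibility condition omits \<open>\<tau> = UNIV\<close>, which is equivalent only to itself: a shift
  by \<open>d * n\<close> would act on the quasi-periodic extension as addition of \<open>d * c\<close>.\<close>

definition compat_prod ::
  "nat \<Rightarrow> (int \<Rightarrow> int \<Rightarrow> bool) \<Rightarrow> real \<Rightarrow> (int set \<Rightarrow> int \<Rightarrow> real) set" where
  "compat_prod n le c =
     {x \<in> (\<Pi>\<^sub>E \<tau>\<in>{\<tau>. nontriv_pipe n le \<tau>}. if \<tau> = UNIV then O_affine n le c else O_pipe le \<tau>).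
        \<forall>\<tau> d. proper_pipe n le \<tau> \<longrightarrow>
          (\<forall>i\<in>\<tau>. x (shift n d \<tau>) (i + d * int n) = x \<tau> i)}"

definition rho ::
  "nat \<Rightarrow> (int \<Rightarrow> int \<Rightarrow> bool) \<Rightarrow> (int \<Rightarrow> real) \<Rightarrow> (int set \<Rightarrow> int \<Rightarrow> real)" where
  "rho n le x = (\<lambda>\<tau>\<in>{\<tau>. nontriv_pipe n le \<tau>}. coord le x \<tau>)"

definition Comp ::
  "nat \<Rightarrow> (int \<Rightarrow> int \<Rightarrow> bool) \<Rightarrow> real \<Rightarrow> (int set \<Rightarrow> int \<Rightarrow> real) set" where
  "Comp n le c = top_of_set (compat_prod n le c) closure_of (rho n le ` O_open n le c)"

section \<open>Strata\<close>

definition const_pipes ::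
  "nat \<Rightarrow> (int \<Rightarrow> int \<Rightarrow> bool) \<Rightarrow> int set \<Rightarrow> (int \<Rightarrow> real) \<Rightarrow> int set set" where
  "const_pipes n le \<tau> y = {\<sigma>. pipe n le \<sigma> \<and> \<sigma> \<subseteq> \<tau> \<and> (\<forall>i\<in>\<sigma>. \<forall>j\<in>\<sigma>. y i = y j)}"

definition B_pipes ::
  "nat \<Rightarrow> (int \<Rightarrow> int \<Rightarrow> bool) \<Rightarrow> int set \<Rightarrow> (int \<Rightarrow> real) \<Rightarrow> int set set" where
  "B_pipes n le \<tau> y =
     {\<sigma> \<in> const_pipes n le \<tau> y. \<forall>\<sigma>'\<in>const_pipes n le \<tau> y. \<sigma> \<subseteq> \<sigma>' \<longrightarrow> \<sigma>' = \<sigma>}"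

inductive_set T_hat ::
  "nat \<Rightarrow> (int \<Rightarrow> int \<Rightarrow> bool) \<Rightarrow> (int set \<Rightarrow> int \<Rightarrow> real) \<Rightarrow> int set set"
  for n le x where
  top: "UNIV \<in> T_hat n le x"
| step: "\<tau> \<in> T_hat n le x \<Longrightarrow> \<not> is_singleton \<tau> \<Longrightarrow> \<sigma> \<in> B_pipes n le \<tau> (x \<tau>)
    \<Longrightarrow> \<sigma> \<in> T_hat n le x"

definition piping_of ::
  "nat \<Rightarrow> (int \<Rightarrow> int \<Rightarrow> bool) \<Rightarrow> (int set \<Rightarrow> int \<Rightarrow> real) \<Rightarrow> int set set" where
  "piping_of n le x = {\<tau> \<in> T_hat n le x. proper_pipe n le \<tau>}"

definition Comp_stratum ::
  "nat \<Rightarrow> (int \<Rightarrow> int \<Rightarrow> bool) \<Rightarrow> real \<Rightarrow> int set set \<Rightarrow> (int set \<Rightarrow> int \<Rightarrow> real) set" where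
  "Comp_stratum n le c T = {x \<in> Comp n le c. piping_of n le x = T}"

end

theory Submission
  imports Defs
begin

text \<open>The compactification is identified with the polytope \<open>A\<close> of all quasi-periodic \<open>x\<close> with coordinate
  sum zero and \<open>alpha \<tau> x \<ge> eps (card \<tau>)\<close> for every proper pipe \<open>\<tau>\<close>, where \<open>eps\<close> grows very fast with the
  size of the pipe. Two intersecting pipes on which \<open>x\<close> nearly attains these bounds are nested, since
  otherwise the pipe spanned by both would violate its own bound. Contracting every such pipe \<open>\<sigma>\<close> by a
  factor that runs from 1 to 0 as \<open>alpha \<sigma> x\<close> decreases from \<open>2 * eps\<close> to \<open>eps\<close>, and normalising the
  result on each pipe separately, gives a continuous map from \<open>A\<close> to the compactification under which
  the pipes with \<open>alpha \<sigma> x = eps\<close> become the piping of the image. It is injective: if \<open>x\<close> and \<open>z\<close> have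
  the same image, then at a pipe where the ratio of the scales of \<open>x\<close> and \<open>z\<close> is extremal \<open>x\<close> would have to
  be both larger and not larger than \<open>z\<close>. By invariance of domain its restriction to the interior of
  \<open>A\<close> is onto the open stratum, so the whole map is onto.

  The polytope \<open>A\<close> is also homeomorphic to the polar dual of \<open>Q\<close>: going through the faces by increasing
  dimension, a homeomorphism of the boundaries of two corresponding faces is extended radially. At
  first only the faces of \<open>A\<close> are known to occur among those of the polar dual, so this yields an
  injective map; it is onto again by invariance of domain. In particular it is never needed to
  exhibit a point of \<open>A\<close> on the face of a given piping.\<close>


section \<open>Homeomorphisms between polyhedra with the same faces\<close>

text \<open>The growth of \<open>eps\<close> turns size into scale: a pipe with one more element
  must have an \<open>alpha\<close> at least \<open>K\<close> times as large, so two narrow pipes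
  that cross would span a hull that is too narrow. The period \<open>c\<close> plays the part of
  size \<open>n + 1\<close>, which excludes hulls containing congruent elements. Points of
  \<open>A\<close> never degenerate on a pipe, whereas boundary points of the compactification do;
  hence the contraction. Its factor is clipped at 1, so the map stays continuous although the set of
  contracted pipes jumps. The obstacle to injectivity is that normalising hides the scale of each
  pipe while the factors depend on the very point to be recovered. The way out: base points are not
  moved by the contractions of their own pipes, so differences of \<open>x\<close> between them can
  be read off up to the unknown scale, and all errors are proportional to the deviation of the
  extremal ratio from 1, so the argument works however small this deviation is. The multiples 2 and
  4 of \<open>eps\<close> separate the pipes that move from those that are merely comparable, as
  equality of images controls \<open>alpha\<close> up to a factor 2.\<close>

locale slack_system =
  fixes U :: "'a::euclidean_space set" and V :: "'v set" and s :: "'v \<Rightarrow> 'a \<Rightarrow> real"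
  assumes affine_U: "affine U"
    and finite_V: "finite V"
    and slack_affine:
      "\<And>v y z r. v \<in> V \<Longrightarrow> s v ((1 - r) *\<^sub>R y + r *\<^sub>R z) = (1 - r) * s v y + r * s v z"
    and slack_cont: "\<And>v. v \<in> V \<Longrightarrow> continuous_on UNIV (s v)"
    and compact_cell: "compact {y \<in> U. \<forall>v\<in>V. 0 \<le> s v y}"
begin

definition cell :: "'a set" where
  "cell = {y \<in> U. \<forall>v\<in>V. 0 \<le> s v y}"

definition zeros :: "'a \<Rightarrow> 'v set" where
  "zeros y = {v \<in> V. s v y = 0}"

text \<open>The Minkowski gauge, centred at \<open>a\<close>, of the face whose relative interior
  contains \<open>a\<close>; slacks vanishing at \<open>a\<close> vanish on that whole face and are
  left out. The inserted 0 keeps \<open>Max\<close> defined when no slack remains.\<close>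

definition gauge_at :: "'a \<Rightarrow> 'a \<Rightarrow> real" where
  "gauge_at a y = Max (insert 0 ((\<lambda>v. (s v a - s v y) / s v a) ` (V - zeros a)))"

definition ray :: "'a \<Rightarrow> real \<Rightarrow> 'a \<Rightarrow> 'a" where
  "ray a r y = (1 - r) *\<^sub>R a + r *\<^sub>R y"

lemma ray_U: "a \<in> U \<Longrightarrow> y \<in> U \<Longrightarrow> ray a r y \<in> U"
  unfolding ray_def using affine_U by (simp add: mem_affine)

lemma slack_ray: "v \<in> V \<Longrightarrow> s v (ray a r y) = (1 - r) * s v a + r * s v y"
  unfolding ray_def by (rule slack_affine)

lemma ray_ray: "ray a r (ray a q y) = ray a (r * q) y"
  unfolding ray_def by (simp add: algebra_simps)

lemma ray_0 [simp]: "ray a 0 y = a" by (simp add: ray_def)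

lemma ray_1 [simp]: "ray a 1 y = y" by (simp add: ray_def)

lemma gauge_ge:
  "v \<in> V - zeros a \<Longrightarrow> (s v a - s v y) / s v a \<le> gauge_at a y"
  unfolding gauge_at_def using finite_V by (auto intro!: Max_ge)

lemma gauge_nonneg: "0 \<le> gauge_at a y"
  unfolding gauge_at_def using finite_V by (auto intro!: Max_ge)

lemma gauge_le_iff:
  assumes "0 \<le> m"
  shows "gauge_at a y \<le> m \<longleftrightarrow> (\<forall>v\<in>V - zeros a. (s v a - s v y) / s v a \<le> m)"
  unfolding gauge_at_def using finite_V assms by (subst Max_le_iff) auto

lemma gauge_attained:
  assumes "gauge_at a y > 0"
  obtains v where "v \<in> V - zeros a" "gauge_at a y = (s v a - s v y) / s v a"
proof -
  have "gauge_at a y \<in> insert 0 ((\<lambda>v. (s v a - s v y) / s v a) ` (V - zeros a))"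
    unfolding gauge_at_def using finite_V by (intro Max_in) auto
  then show ?thesis using assms that by auto
qed

lemma gauge_ray:
  assumes "0 \<le> r"
  shows "gauge_at a (ray a r y) = r * gauge_at a y"
proof -
  have eq: "(s v a - s v (ray a r y)) / s v a = r * ((s v a - s v y) / s v a)" if "v \<in> V" for v
    using that by (simp add: slack_ray diff_divide_distrib algebra_simps)
  have "insert 0 ((\<lambda>v. (s v a - s v (ray a r y)) / s v a) ` (V - zeros a)) =
      (\<lambda>x. r * x) ` insert 0 ((\<lambda>v. (s v a - s v y) / s v a) ` (V - zeros a))"
    unfolding image_insert image_image mult_zero_right using eq by (metis (no_types, lifting) DiffD1 image_cong)
  moreover have "mono (\<lambda>x. r * x)" using assms by (simp add: mono_def mult_left_mono)
  ultimately show ?thesis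
    unfolding gauge_at_def using finite_V by (simp add: mono_Max_commute)
qed

lemma continuous_gauge: "continuous_on UNIV (gauge_at a)"
proof -
  have "continuous_on UNIV (\<lambda>y. Max (insert (0::real) ((\<lambda>v. (s v a - s v y) / s v a) ` W)))"
    if "finite W" "W \<subseteq> V - zeros a" for W
    using that
  proof (induction W)
    case empty
    then show ?case by simp
  next
    case (insert w W)
    have "Max (insert 0 ((\<lambda>v. (s v a - s v y) / s v a) ` insert w W)) =
       max ((s w a - s w y) / s w a) (Max (insert 0 ((\<lambda>v. (s v a - s v y) / s v a) ` W)))" for y
      using insert(1) unfolding image_insert by (subst insert_commute, subst Max_insert) auto
    moreover have "s w a \<noteq> 0" using insert by (auto simp: zeros_def)
    moreover have "continuous_on UNIV (s w)" using insert by (intro slack_cont) auto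
    ultimately show ?case using insert by (auto intro!: continuous_intros)
  qed
  then show ?thesis unfolding gauge_at_def using finite_V by auto
qed

context
  fixes a assumes a: "a \<in> cell"
begin

lemma slack_pos: "v \<in> V - zeros a \<Longrightarrow> 0 < s v a"
  using a by (force simp: cell_def zeros_def)

lemma gauge_le_1: "y \<in> cell \<Longrightarrow> gauge_at a y \<le> 1"
  using slack_pos by (auto simp: gauge_le_iff cell_def)

text \<open>The value 1 marks the relative boundary of the face of \<open>a\<close>: a quotient
  equal to 1 is a slack that has dropped to 0.\<close>

lemma gauge_eq_1:
  assumes "y \<in> cell" "zeros a \<subseteq> zeros y"
  shows "gauge_at a y = 1 \<longleftrightarrow> zeros y \<noteq> zeros a"
proof
  assume "gauge_at a y = 1"
  then obtain v where "v \<in> V - zeros a" "(s v a - s v y) / s v a = 1"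
    using gauge_attained[of a y] zero_less_one by metis
  moreover from this have "s v y = 0" using slack_pos[of v] by simp
  ultimately show "zeros y \<noteq> zeros a" by (auto simp: zeros_def)
next
  assume "zeros y \<noteq> zeros a"
  then obtain v where v: "v \<in> V - zeros a" "s v y = 0"
    using assms by (auto simp: zeros_def)
  then have "1 \<le> gauge_at a y" using gauge_ge[of v a y] slack_pos[of v] by simp
  then show "gauge_at a y = 1" using gauge_le_1[OF assms(1)] by linarith
qed

lemma gauge_cell:
  assumes "y \<in> U" "gauge_at a y \<le> 1" "\<And>v. v \<in> zeros a \<Longrightarrow> s v y = 0"
  shows "y \<in> cell"
proof -
  have "0 \<le> s v y" if v: "v \<in> V" for v
  proof (cases "v \<in> zeros a")
    case False
    then have "v \<in> V - zeros a" using v by simp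
    then have "s v a - s v y \<le> s v a * gauge_at a y" "0 < s v a"
      using gauge_ge[of v a y] slack_pos[of v] by (auto simp: field_simps)
    moreover from this have "s v a * gauge_at a y \<le> s v a" using assms(2) by (simp add: mult_left_le)
    ultimately show ?thesis by linarith
  qed (use assms in auto)
  then show ?thesis using assms by (simp add: cell_def)
qed

lemma ray_cell:
  assumes "y \<in> cell" "zeros a \<subseteq> zeros y" "0 \<le> r" "r * gauge_at a y \<le> 1"
  shows "ray a r y \<in> cell" "zeros a \<subseteq> zeros (ray a r y)"
proof -
  have *: "s v (ray a r y) = 0" if "v \<in> zeros a" for v
    using that assms(2) by (auto simp: zeros_def slack_ray)
  show "ray a r y \<in> cell"
    using assms a * by (intro gauge_cell ray_U) (auto simp: gauge_ray cell_def)
  show "zeros a \<subseteq> zeros (ray a r y)" using * by (auto simp: zeros_def)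
qed

text \<open>A zero gauge would keep the entire ray from \<open>a\<close> through \<open>y\<close>
  inside the cell, against its boundedness.\<close>

lemma gauge_eq_0:
  assumes y: "y \<in> cell" "zeros a \<subseteq> zeros y" and g: "gauge_at a y = 0"
  shows "y = a"
proof (rule ccontr)
  assume "y \<noteq> a"
  have "bounded cell" using compact_cell compact_imp_bounded by (simp add: cell_def)
  then obtain B where B: "\<And>z. z \<in> cell \<Longrightarrow> norm z \<le> B" unfolding bounded_iff by blast
  define r where "r = (B + norm a + 1) / norm (y - a)"
  have n: "norm (y - a) > 0" using \<open>y \<noteq> a\<close> by simp
  have "B \<ge> 0" using B[OF y(1)] norm_ge_zero order_trans by blast
  then have r: "r \<ge> 0" using n unfolding r_def by (intro divide_nonneg_pos) auto
  have "norm (ray a r y) \<le> B" using ray_cell[OF y r] g B by simp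
  moreover have "r *\<^sub>R (y - a) = ray a r y - a" by (simp add: ray_def algebra_simps)
  then have "r * norm (y - a) \<le> norm (ray a r y) + norm a"
    using r by (metis abs_of_nonneg norm_scaleR norm_triangle_ineq4)
  moreover have "r * norm (y - a) = B + norm a + 1" using n by (simp add: r_def)
  ultimately show False by linarith
qed

end

end

section \<open>Radial extension and embeddings that preserve the active constraints\<close>

lemma radial_continuous:
  fixes g :: "'a::euclidean_space \<Rightarrow> 'b::euclidean_space"
  assumes m: "continuous_on S m" and a: "a \<in> S" and m0: "\<And>y. y \<in> S \<Longrightarrow> m y = 0 \<longleftrightarrow> y = a"
    and g: "continuous_on (S - {a}) g" and bdd: "bounded (g ` (S - {a}))"
  shows "continuous_on S (\<lambda>y. (1 - m y) *\<^sub>R x + m y *\<^sub>R g y)"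
proof -
  have "continuous (at y within S) (\<lambda>y. (1 - m y) *\<^sub>R x + m y *\<^sub>R g y)" if y: "y \<in> S" for y
  proof (cases "y = a")
    case False
    have "at y within S = at y within (S - {a})"
      by (rule at_within_nhd[where S = "- {a}"]) (use False in auto)
    moreover have "continuous (at y within (S - {a})) (\<lambda>y. (1 - m y) *\<^sub>R x + m y *\<^sub>R g y)"
      using g continuous_on_subset[OF m, of "S - {a}"] False y
      by (intro continuous_intros) (auto simp: continuous_on_eq_continuous_within)
    ultimately show ?thesis by simp
  next
    case True
    \<comment> \<open>At the apex \<open>g\<close> may fail to converge, but it is bounded and its
      factor \<open>m\<close> tends to 0.\<close>
    obtain B where B: "\<And>y. y \<in> S - {a} \<Longrightarrow> norm (g y) \<le> B"
      using bdd unfolding bounded_iff by auto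
    have m_lim: "(m \<longlongrightarrow> 0) (at a within S)"
      using m a m0 by (metis continuous_on_def)
    have "((\<lambda>y. m y *\<^sub>R g y) \<longlongrightarrow> 0) (at a within S)"
    proof (rule Lim_null_comparison)
      show "\<forall>\<^sub>F y in at a within S. norm (m y *\<^sub>R g y) \<le> \<bar>m y\<bar> * \<bar>B\<bar>"
        unfolding eventually_at_filter
        by (intro always_eventually allI impI) (use B in \<open>force intro!: mult_left_mono\<close>)
      show "((\<lambda>y. \<bar>m y\<bar> * \<bar>B\<bar>) \<longlongrightarrow> 0) (at a within S)"
        using tendsto_mult_left_zero[OF tendsto_rabs_zero[OF m_lim]] .
    qed
    then have "((\<lambda>y. (1 - m y) *\<^sub>R x + m y *\<^sub>R g y) \<longlongrightarrow> (1 - 0) *\<^sub>R x + 0) (at a within S)"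
      using m_lim by (intro tendsto_intros)
    then show ?thesis using True m0[OF a] by (simp add: continuous_within)
  qed
  then show ?thesis by (simp add: continuous_on_eq_continuous_within)
qed

text \<open>Induction over upward closed sets of patterns, that is, unions of closed faces: a face
  is added once its relative boundary has been embedded, and is filled in as a cone over that
  boundary.\<close>

lemma slack_system_embedding:
  fixes s t :: "'v \<Rightarrow> 'a::euclidean_space \<Rightarrow> real"
  assumes A: "slack_system U V s" and X: "slack_system U V t"
    and patterns: "\<And>y. y \<in> slack_system.cell U V s \<Longrightarrow>
      \<exists>x\<in>slack_system.cell U V t. slack_system.zeros V t x = slack_system.zeros V s y"
  obtains f where "continuous_on (slack_system.cell U V s) f" "inj_on f (slack_system.cell U V s)"
    "\<And>y. y \<in> slack_system.cell U V s \<Longrightarrow> f y \<in> slack_system.cell U V t"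
    "\<And>y. y \<in> slack_system.cell U V s \<Longrightarrow> slack_system.zeros V t (f y) = slack_system.zeros V s y"
proof -
  interpret A: slack_system U V s by fact
  interpret X: slack_system U V t by fact
  define good where "good \<D> f \<longleftrightarrow> continuous_on {y \<in> A.cell. A.zeros y \<in> \<D>} f \<and>
     inj_on f {y \<in> A.cell. A.zeros y \<in> \<D>} \<and>
     (\<forall>y\<in>A.cell. A.zeros y \<in> \<D> \<longrightarrow> f y \<in> X.cell \<and> X.zeros (f y) = A.zeros y)" for \<D> f
  have closed_A: "closed A.cell" using A.compact_cell compact_imp_closed by (simp add: A.cell_def)
  have closed_face: "closed {y \<in> A.cell. S \<subseteq> A.zeros y}" for S
  proof (cases "S \<subseteq> V")
    case True
    have "{y \<in> A.cell. S \<subseteq> A.zeros y} = A.cell \<inter> (\<Inter>v\<in>S. {y. s v y = 0})"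
      using True by (auto simp: A.zeros_def)
    moreover have "closed {y. s v y = 0}" if "v \<in> S" for v
      using that True A.slack_cont by (intro closed_Collect_eq) auto
    ultimately show ?thesis using closed_A by (simp add: closed_Int closed_INT)
  next
    case False
    then have "{y \<in> A.cell. S \<subseteq> A.zeros y} = {}" by (auto simp: A.zeros_def)
    then show ?thesis by (metis closed_empty)
  qed
  have "\<exists>f. good \<D> f"
    if "\<D> \<subseteq> Pow V" "\<And>S y. S \<in> \<D> \<Longrightarrow> y \<in> A.cell \<Longrightarrow> S \<subseteq> A.zeros y \<Longrightarrow> A.zeros y \<in> \<D>" for \<D>
    using finite_subset[OF that(1) finite_Pow_iff[THEN iffD2, OF A.finite_V]] that
  proof (induction \<D> rule: finite_psubset_induct)
    case (psubset \<D>)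
    show ?case
    proof (cases "\<D> = {}")
      case True
      then show ?thesis by (auto simp: good_def)
    next
      case False
      \<comment> \<open>A minimal pattern belongs to a maximal face of the family, so the family
        remains upward closed without it.\<close>
      obtain S where S: "S \<in> \<D>" and S_min: "\<And>S'. S' \<in> \<D> \<Longrightarrow> S' \<subseteq> S \<Longrightarrow> S' = S"
        using finite_has_minimal[OF psubset(1) False] by blast
      let ?D = "\<D> - {S}"
      have "?D \<subset> \<D>" using S by auto
      moreover have "?D \<subseteq> Pow V" using psubset.prems by auto
      moreover have "A.zeros y \<in> ?D" if "S' \<in> ?D" "y \<in> A.cell" "S' \<subseteq> A.zeros y" for S' y
        using that psubset.prems(2)[of S' y] S_min[of S'] by auto
      ultimately obtain f where f: "good ?D f" using psubset.IH[of ?D] by blast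
      show ?thesis
      proof (cases "\<exists>a\<in>A.cell. A.zeros a = S")
        case False
        then have "{y \<in> A.cell. A.zeros y \<in> \<D>} = {y \<in> A.cell. A.zeros y \<in> ?D}" by auto
        then have "good \<D> f" using f False unfolding good_def by auto
        then show ?thesis by blast
      next
        case True
        then obtain a where a: "a \<in> A.cell" and aS: "A.zeros a = S" by blast
        obtain x where x: "x \<in> X.cell" and xS: "X.zeros x = S" using patterns[OF a] aS by auto
        \<comment> \<open>\<open>r\<close> projects radially from \<open>a\<close> onto the relative
          boundary, where \<open>f\<close> is already given, and \<open>h\<close> maps the segment
          from \<open>a\<close> to \<open>r y\<close> affinely onto the one from \<open>x\<close> to
          \<open>f (r y)\<close>. Division by zero makes \<open>r a\<close> equal to
          \<open>a\<close>, and there \<open>f (r a)\<close> is multiplied by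
          \<open>m a = 0\<close>.\<close>
        define m where "m = A.gauge_at a"
        define r where "r y = A.ray a (1 / m y) y" for y
        define h where "h y = (1 - m y) *\<^sub>R x + m y *\<^sub>R f (r y)" for y
        define F where "F = {y \<in> A.cell. S \<subseteq> A.zeros y}"
        define D where "D = {y \<in> A.cell. A.zeros y \<in> ?D}"
        have aF: "a \<in> F" using a aS by (auto simp: F_def)
        have F_up: "A.zeros y \<in> \<D>" if "y \<in> F" for y
          using that psubset.prems(2)[OF S] by (auto simp: F_def)
        have m0: "m y = 0 \<longleftrightarrow> y = a" if "y \<in> F" for y
        proof
          show "m y = 0 \<Longrightarrow> y = a"
            using A.gauge_eq_0[OF a] that aS by (auto simp: m_def F_def)
          have "m a = 0" using A.gauge_ray[of 0 a a] by (simp add: m_def)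
          then show "y = a \<Longrightarrow> m y = 0" by simp
        qed
        have m_nonneg: "0 \<le> m y" for y by (simp add: m_def A.gauge_nonneg)
        have m_le: "m y \<le> 1" if "y \<in> F" for y using that A.gauge_le_1[OF a] by (auto simp: F_def m_def)
        have m1: "m y = 1 \<longleftrightarrow> y \<in> D" if "y \<in> F" for y
          using that A.gauge_eq_1[OF a, of y] aS F_up[OF that] by (auto simp: F_def D_def m_def)
        have r: "r y \<in> D \<and> r y \<in> F" if "y \<in> F" "y \<noteq> a" for y
        proof -
          have "m y > 0" using m0[OF that(1)] that m_nonneg[of y] by force
          then have "r y \<in> A.cell" "S \<subseteq> A.zeros (r y)" "m (r y) = 1"
            using A.ray_cell[OF a, of y "1 / m y"] A.gauge_ray[of "1 / m y" a y] that aS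
            by (auto simp: r_def m_def F_def)
          then show ?thesis using m1[of "r y"] by (auto simp: F_def)
        qed
        have fD: "f z \<in> X.cell" "X.zeros (f z) = A.zeros z" if "z \<in> D" for z
          using f that by (auto simp: good_def D_def)
        have h_ray: "h y = X.ray x (m y) (f (r y))" for y by (simp add: h_def X.ray_def)
        have fr: "f (r y) \<in> X.cell" "X.zeros x \<subseteq> X.zeros (f (r y))" "X.gauge_at x (f (r y)) = 1"
          if "y \<in> F" "y \<noteq> a" for y
        proof -
          show 1: "f (r y) \<in> X.cell" using r[OF that] fD by auto
          show 2: "X.zeros x \<subseteq> X.zeros (f (r y))" using r[OF that] fD xS by (auto simp: F_def)
          have "X.zeros (f (r y)) \<noteq> X.zeros x" using r[OF that] fD xS by (auto simp: D_def)
          then show "X.gauge_at x (f (r y)) = 1" using X.gauge_eq_1[OF x 1 2] by simp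
        qed
        have h_D: "h y = f y" if "y \<in> F" "y \<in> D" for y
          using m1[OF that(1)] that by (simp add: h_def r_def)
        have h_a: "h a = x" using m0[OF aF] by (simp add: h_def)
        \<comment> \<open>The radial parameter can thus be recovered from the image, which gives
          injectivity of \<open>h\<close>.\<close>
        have h_gauge: "X.gauge_at x (h y) = m y" if "y \<in> F" for y
        proof (cases "y = a")
          case True
          then show ?thesis
            using m0[OF aF] X.gauge_ray[of 0 x x] by (simp add: h_a)
        next
          case False
          then show ?thesis using fr[OF that False] X.gauge_ray[of "m y" x "f (r y)"] m_nonneg
            by (simp add: h_ray)
        qed
        have h_cell: "h y \<in> X.cell \<and> S \<subseteq> X.zeros (h y)" if "y \<in> F" for y
        proof (cases "y = a")
          case False
          then show ?thesis
            using X.ray_cell[OF x fr(1,2)[OF that False], of "m y"] m_le[OF that] m_nonneg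
              fr(3)[OF that False] xS
            by (simp add: h_ray)
        qed (use h_a x xS in auto)
        have h_zeros: "X.zeros (h y) = A.zeros y" if "y \<in> F" for y
        proof (cases "y \<in> D")
          case True
          then show ?thesis using h_D[OF that] fD by simp
        next
          case False
          then have "m y \<noteq> 1" using m1 that by blast
          then have "X.zeros (h y) = S"
            using X.gauge_eq_1[OF x, of "h y"] h_gauge h_cell[OF that] xS that by auto
          moreover have "A.zeros y = S" using False F_up[OF that] that by (auto simp: D_def F_def)
          ultimately show ?thesis by simp
        qed
        have cont_h: "continuous_on F h"
          unfolding h_def
        proof (rule radial_continuous[OF _ aF m0])
          show m_cont: "continuous_on F m"
            unfolding m_def using A.continuous_gauge continuous_on_subset by blast
          have "continuous_on (F - {a}) r"
            unfolding r_def A.ray_def using m0 continuous_on_subset[OF m_cont, of "F - {a}"]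
            by (intro continuous_intros) auto
          moreover have "r ` (F - {a}) \<subseteq> D" using r by auto
          moreover have "continuous_on D f" using f by (simp add: good_def D_def)
          ultimately show "continuous_on (F - {a}) (\<lambda>y. f (r y))"
            by (metis continuous_on_compose2)
          have "bounded X.cell" using X.compact_cell compact_imp_bounded by (simp add: X.cell_def)
          then show "bounded ((\<lambda>y. f (r y)) ` (F - {a}))"
            by (rule bounded_subset) (use fr in auto)
        qed auto
        define g where "g y = (if y \<in> F then h y else f y)" for y
        have dom: "{y \<in> A.cell. A.zeros y \<in> \<D>} = F \<union> D"
          using S F_up by (auto simp: F_def D_def)
        \<comment> \<open>The glueing requires both pieces to be closed; upward closure turns
          \<open>D\<close> into a finite union of closed faces.\<close>
        have closed_D: "closed D"
        proof -
          have "D = (\<Union>S'\<in>?D. {y \<in> A.cell. S' \<subseteq> A.zeros y})"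
            using psubset.prems(2) S_min by (auto simp: D_def)
          then show ?thesis using psubset(1) closed_face by auto
        qed
        have "continuous_on (F \<union> D) g"
          unfolding g_def
        proof (rule continuous_on_If)
          show "closed F" using closed_face[of S] by (simp add: F_def)
          show "closed D" by (fact closed_D)
          show "continuous_on D f" using f by (simp add: good_def D_def)
        qed (use cont_h h_D in auto)
        moreover have g_cell: "g y \<in> X.cell \<and> X.zeros (g y) = A.zeros y" if "y \<in> F \<union> D" for y
          using that h_cell h_zeros fD by (auto simp: g_def)
        moreover have "inj_on g (F \<union> D)"
        proof (rule inj_onI)
          fix y z assume yz: "y \<in> F \<union> D" "z \<in> F \<union> D" and eq: "g y = g z"
          have Z: "A.zeros y = A.zeros z" using g_cell yz eq by metis
          then have F_iff: "y \<in> F \<longleftrightarrow> z \<in> F" using yz by (auto simp: F_def D_def)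
          have inj_f: "inj_on f D" using f by (simp add: good_def D_def)
          show "y = z"
          proof (cases "y \<in> F")
            case False
            then show ?thesis using F_iff yz eq inj_f by (auto simp: g_def inj_on_def)
          next
            case True
            then have hh: "h y = h z" and zF: "z \<in> F" using F_iff eq by (auto simp: g_def)
            then have mm: "m y = m z" using h_gauge True by metis
            show ?thesis
            proof (cases "y = a")
              case True
              then show ?thesis using mm m0 zF aF by metis
            next
              case False
              then have za: "z \<noteq> a" and my: "m y \<noteq> 0" using mm m0 True zF by metis+
              then have "f (r y) = f (r z)" using hh mm by (simp add: h_def)
              then have "r y = r z" using inj_f r True zF za False by (auto simp: inj_on_def)
              then have "A.ray a (m y) (r y) = A.ray a (m z) (r z)" using mm by simp
              then show ?thesis using my mm by (simp add: r_def A.ray_ray)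
            qed
          qed
        qed
        ultimately have "good \<D> g" unfolding good_def dom using dom by blast
        then show ?thesis by blast
      qed
    qed
  qed
  from this[of "Pow V"] obtain f where "good (Pow V) f" by (auto simp: A.zeros_def)
  moreover have "{y \<in> A.cell. A.zeros y \<in> Pow V} = A.cell" by (auto simp: A.zeros_def)
  ultimately show ?thesis using that[of f] unfolding good_def by (auto simp: A.zeros_def)
qed

section \<open>Compactness, dense open cells and invariance of domain\<close>

lemma Hausdorff_space_fun2: "Hausdorff_space (euclidean :: ('b \<Rightarrow> 'c \<Rightarrow> real) topology)"
proof -
  have "Hausdorff_space (euclidean :: ('c \<Rightarrow> real) topology)"
    by (simp add: euclidean_product_topology[symmetric] Hausdorff_space_product_topology)
  then show ?thesis
    by (simp add: euclidean_product_topology[symmetric, where ?'a = 'b] Hausdorff_space_product_topology)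
qed

lemma compact_imp_closed_fun2:
  fixes S :: "('b \<Rightarrow> 'c \<Rightarrow> real) set"
  shows "compact S \<Longrightarrow> closed S"
  using compactin_imp_closedin[OF Hausdorff_space_fun2, of S] by simp

lemma homeomorphism_compact_fun2:
  fixes f :: "'a::topological_space \<Rightarrow> 'b \<Rightarrow> 'c \<Rightarrow> real"
  assumes "compact S" "continuous_on S f" "f ` S = T" "inj_on f S"
  shows "\<exists>g. homeomorphism S T f g"
proof -
  have "homeomorphic_map (top_of_set S) (top_of_set T) f"
    using assms
    by (intro continuous_imp_homeomorphic_map Hausdorff_space_subtopology Hausdorff_space_fun2)
      (auto simp: compact_space_subtopology)
  then obtain g where g: "homeomorphic_maps (top_of_set S) (top_of_set T) f g"
    by (auto simp: homeomorphic_map_maps)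
  then have inv: "\<And>x. x \<in> S \<Longrightarrow> g (f x) = x" "\<And>y. y \<in> T \<Longrightarrow> f (g y) = y"
    by (simp_all add: homeomorphic_maps_def)
  have "continuous_on T g" using g by (simp add: homeomorphic_maps_def)
  moreover have "g ` T = S" unfolding assms(3)[symmetric] image_image using inv(1) by simp
  ultimately show ?thesis using assms(2,3) inv by (auto simp: homeomorphism_def)
qed

context slack_system
begin

lemma open_cell_openin: "openin (top_of_set U) {y \<in> cell. zeros y = {}}"
proof -
  have "{y \<in> cell. zeros y = {}} = U \<inter> (\<Inter>v\<in>V. {y. 0 < s v y})"
    by (force simp: cell_def zeros_def)
  moreover have "open {y. 0 < s v y}" if "v \<in> V" for v
    using slack_cont[OF that] by (intro open_Collect_less) auto
  ultimately show ?thesis using finite_V by (simp add: openin_open_Int open_INT)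
qed

lemma open_cellI: "y \<in> U \<Longrightarrow> (\<And>v. v \<in> V \<Longrightarrow> 0 < s v y) \<Longrightarrow> y \<in> cell \<and> zeros y = {}"
proof -
  assume *: "y \<in> U" "\<And>v. v \<in> V \<Longrightarrow> 0 < s v y"
  have "0 \<le> s v y" "s v y \<noteq> 0" if "v \<in> V" for v using *(2)[OF that] by simp_all
  then show ?thesis using *(1) unfolding cell_def zeros_def by simp
qed

lemma open_cellD: "y \<in> cell \<Longrightarrow> zeros y = {} \<Longrightarrow> v \<in> V \<Longrightarrow> 0 < s v y"
  unfolding cell_def zeros_def by (metis (mono_tags, lifting) empty_Collect_eq less_eq_real_def mem_Collect_eq)

lemma open_cell_convex: "convex {y \<in> cell. zeros y = {}}"
proof -
  have "ray y r z \<in> {y \<in> cell. zeros y = {}}"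
    if "y \<in> {y \<in> cell. zeros y = {}}" "z \<in> {y \<in> cell. zeros y = {}}" "0 \<le> r" "r \<le> 1" for y z r
  proof -
    have yz: "y \<in> cell" "zeros y = {}" "z \<in> cell" "zeros z = {}" using that by auto
    have "0 < s v (ray y r z)" if v: "v \<in> V" for v
    proof -
      have pos: "0 < s v y" "0 < s v z" using open_cellD yz v by blast+
      show ?thesis
      proof (cases "r = 1")
        case False
        then have "0 < (1 - r) * s v y" "0 \<le> r * s v z" using pos \<open>0 \<le> r\<close> \<open>r \<le> 1\<close> by simp_all
        then show ?thesis unfolding slack_ray[OF v] by simp
      qed (simp add: pos)
    qed
    then show ?thesis using open_cellI[of "ray y r z"] ray_U yz by (simp add: cell_def)
  qed
  then show ?thesis unfolding convex_alt ray_def by blast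
qed

text \<open>Every point of the cell is a limit of points moved slightly towards the interior point
  \<open>a\<close>.\<close>

lemma open_cell_dense:
  assumes a: "a \<in> cell" "zeros a = {}" and Z: "closed Z" "{y \<in> cell. zeros y = {}} \<subseteq> Z"
  shows "cell \<subseteq> Z"
proof
  fix y assume y: "y \<in> cell"
  define r where "r m = inverse (real (Suc m))" for m
  have "ray y (r m) a \<in> Z" for m
  proof -
    have r: "0 < r m" "r m \<le> 1" by (auto simp: r_def divide_simps)
    have "0 < s v (ray y (r m) a)" if "v \<in> V" for v
    proof -
      have "0 < s v a" "0 \<le> s v y" using open_cellD[OF a that] y that by (simp_all add: cell_def)
      then show ?thesis unfolding slack_ray[OF that] using r by (intro add_nonneg_pos) auto
    qed
    then have "ray y (r m) a \<in> cell \<and> zeros (ray y (r m) a) = {}"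
      using ray_U a(1) y by (intro open_cellI) (auto simp: cell_def)
    then show ?thesis using Z by blast
  qed
  moreover have "(\<lambda>m. ray y (r m) a) \<longlonglongrightarrow> (1 - 0) *\<^sub>R y + 0 *\<^sub>R a"
    unfolding ray_def r_def by (intro tendsto_intros LIMSEQ_inverse_real_of_nat)
  ultimately show "y \<in> Z" using closed_sequentially[OF Z(1), of "\<lambda>m. ray y (r m) a" y] by simp
qed

end

text \<open>Invariance of domain makes the image open, because source and target lie in the same
  subspace; being relatively closed as well, it exhausts the connected set \<open>T\<close>.\<close>

lemma clopen_surj:
  fixes f :: "'a::euclidean_space \<Rightarrow> 'a"
  assumes U: "subspace U" and S: "openin (top_of_set U) S" "S \<noteq> {}"
    and T: "T \<subseteq> U" "connected T"
    and f: "continuous_on S f" "inj_on f S" "f ` S \<subseteq> T"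
    and cl: "closedin (top_of_set T) (f ` S)"
  shows "f ` S = T"
proof -
  have "openin (top_of_set U) (f ` S)"
    using f T by (intro invariance_of_domain_subspaces[OF S(1) U U]) auto
  then have "openin (top_of_set T) (f ` S)" using f(3) T(1) openin_subset_trans by blast
  then show ?thesis using T(2) cl S(2) unfolding connected_clopen by blast
qed

text \<open>The open cells correspond by \<open>clopen_surj\<close>, and a closed image containing
  the open cell contains the cell. The interior point keeps the open cell from being empty.\<close>

lemma slack_system_homeomorphism:
  fixes s t :: "'v \<Rightarrow> 'a::euclidean_space \<Rightarrow> real"
  assumes U: "subspace U" and A: "slack_system U V s" and X: "slack_system U V t"
    and patterns: "\<And>y. y \<in> slack_system.cell U V s \<Longrightarrow>
      \<exists>x\<in>slack_system.cell U V t. slack_system.zeros V t x = slack_system.zeros V s y"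
    and interior: "\<exists>a\<in>slack_system.cell U V s. slack_system.zeros V s a = {}"
  obtains f g where "homeomorphism (slack_system.cell U V s) (slack_system.cell U V t) f g"
    "\<And>y. y \<in> slack_system.cell U V s \<Longrightarrow> slack_system.zeros V t (f y) = slack_system.zeros V s y"
proof -
  interpret A: slack_system U V s by fact
  interpret X: slack_system U V t by fact
  obtain f where f: "continuous_on A.cell f" "inj_on f A.cell" "\<And>y. y \<in> A.cell \<Longrightarrow> f y \<in> X.cell"
    "\<And>y. y \<in> A.cell \<Longrightarrow> X.zeros (f y) = A.zeros y"
    using slack_system_embedding[OF A X patterns] by blast
  obtain a where a: "a \<in> A.cell" "A.zeros a = {}" using interior by blast
  define S where "S = {y \<in> A.cell. A.zeros y = {}}"
  define T where "T = {y \<in> X.cell. X.zeros y = {}}"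
  have compact_A: "compact A.cell" using A.compact_cell by (simp add: A.cell_def)
  have closed_image: "closed (f ` A.cell)"
    using compact_A f(1) compact_continuous_image compact_imp_closed by blast
  \<comment> \<open>As patterns are preserved, the image of the open cell is the part of a compact
    image that lies in \<open>T\<close>, hence relatively closed.\<close>
  have fS: "f ` S = T \<inter> f ` A.cell" using f(3,4) by (auto simp: S_def T_def)
  have "f ` S = T"
  proof (rule clopen_surj[OF U])
    show "openin (top_of_set U) S" unfolding S_def by (rule A.open_cell_openin)
    show "S \<noteq> {}" using a by (auto simp: S_def)
    show "T \<subseteq> U" by (auto simp: T_def X.cell_def)
    show "connected T" unfolding T_def by (rule convex_connected[OF X.open_cell_convex])
    show "continuous_on S f" "inj_on f S"
      using f(1,2) by (auto simp: S_def intro: continuous_on_subset inj_on_subset)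
    show "f ` S \<subseteq> T" using fS by blast
    show "closedin (top_of_set T) (f ` S)"
      unfolding fS using closed_image by (rule closedin_closed_Int)
  qed
  then have T_sub: "T \<subseteq> f ` A.cell" using fS by blast
  have "X.cell \<subseteq> f ` A.cell"
    using X.open_cell_dense[of "f a", OF f(3)[OF a(1)] _ closed_image] f(4)[OF a(1)] a(2) T_sub
    by (simp add: T_def)
  then have "f ` A.cell = X.cell" using f(3) by blast
  then obtain g where "homeomorphism A.cell X.cell f g"
    using homeomorphism_compact[OF compact_A f(1) _ f(2)] by blast
  then show ?thesis using that f(4) by blast
qed

text \<open>With an orthonormal basis \<open>h\<close> of \<open>U\<close>, take \<open>h\<close>
  for the first \<open>n - 1\<close> vectors \<open>e\<close> and minus their sum for the last: the
  numbers \<open>y \<bullet> e i\<close> then run over all vectors with sum zero. The first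
  \<open>n - 1\<close> of them determine \<open>y\<close>, so \<open>b\<close> is \<open>h\<close>
  followed by a zero. This places sequences and the polar dual in one space, as invariance of domain
  requires.\<close>

lemma zero_sum_coordinates:
  fixes U :: "'a::euclidean_space set"
  assumes U: "subspace U" and dim: "dim U + 1 = n"
  obtains e b :: "int \<Rightarrow> 'a" where
    "\<And>i. e (i + int n) = e i" "\<And>i. e i \<in> U" "\<And>i. b i \<in> U" "(\<Sum>i\<in>{1..int n}. e i) = 0"
    "\<And>v j. (\<Sum>i\<in>{1..int n}. v i) = (0::real) \<Longrightarrow> j \<in> {1..int n} \<Longrightarrow>
      (\<Sum>i\<in>{1..int n}. v i *\<^sub>R b i) \<bullet> e j = v j"
    "\<And>y. y \<in> U \<Longrightarrow> (\<Sum>i\<in>{1..int n}. (y \<bullet> e i) *\<^sub>R b i) = y"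
proof -
  obtain B where B: "B \<subseteq> U" "pairwise orthogonal B" "\<And>x. x \<in> B \<Longrightarrow> norm x = 1"
    "independent B" "card B = dim U" "span B = U"
    using orthonormal_basis_subspace[OF U] by blast
  have finB: "finite B" using B(4) independent_imp_finite by blast
  have "card {1..<int n} = card B" using dim B(5) by simp
  then obtain h where h: "bij_betw h {1..<int n} B"
    using finite_same_card_bij[of "{1..<int n}" B] finB by auto
  have n1: "1 \<le> int n" using dim by simp
  have split: "{1..int n} = insert (int n) {1..<int n}" using n1 by auto
  have hh: "h i \<bullet> h j = (if i = j then 1 else 0)" if "i \<in> {1..<int n}" "j \<in> {1..<int n}" for i j
  proof (cases "i = j")
    case True
    have "h i \<in> B" using h that bij_betwE by blast
    then show ?thesis using True B(3)[of "h i"] by (simp add: norm_eq_1)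
  next
    case False
    have "h i \<noteq> h j" "h i \<in> B" "h j \<in> B"
      using False h that bij_betwE by (auto simp: bij_betw_def inj_on_def)
    then show ?thesis using B(2) False by (auto simp: pairwise_def orthogonal_def)
  qed
  define e0 where "e0 i = (if i = int n then - (\<Sum>k\<in>{1..<int n}. h k) else h i)" for i
  \<comment> \<open>The shift by 1 puts the representatives of residues into \<open>{1..n}\<close>,
    so that \<open>n\<close> and not 0 receives the special vector.\<close>
  define e where "e i = e0 ((i - 1) mod int n + 1)" for i
  define b where "b i = (if i \<in> {1..<int n} then h i else 0)" for i
  have e_in: "e i = e0 i" if "i \<in> {1..int n}" for i using that by (simp add: e_def)
  have hU: "h i \<in> U" if "i \<in> {1..<int n}" for i using h that B(1) bij_betwE by blast
  have e0U: "e0 i \<in> U" if "i \<in> {1..int n}" for i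
    using that hU U by (auto simp: e0_def split intro!: subspace_neg subspace_sum)
  show ?thesis
  proof (rule that[of e b])
    show "e (i + int n) = e i" for i
    proof -
      have "(i + int n - 1) mod int n = (i - 1) mod int n"
        by (metis add_diff_eq add.commute diff_add_eq mod_add_self2)
      then show ?thesis by (simp add: e_def)
    qed
    show "e i \<in> U" for i
    proof -
      have "(i - 1) mod int n < int n" "0 \<le> (i - 1) mod int n"
        using n1 by (auto intro: pos_mod_bound pos_mod_sign)
      then have "(i - 1) mod int n + 1 \<in> {1..int n}" by simp
      then show ?thesis unfolding e_def by (rule e0U)
    qed
    show "b i \<in> U" for i using hU subspace_0[OF U] by (simp add: b_def)
    have sum_e0: "(\<Sum>i\<in>{1..<int n}. e0 i) = (\<Sum>i\<in>{1..<int n}. h i)"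
      by (rule sum.cong) (auto simp: e0_def)
    show "(\<Sum>i\<in>{1..int n}. e i) = 0"
    proof -
      have "(\<Sum>i\<in>{1..int n}. e i) = (\<Sum>i\<in>{1..int n}. e0 i)" by (rule sum.cong) (auto simp: e_in)
      also have "\<dots> = e0 (int n) + (\<Sum>i\<in>{1..<int n}. e0 i)" by (simp add: split)
      finally show ?thesis unfolding sum_e0 by (simp add: e0_def)
    qed
    have b_sum: "(\<Sum>i\<in>{1..int n}. v i *\<^sub>R b i) = (\<Sum>i\<in>{1..<int n}. v i *\<^sub>R h i)" for v
      unfolding split by (simp add: b_def)
    have dot: "(\<Sum>i\<in>{1..<int n}. v i *\<^sub>R h i) \<bullet> h j = v j" if "j \<in> {1..<int n}" for v j
    proof -
      have "(\<Sum>i\<in>{1..<int n}. v i *\<^sub>R h i) \<bullet> h j = (\<Sum>i\<in>{1..<int n}. if i = j then v i else 0)"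
        unfolding inner_sum_left by (rule sum.cong) (use hh that in auto)
      then show ?thesis using that by simp
    qed
    show "(\<Sum>i\<in>{1..int n}. v i *\<^sub>R b i) \<bullet> e j = v j"
      if v: "(\<Sum>i\<in>{1..int n}. v i) = (0::real)" and j: "j \<in> {1..int n}" for v j
    proof (cases "j = int n")
      case True
      have "(\<Sum>i\<in>{1..<int n}. v i *\<^sub>R h i) \<bullet> e j = - (\<Sum>k\<in>{1..<int n}. v k)"
      proof -
        have "e j = - (\<Sum>k\<in>{1..<int n}. h k)" using e_in[OF j] True by (simp add: e0_def)
        moreover have "(\<Sum>k\<in>{1..<int n}. (\<Sum>i\<in>{1..<int n}. v i *\<^sub>R h i) \<bullet> h k) = (\<Sum>k\<in>{1..<int n}. v k)"
          by (rule sum.cong) (auto simp: dot)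
        ultimately show ?thesis by (simp add: inner_sum_right)
      qed
      also have "\<dots> = v j" using v True by (simp add: split)
      finally show ?thesis by (simp add: b_sum)
    next
      case False
      then show ?thesis using j dot by (simp add: b_sum e_in e0_def)
    qed
    show "(\<Sum>i\<in>{1..int n}. (y \<bullet> e i) *\<^sub>R b i) = y" if y: "y \<in> U" for y
    proof -
      define w where "w = (\<Sum>i\<in>{1..<int n}. (y \<bullet> h i) *\<^sub>R h i)"
      have wU: "w \<in> U" unfolding w_def using U hU by (intro subspace_sum subspace_scale) auto
      have "orthogonal (y - w) (y - w)"
      proof (rule orthogonal_to_span[of _ B])
        show "y - w \<in> span B" using y wU U B(6) by (simp add: subspace_diff)
        fix x assume "x \<in> B"
        then obtain j where j: "j \<in> {1..<int n}" "x = h j" using h by (auto simp: bij_betw_def)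
        then show "orthogonal (y - w) x"
          using dot[OF j(1), of "\<lambda>i. y \<bullet> h i"] by (simp add: orthogonal_def w_def inner_diff_left)
      qed
      then have "y = w" by (simp add: orthogonal_self)
      moreover have "(\<Sum>i\<in>{1..int n}. (y \<bullet> e i) *\<^sub>R b i) = w"
        unfolding b_sum w_def by (rule sum.cong) (auto simp: e_in e0_def)
      ultimately show ?thesis by simp
    qed
  qed
qed

section \<open>Affine posets and pipes\<close>

text \<open>Finiteness of the set of classes is inherited from the polytope \<open>Q\<close>, whose
  vertices correspond to them.\<close>

locale affine_setting =
  fixes n :: nat and le :: "int \<Rightarrow> int \<Rightarrow> bool" and c :: real
  assumes affine: "affine_poset n le" and c_pos: "c > 0"
    and finite_classes: "finite (pipe_class n ` {\<tau>. proper_pipe n le \<tau>})"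
begin

abbreviation cov :: "int \<Rightarrow> int \<Rightarrow> bool" where
  "cov \<equiv> covers_in le UNIV"

abbreviation pp :: "int set \<Rightarrow> bool" where
  "pp \<equiv> proper_pipe n le"

abbreviation sh :: "int \<Rightarrow> int set \<Rightarrow> int set" where
  "sh \<equiv> shift n"

lemma n_pos: "0 < n"
  using affine by (auto simp: affine_poset_def)

lemma le_refl [simp]: "le i i"
  using affine by (simp add: affine_poset_def reflpD)

lemma le_trans: "le i j \<Longrightarrow> le j k \<Longrightarrow> le i k"
  using affine by (meson affine_poset_def transpD)

lemma le_antisym: "le i j \<Longrightarrow> le j i \<Longrightarrow> i = j"
  using affine by (meson affine_poset_def antisympD)

lemma le_shift_nat: "le (i + int d * int n) (j + int d * int n) \<longleftrightarrow> le i j"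
proof (induction d)
  case (Suc d)
  have "le (i + int d * int n + int n) (j + int d * int n + int n) \<longleftrightarrow>
      le (i + int d * int n) (j + int d * int n)"
    using affine by (simp add: affine_poset_def)
  then show ?case using Suc by (simp add: algebra_simps)
qed simp

lemma le_shift: "le (i + d * int n) (j + d * int n) \<longleftrightarrow> le i j"
proof (cases "d \<ge> 0")
  case True
  then show ?thesis using le_shift_nat[of i "nat d" j] by simp
next
  case False
  then show ?thesis using le_shift_nat[of "i + d * int n" "nat (-d)" "j + d * int n"] by simp
qed

lemma le_up: "0 \<le> d \<Longrightarrow> le i (i + d * int n)"
proof (induction d rule: int_ge_induct)
  case (step d)
  have "le (i + d * int n) (i + d * int n + int n)"
    using affine by (simp add: affine_poset_def)
  moreover have "i + (d + 1) * int n = i + d * int n + int n" by (simp add: algebra_simps)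
  ultimately show ?case using step(2) le_trans by metis
qed simp

lemma le_shift_self: "le (i + d * int n) (i + e * int n) \<Longrightarrow> d \<le> e"
proof (rule ccontr)
  assume "le (i + d * int n) (i + e * int n)" "\<not> d \<le> e"
  moreover from this have "le (i + e * int n) (i + e * int n + (d - e) * int n)"
    by (intro le_up) simp
  ultimately have "i + d * int n = i + e * int n"
    by (intro le_antisym) (auto simp: algebra_simps)
  then show False using \<open>\<not> d \<le> e\<close> n_pos by simp
qed

lemma le_cofinal: "\<exists>k::nat. le i (j + int k * int n)"
  using affine by (simp add: affine_poset_def)

lemma le_coinitial: "\<exists>k::nat. le (i - int k * int n) j"
proof -
  obtain k :: nat where "le i (j + int k * int n)" using le_cofinal by blast
  then have "le (i + (- int k) * int n) (j + int k * int n + (- int k) * int n)"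
    by (simp only: le_shift)
  then show ?thesis by (intro exI[of _ k]) (simp add: algebra_simps)
qed

text \<open>Each of the \<open>n\<close> residue classes is cut off above and below by cofinality.
  This local finiteness is what makes saturated chains exist.\<close>

lemma finite_interval: "finite {k. le i k \<and> le k j}"
proof -
  obtain hi :: "int \<Rightarrow> nat" where hi: "\<And>r. le j (r + int (hi r) * int n)"
    using le_cofinal by metis
  define lo where "lo r = (SOME k::nat. le (r - int k * int n) i)" for r
  have lo: "le (r - int (lo r) * int n) i" for r
    unfolding lo_def by (rule someI_ex) (rule le_coinitial)
  have "{k. le i k \<and> le k j} \<subseteq>
      (\<Union>r\<in>{0..<int n}. (\<lambda>d. r + d * int n) ` {- int (lo r)..int (hi r)})"
  proof
    fix k assume k: "k \<in> {k. le i k \<and> le k j}"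
    define r d where "r = k mod int n" and "d = k div int n"
    have kr: "k = r + d * int n" by (simp add: r_def d_def)
    have "le (r + d * int n) (r + int (hi r) * int n)"
      using k hi[of r] kr le_trans by blast
    then have "d \<le> int (hi r)" by (rule le_shift_self)
    moreover have "le (r - int (lo r) * int n) k" using k lo[of r] le_trans by blast
    then have "le (r + (- int (lo r)) * int n) (r + d * int n)" using kr by simp
    then have "- int (lo r) \<le> d" by (rule le_shift_self)
    moreover have "r \<in> {0..<int n}" using n_pos by (simp add: r_def)
    ultimately show "k \<in> (\<Union>r\<in>{0..<int n}. (\<lambda>d. r + d * int n) ` {- int (lo r)..int (hi r)})"
      using kr by (intro UN_I[of r] image_eqI[of _ _ d]) auto
  qed
  then show ?thesis by (rule finite_subset) auto
qed

lemma cov_iff: "cov i j \<longleftrightarrow> strict le i j \<and> \<not> (\<exists>k. strict le i k \<and> strict le k j)"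
  by (simp add: covers_in_def)

lemma cov_le: "cov i j \<Longrightarrow> le i j"
  by (simp add: cov_iff strict_def)

lemma cov_neq: "cov i j \<Longrightarrow> i \<noteq> j"
  by (simp add: cov_iff strict_def)

text \<open>Splitting at an intermediate element strictly shrinks the finite interval. The bounds
  built into the relation keep the chain inside every order-convex set containing both ends.\<close>

lemma saturated_chain:
  "le a b \<Longrightarrow> (a, b) \<in> {(p, q). cov p q \<and> le a p \<and> le q b}\<^sup>*"
proof (induction "card {k. le a k \<and> le k b}" arbitrary: a b rule: less_induct)
  case less
  show ?case
  proof (cases "a = b \<or> cov a b")
    case True
    then show ?thesis by (auto intro: r_into_rtrancl)
  next
    case False
    then obtain k where k: "strict le a k" "strict le k b"
      using less.prems by (auto simp: cov_iff strict_def)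
    then have k': "le a k" "le k b" "k \<noteq> a" "k \<noteq> b" by (auto simp: strict_def)
    have "b \<notin> {l. le a l \<and> le l k}" using k' le_antisym by blast
    moreover have "{l. le a l \<and> le l k} \<subseteq> {l. le a l \<and> le l b}" using k' le_trans by blast
    ultimately have "{l. le a l \<and> le l k} \<subset> {l. le a l \<and> le l b}" using less.prems by auto
    then have "(a, k) \<in> {(p, q). cov p q \<and> le a p \<and> le q k}\<^sup>*"
      using less.hyps k' finite_interval by (simp add: psubset_card_mono)
    then have 1: "(a, k) \<in> {(p, q). cov p q \<and> le a p \<and> le q b}\<^sup>*"
      by (rule rtrancl_mono[THEN subsetD, rotated]) (use k' le_trans in blast)
    have "a \<notin> {l. le k l \<and> le l b}" using k' le_antisym by blast
    moreover have "{l. le k l \<and> le l b} \<subseteq> {l. le a l \<and> le l b}" using k' le_trans by blast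
    ultimately have "{l. le k l \<and> le l b} \<subset> {l. le a l \<and> le l b}" using less.prems by auto
    then have "(k, b) \<in> {(p, q). cov p q \<and> le k p \<and> le q b}\<^sup>*"
      using less.hyps k' finite_interval by (simp add: psubset_card_mono)
    then have "(k, b) \<in> {(p, q). cov p q \<and> le a p \<and> le q b}\<^sup>*"
      by (rule rtrancl_mono[THEN subsetD, rotated]) (use k' le_trans in blast)
    with 1 show ?thesis by simp
  qed
qed

lemma strict_shift: "strict le (i + d * int n) (j + d * int n) \<longleftrightarrow> strict le i j"
  by (simp add: strict_def le_shift)

lemma cov_shift: "cov (i + d * int n) (j + d * int n) \<longleftrightarrow> cov i j"
proof -
  have "(\<exists>k. strict le (i + d * int n) k \<and> strict le k (j + d * int n)) \<longleftrightarrow>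
      (\<exists>k. strict le i k \<and> strict le k j)"
    by (metis diff_add_cancel strict_shift)
  then show ?thesis by (simp add: cov_iff strict_shift)
qed

section \<open>Paths in the Hasse diagram and proper pipes\<close>

definition adj :: "int set \<Rightarrow> (int \<times> int) set" where
  "adj \<tau> = {(a, b). a \<in> \<tau> \<and> b \<in> \<tau> \<and> (cov a b \<or> cov b a)}"

lemma hasse_connected_iff: "hasse_connected le \<tau> \<longleftrightarrow> (\<forall>i\<in>\<tau>. \<forall>j\<in>\<tau>. (i, j) \<in> (adj \<tau>)\<^sup>*)"
  by (simp add: hasse_connected_def adj_def)

lemma adj_mono: "\<sigma> \<subseteq> \<tau> \<Longrightarrow> adj \<sigma> \<subseteq> adj \<tau>"
  by (auto simp: adj_def)

lemma adj_rtrancl_mono: "(i, j) \<in> (adj \<sigma>)\<^sup>* \<Longrightarrow> \<sigma> \<subseteq> \<tau> \<Longrightarrow> (i, j) \<in> (adj \<tau>)\<^sup>*"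
  using rtrancl_mono[OF adj_mono] by blast

lemma sym_adj: "(i, j) \<in> (adj \<tau>)\<^sup>* \<Longrightarrow> (j, i) \<in> (adj \<tau>)\<^sup>*"
  by (rule symD[OF sym_rtrancl]) (auto simp: adj_def sym_def)

lemma chain_adj:
  assumes "order_convex le \<tau>" "a \<in> \<tau>" "b \<in> \<tau>" "le a b"
  shows "(a, b) \<in> (adj \<tau>)\<^sup>*"
proof -
  have between: "k \<in> \<tau>" if "le a k" "le k b" for k
    using assms that unfolding order_convex_def strict_def by blast
  have "{(p, q). cov p q \<and> le a p \<and> le q b} \<subseteq> adj \<tau>"
    using between cov_le le_trans unfolding adj_def by blast
  then show ?thesis using saturated_chain[OF assms(4)] rtrancl_mono by blast
qed

lemma leaving_edge:
  assumes "(i, k) \<in> (adj \<tau>)\<^sup>*" "i \<in> S" "k \<notin> S"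
  obtains a b where "(a, b) \<in> adj \<tau>" "a \<in> S" "b \<notin> S"
  using assms by (induction rule: rtrancl_induct) blast+

lemma order_convex_UNIV: "order_convex le UNIV"
  by (simp add: order_convex_def)

text \<open>Both \<open>i\<close> and \<open>j\<close> lie below a common translate of
  \<open>j\<close>.\<close>

lemma hasse_connected_UNIV: "hasse_connected le UNIV"
  unfolding hasse_connected_iff
proof (intro ballI)
  fix i j :: int
  obtain k :: nat where k: "le i (j + int k * int n)" using le_cofinal by blast
  have "(i, j + int k * int n) \<in> (adj UNIV)\<^sup>*" using k by (intro chain_adj order_convex_UNIV) auto
  moreover have "(j, j + int k * int n) \<in> (adj UNIV)\<^sup>*"
    by (intro chain_adj order_convex_UNIV le_up) auto
  ultimately show "(i, j) \<in> (adj UNIV)\<^sup>*" using sym_adj rtrancl_trans by fast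
qed

lemma nontriv_UNIV: "nontriv_pipe n le UNIV"
  using order_convex_UNIV hasse_connected_UNIV
  by (simp add: nontriv_pipe_def pipe_def is_singleton_altdef)

lemma pp_nontriv: "pp \<tau> \<Longrightarrow> nontriv_pipe n le \<tau>"
  by (simp add: proper_pipe_def)

lemma nontriv_iff: "nontriv_pipe n le \<tau> \<longleftrightarrow> \<tau> = UNIV \<or> pp \<tau>"
  using nontriv_UNIV by (auto simp: proper_pipe_def)

lemma residue_UNIV: "\<exists>i j::int. i mod int n = j mod int n \<and> i \<noteq> j"
  using n_pos by (intro exI[of _ 0] exI[of _ "int n"]) auto

lemma pp_iff: "pp \<tau> \<longleftrightarrow> \<tau> \<noteq> {} \<and> \<not> is_singleton \<tau> \<and> order_convex le \<tau> \<and> hasse_connected le \<tau> \<and>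
    (\<forall>i\<in>\<tau>. \<forall>j\<in>\<tau>. i mod int n = j mod int n \<longrightarrow> i = j)"
  using residue_UNIV by (auto simp: proper_pipe_def nontriv_pipe_def pipe_def)

lemma pipe_iff: "pipe n le \<tau> \<longleftrightarrow> \<tau> = UNIV \<or> pp \<tau> \<or> is_singleton \<tau>"
proof -
  have "order_convex le {i}" "hasse_connected le {i}" for i
    using le_antisym by (auto simp: order_convex_def hasse_connected_iff strict_def)
  then have "pipe n le \<tau>" if "is_singleton \<tau>"
    using that by (auto simp: is_singleton_def pipe_def)
  moreover have "nontriv_pipe n le \<tau>" if "pipe n le \<tau>" "\<not> is_singleton \<tau>"
    using that by (simp add: nontriv_pipe_def)
  ultimately show ?thesis using nontriv_iff by (auto simp: nontriv_pipe_def)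
qed

lemma pp_convex: "pp \<tau> \<Longrightarrow> order_convex le \<tau>"
  and pp_connected: "pp \<tau> \<Longrightarrow> hasse_connected le \<tau>"
  and pp_nonempty: "pp \<tau> \<Longrightarrow> \<tau> \<noteq> {}"
  and pp_residue: "pp \<tau> \<Longrightarrow> i \<in> \<tau> \<Longrightarrow> j \<in> \<tau> \<Longrightarrow> i mod int n = j mod int n \<Longrightarrow> i = j"
  by (auto simp: pp_iff)

lemma pp_not_UNIV: "pp \<tau> \<Longrightarrow> \<tau> \<noteq> UNIV"
  by (simp add: proper_pipe_def)

lemma pp_finite: "pp \<tau> \<Longrightarrow> finite \<tau>" and pp_card: "pp \<tau> \<Longrightarrow> card \<tau> \<le> n"
proof -
  assume \<tau>: "pp \<tau>"
  have inj: "inj_on (\<lambda>i. i mod int n) \<tau>" using pp_residue[OF \<tau>] by (auto simp: inj_on_def)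
  have sub: "(\<lambda>i. i mod int n) ` \<tau> \<subseteq> {0..<int n}" using n_pos by auto
  show "finite \<tau>" using inj sub by (meson finite_atLeastLessThan_int finite_imageD finite_subset)
  show "card \<tau> \<le> n"
    using card_inj_on_le[OF inj sub] by simp
qed

definition edges :: "int set \<Rightarrow> (int \<times> int) set" where
  "edges \<tau> = {(i, j). i \<in> \<tau> \<and> j \<in> \<tau> \<and> cov i j}"

text \<open>Whatever lies between two members of a convex set belongs to it, so the covers of the
  induced order are covers of the whole poset.\<close>

lemma covers_in_convex:
  assumes "order_convex le \<tau>"
  shows "{(i, j). covers_in le \<tau> i j} = edges \<tau>"
proof -
  have "\<not> (\<exists>k. strict le i k \<and> strict le k j)"
    if "i \<in> \<tau>" "j \<in> \<tau>" "\<not> (\<exists>k\<in>\<tau>. strict le i k \<and> strict le k j)" for i j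
    using that assms unfolding order_convex_def by blast
  then show ?thesis unfolding edges_def covers_in_def by blast
qed

lemma alpha_edges: "pp \<tau> \<Longrightarrow> alpha le \<tau> x = (\<Sum>(i, j)\<in>edges \<tau>. x j - x i)"
  by (simp add: alpha_def covers_in_convex pp_convex)

text \<open>A generous common bound: a proper pipe has at most \<open>n\<close> elements, hence at
  most \<open>D\<close> covering pairs, and any two of its elements are joined by at most
  \<open>D\<close> steps.\<close>

abbreviation D :: real where "D \<equiv> (real n)\<^sup>2"

lemma D_ge_n: "real n \<le> D" and D_ge_1: "1 \<le> D"
  using n_pos by (auto simp: power2_eq_square)
    (metis One_nat_def Suc_leI mult_le_mono nat_mult_1 of_nat_1 of_nat_le_iff of_nat_mult)

lemma edges_finite: "pp \<tau> \<Longrightarrow> finite (edges \<tau>)"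
  by (rule finite_subset[of _ "\<tau> \<times> \<tau>"]) (auto simp: edges_def pp_finite)

lemma edges_card: "pp \<tau> \<Longrightarrow> real (card (edges \<tau>)) \<le> D"
proof -
  assume \<tau>: "pp \<tau>"
  have "card (edges \<tau>) \<le> card (\<tau> \<times> \<tau>)"
    by (rule card_mono) (auto simp: edges_def pp_finite[OF \<tau>])
  also have "\<dots> = card \<tau> * card \<tau>" by (simp add: card_cartesian_product)
  also have "\<dots> \<le> n * n" using pp_card[OF \<tau>] by (intro mult_le_mono)
  finally show ?thesis by (metis of_nat_le_iff of_nat_power power2_eq_square)
qed

lemma edges_sum_le:
  assumes "pp \<tau>" "\<And>i j. (i, j) \<in> edges \<tau> \<Longrightarrow> f i j \<le> B" "0 \<le> B"
  shows "(\<Sum>(i, j)\<in>edges \<tau>. f i j) \<le> D * (B::real)"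
proof -
  have "(\<Sum>(i, j)\<in>edges \<tau>. f i j) \<le> (\<Sum>(i, j)\<in>edges \<tau>. B)"
    using assms by (intro sum_mono) auto
  also have "\<dots> = real (card (edges \<tau>)) * B" by (simp add: case_prod_unfold)
  also have "\<dots> \<le> D * B" using edges_card[OF assms(1)] assms(3) by (intro mult_right_mono)
  finally show ?thesis .
qed

definition order_mono :: "(int \<Rightarrow> real) \<Rightarrow> bool" where
  "order_mono x \<longleftrightarrow> (\<forall>i j. le i j \<longrightarrow> x i \<le> x j)"

lemma edge_le_alpha:
  assumes x: "\<And>i j. (i, j) \<in> edges \<tau> \<Longrightarrow> x i \<le> x j" and \<tau>: "pp \<tau>" and ij: "(i, j) \<in> edges \<tau>"
  shows "x j - x i \<le> alpha le \<tau> x"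
proof -
  have "(\<lambda>(i, j). x j - x i) (i, j) \<le> (\<Sum>(i, j)\<in>edges \<tau>. x j - x i)"
    using x ij by (intro member_le_sum) (auto simp: edges_finite \<tau>)
  then show ?thesis by (simp add: alpha_edges \<tau>)
qed

text \<open>Each step of a Hasse path from \<open>i\<close> to \<open>j\<close> changes
  \<open>x\<close> by at most one summand of \<open>alpha\<close>. Thus a small \<open>alpha\<close>
  makes the whole pipe narrow.\<close>

lemma spread_le_alpha:
  assumes x: "order_mono x" and \<tau>: "pp \<tau>" and ij: "i \<in> \<tau>" "j \<in> \<tau>"
  shows "x i - x j \<le> D * alpha le \<tau> x"
proof -
  have up: "x a \<le> x b" if "(a, b) \<in> edges \<tau>" for a b
    using that x cov_le by (auto simp: edges_def order_mono_def)
  have alpha0: "0 \<le> alpha le \<tau> x"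
    unfolding alpha_edges[OF \<tau>] using up by (intro sum_nonneg) auto
  have step: "x a - x b \<le> alpha le \<tau> x" if "(a, b) \<in> adj \<tau>" for a b
  proof (cases "cov a b")
    case True
    then have "x a \<le> x b" using x cov_le by (auto simp: order_mono_def)
    then show ?thesis using alpha0 by simp
  next
    case False
    then have "(b, a) \<in> edges \<tau>" using that by (auto simp: adj_def edges_def)
    then show ?thesis using edge_le_alpha[of \<tau> x b a, OF up \<tau>] alpha0 by simp
  qed
  have fin: "finite (adj \<tau>)"
    by (rule finite_subset[of _ "\<tau> \<times> \<tau>"]) (auto simp: adj_def pp_finite[OF \<tau>])
  have "(i, j) \<in> (adj \<tau>)\<^sup>*" using pp_connected[OF \<tau>] ij by (simp add: hasse_connected_iff)
  then obtain m where m: "m \<le> card (adj \<tau>)" "(i, j) \<in> adj \<tau> ^^ m"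
    unfolding rtrancl_finite_eq_relpow[OF fin] by auto
  have "x i - x k \<le> real m * alpha le \<tau> x" if "(i, k) \<in> adj \<tau> ^^ m" for m k
    using that
  proof (induction m arbitrary: k)
    case (Suc m)
    then obtain l where l: "(i, l) \<in> adj \<tau> ^^ m" "(l, k) \<in> adj \<tau>" by auto
    then show ?case using Suc.IH[OF l(1)] step[OF l(2)] by (simp add: algebra_simps)
  qed simp
  from this[OF m(2)] have "x i - x j \<le> real m * alpha le \<tau> x" .
  also have "real m \<le> D"
  proof -
    have "card (adj \<tau>) \<le> card (\<tau> \<times> \<tau>)"
      by (rule card_mono) (auto simp: adj_def pp_finite[OF \<tau>])
    also have "\<dots> = card \<tau> * card \<tau>" by (simp add: card_cartesian_product)
    also have "\<dots> \<le> n * n" using pp_card[OF \<tau>] by (intro mult_le_mono)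
    finally have "m \<le> n * n" using m(1) by linarith
    then show ?thesis by (metis of_nat_le_iff of_nat_power power2_eq_square)
  qed
  then have "real m * alpha le \<tau> x \<le> D * alpha le \<tau> x" using alpha0 by (rule mult_right_mono)
  finally show ?thesis .
qed

section \<open>Translation by multiples of the period\<close>

lemma mem_sh: "i \<in> sh d \<tau> \<longleftrightarrow> i - d * int n \<in> \<tau>"
  by (force simp: shift_def)

lemma mem_sh' [simp]: "i + d * int n \<in> sh d \<tau> \<longleftrightarrow> i \<in> \<tau>"
  by (simp add: mem_sh)

lemma sh_0 [simp]: "sh 0 \<tau> = \<tau>" by (simp add: shift_def)

lemma sh_sh: "sh d (sh e \<tau>) = sh (d + e) \<tau>"
  by (auto simp: mem_sh algebra_simps)

lemma sh_UNIV [simp]: "sh d UNIV = UNIV" by (auto simp: mem_sh)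

lemma sh_subset [simp]: "sh d \<sigma> \<subseteq> sh d \<tau> \<longleftrightarrow> \<sigma> \<subseteq> \<tau>"
  unfolding shift_def by (intro inj_image_subset_iff) (auto simp: inj_def)

lemma sh_eq [simp]: "sh d \<sigma> = sh d \<tau> \<longleftrightarrow> \<sigma> = \<tau>"
  by (metis sh_subset subset_antisym subset_refl)

lemma card_sh [simp]: "card (sh d \<tau>) = card \<tau>"
  unfolding shift_def by (intro card_image) (auto simp: inj_on_def)

lemma pp_sh_imp: "pp \<tau> \<Longrightarrow> pp (sh d \<tau>)"
proof -
  assume \<tau>: "pp \<tau>"
  have "order_convex le (sh d \<tau>)"
    unfolding order_convex_def
  proof (intro ballI allI impI)
    fix i k j assume ik: "i \<in> sh d \<tau>" "k \<in> sh d \<tau>" and j: "strict le i j \<and> strict le j k"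
    have "strict le (i - d * int n) (j - d * int n)" "strict le (j - d * int n) (k - d * int n)"
      using j strict_shift[of i "- d" j] strict_shift[of j "- d" k] by simp_all
    then show "j \<in> sh d \<tau>" using pp_convex[OF \<tau>] ik unfolding order_convex_def mem_sh by blast
  qed
  moreover have "hasse_connected le (sh d \<tau>)"
    unfolding hasse_connected_iff
  proof (intro ballI)
    fix i j assume "i \<in> sh d \<tau>" "j \<in> sh d \<tau>"
    then have "(i - d * int n, j - d * int n) \<in> (adj \<tau>)\<^sup>*"
      using pp_connected[OF \<tau>] by (simp add: mem_sh hasse_connected_iff)
    then have "(i - d * int n + d * int n, j - d * int n + d * int n) \<in> (adj (sh d \<tau>))\<^sup>*"
    proof (induction rule: rtrancl_induct)
      case (step y z)
      then have "(y + d * int n, z + d * int n) \<in> adj (sh d \<tau>)"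
        by (auto simp: adj_def cov_shift)
      then show ?case using step.IH by (meson rtrancl.rtrancl_into_rtrancl)
    qed simp
    then show "(i, j) \<in> (adj (sh d \<tau>))\<^sup>*" by simp
  qed
  moreover have "i = j" if "i \<in> sh d \<tau>" "j \<in> sh d \<tau>" "i mod int n = j mod int n" for i j
  proof -
    have "(i - d * int n) mod int n = (j - d * int n) mod int n"
      using that(3) mod_mult_self1[of i "- d" "int n"] mod_mult_self1[of j "- d" "int n"] by simp
    then show ?thesis
      using pp_residue[OF \<tau>, of "i - d * int n" "j - d * int n"] that by (simp add: mem_sh)
  qed
  moreover have "sh d \<tau> \<noteq> {}" using pp_nonempty[OF \<tau>] by (simp add: shift_def)
  moreover have "\<not> is_singleton (sh d \<tau>)"
    using \<tau> by (simp add: pp_iff is_singleton_altdef)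
  ultimately show ?thesis unfolding pp_iff by blast
qed

lemma pp_sh [simp]: "pp (sh d \<tau>) \<longleftrightarrow> pp \<tau>"
  using pp_sh_imp[of \<tau> d] pp_sh_imp[of "sh d \<tau>" "- d"] by (auto simp: sh_sh)

definition quasi_periodic :: "(int \<Rightarrow> real) \<Rightarrow> bool" where
  "quasi_periodic x \<longleftrightarrow> (\<forall>i. x (i + int n) = x i + c)"

lemma quasi_periodic_shift:
  assumes "quasi_periodic x"
  shows "x (i + d * int n) = x i + real_of_int d * c"
proof -
  have nat: "x (i + int d * int n) = x i + real d * c" for d i
  proof (induction d)
    case (Suc d)
    have "x (i + int d * int n + int n) = x (i + int d * int n) + c"
      using assms by (simp add: quasi_periodic_def)
    then show ?case using Suc by (simp add: algebra_simps)
  qed simp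
  show ?thesis
  proof (cases "d \<ge> 0")
    case True
    then show ?thesis using nat[of i "nat d"] by simp
  next
    case False
    then show ?thesis using nat[of "i + d * int n" "nat (-d)"] by simp
  qed
qed

lemma edges_sh: "edges (sh d \<tau>) = (\<lambda>(i, j). (i + d * int n, j + d * int n)) ` edges \<tau>"
proof -
  let ?f = "\<lambda>(i, j). (i + d * int n, j + d * int n)"
  have 1: "(i, j) \<in> edges (sh d \<tau>) \<longleftrightarrow> (i - d * int n, j - d * int n) \<in> edges \<tau>" for i j
    using cov_shift[of "i - d * int n" d "j - d * int n"] by (simp add: edges_def mem_sh)
  have "(i, j) \<in> ?f ` edges \<tau>" if "(i - d * int n, j - d * int n) \<in> edges \<tau>" for i j
    by (rule image_eqI[OF _ that]) simp
  moreover have "(i - d * int n, j - d * int n) \<in> edges \<tau>" if "(i, j) \<in> ?f ` edges \<tau>" for i j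
    using that by auto
  ultimately show ?thesis using 1 by (intro set_eqI) (metis surj_pair)
qed

lemma alpha_sh:
  assumes "\<And>i j. (i, j) \<in> edges \<tau> \<Longrightarrow> x (j + d * int n) - x (i + d * int n) = y j - y i" "pp \<tau>"
  shows "alpha le (sh d \<tau>) x = alpha le \<tau> y"
proof -
  have "inj_on (\<lambda>(i, j). (i + d * int n, j + d * int n)) (edges \<tau>)" by (auto simp: inj_on_def)
  then have "alpha le (sh d \<tau>) x = (\<Sum>(i, j)\<in>edges \<tau>. x (j + d * int n) - x (i + d * int n))"
    using assms(2) by (simp add: alpha_edges edges_sh sum.reindex case_prod_unfold comp_def)
  also have "\<dots> = (\<Sum>(i, j)\<in>edges \<tau>. y j - y i)"
    using assms(1) by (intro sum.cong) auto
  finally show ?thesis by (simp add: alpha_edges assms(2))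
qed

lemma alpha_sh_quasi_periodic: "quasi_periodic x \<Longrightarrow> pp \<tau> \<Longrightarrow> alpha le (sh d \<tau>) x = alpha le \<tau> x"
  by (rule alpha_sh) (simp add: quasi_periodic_shift)

text \<open>These two-element pipes turn lower bounds on \<open>alpha\<close> into strict
  monotonicity; congruent covering pairs are left to quasi-periodicity.\<close>

lemma cov_pair:
  assumes "cov i j" "i mod int n \<noteq> j mod int n"
  shows "pp {i, j}"
proof -
  have "order_convex le {i, j}"
    unfolding order_convex_def
  proof (intro ballI allI impI)
    fix a b m assume ab: "a \<in> {i, j}" "b \<in> {i, j}" and m: "strict le a m \<and> strict le m b"
    have "le a b" "a \<noteq> b" using m le_trans le_antisym unfolding strict_def by blast+
    then have "a = i" "b = j" using ab cov_le[OF assms(1)] le_antisym by blast+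
    then show "m \<in> {i, j}" using m assms(1) unfolding cov_iff by blast
  qed
  moreover have "hasse_connected le {i, j}"
    using assms(1) unfolding hasse_connected_iff adj_def by (auto intro!: r_into_rtrancl)
  ultimately show ?thesis using assms cov_neq[OF assms(1)]
    unfolding pp_iff by (auto simp: is_singleton_def doubleton_eq_iff)
qed

lemma edges_pair: "cov i j \<Longrightarrow> edges {i, j} = {(i, j)}"
  using cov_le cov_neq le_antisym unfolding edges_def by blast

section \<open>The order-convex hull of two pipes\<close>

definition hull2 :: "int set \<Rightarrow> int set \<Rightarrow> int set" where
  "hull2 \<sigma> \<sigma>' = {k. \<exists>a\<in>\<sigma> \<union> \<sigma>'. \<exists>b\<in>\<sigma> \<union> \<sigma>'. le a k \<and> le k b}"

lemma hull2_superset: "\<sigma> \<union> \<sigma>' \<subseteq> hull2 \<sigma> \<sigma>'"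
  by (auto simp: hull2_def intro: le_refl)

lemma hull2_convex: "order_convex le (hull2 \<sigma> \<sigma>')"
  unfolding order_convex_def hull2_def strict_def using le_trans by blast

lemma hull2_connected:
  assumes \<sigma>: "hasse_connected le \<sigma>" and \<sigma>': "hasse_connected le \<sigma>'"
    and ij: "i \<in> \<sigma>" "j \<in> \<sigma>'" "le i j"
  shows "hasse_connected le (hull2 \<sigma> \<sigma>')"
proof -
  let ?H = "hull2 \<sigma> \<sigma>'"
  have sub: "\<sigma> \<subseteq> ?H" "\<sigma>' \<subseteq> ?H" using hull2_superset by auto
  have base: "(i, a) \<in> (adj ?H)\<^sup>*" if "a \<in> \<sigma> \<union> \<sigma>'" for a
  proof (cases "a \<in> \<sigma>")
    case True
    then have "(i, a) \<in> (adj \<sigma>)\<^sup>*" using \<sigma> ij by (simp add: hasse_connected_iff)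
    then show ?thesis using sub(1) by (rule adj_rtrancl_mono)
  next
    case False
    then have "(j, a) \<in> (adj \<sigma>')\<^sup>*" using that \<sigma>' ij by (simp add: hasse_connected_iff)
    then have "(j, a) \<in> (adj ?H)\<^sup>*" using sub(2) by (rule adj_rtrancl_mono)
    moreover have "(i, j) \<in> (adj ?H)\<^sup>*" using ij sub by (intro chain_adj hull2_convex) auto
    ultimately show ?thesis by simp
  qed
  have all: "(i, k) \<in> (adj ?H)\<^sup>*" if k: "k \<in> ?H" for k
  proof -
    obtain a where a: "a \<in> \<sigma> \<union> \<sigma>'" "le a k" using k by (auto simp: hull2_def)
    then have "(a, k) \<in> (adj ?H)\<^sup>*" using sub k by (intro chain_adj hull2_convex) auto
    then show ?thesis using base[OF a(1)] by simp
  qed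
  show ?thesis unfolding hasse_connected_iff using rtrancl_trans[OF sym_adj[OF all] all] by blast
qed

text \<open>By monotonicity the extremes of \<open>x\<close> on the hull are governed by the two
  sets themselves, and the comparable pair \<open>i\<close>, \<open>j\<close> bridges them.\<close>

lemma hull2_spread:
  assumes x: "order_mono x" and ij: "i \<in> \<sigma>" "j \<in> \<sigma>'" "le i j"
    and s: "\<And>a b. a \<in> \<sigma> \<Longrightarrow> b \<in> \<sigma> \<Longrightarrow> x a - x b \<le> s" "\<And>a b. a \<in> \<sigma>' \<Longrightarrow> b \<in> \<sigma>' \<Longrightarrow> x a - x b \<le> s"
    and k: "k \<in> hull2 \<sigma> \<sigma>'" "k' \<in> hull2 \<sigma> \<sigma>'"
  shows "x k - x k' \<le> 2 * s + (x j - x i)"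
proof -
  obtain a b where ab: "a \<in> \<sigma> \<union> \<sigma>'" "b \<in> \<sigma> \<union> \<sigma>'" "le a k'" "le k b"
    using k by (auto simp: hull2_def)
  then have "x k \<le> x b" "x a \<le> x k'" using x by (auto simp: order_mono_def)
  moreover have "x i \<le> x j" using x ij by (auto simp: order_mono_def)
  moreover have "0 \<le> s" using s(1)[of i i] ij by simp
  moreover have "x b - x a \<le> 2 * s + (x j - x i)"
    using ab(1,2)
  proof (elim UnE)
    assume "a \<in> \<sigma>" "b \<in> \<sigma>"
    then show ?thesis using s(1)[of b a] calculation by simp
  next
    assume "a \<in> \<sigma>'" "b \<in> \<sigma>'"
    then show ?thesis using s(2)[of b a] calculation by simp
  next
    assume "a \<in> \<sigma>" "b \<in> \<sigma>'"
    then show ?thesis using s(1)[of i a] s(2)[of b j] ij by simp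
  next
    assume "a \<in> \<sigma>'" "b \<in> \<sigma>"
    then show ?thesis using s(1)[of b i] s(2)[of j a] ij calculation by simp
  qed
  ultimately show ?thesis by linarith
qed

end

section \<open>Contracting the small pipes of a point\<close>

text \<open>For a chain of sets contracted from the innermost to the outermost with factors
  \<open>t\<close>, this is the coefficient of the centre of \<open>\<sigma>\<close> in the result:
  it enters with weight \<open>1 - t \<sigma>\<close> and is then multiplied by the factors of all
  larger sets.\<close>

definition wt :: "('s set \<Rightarrow> real) \<Rightarrow> 's set set \<Rightarrow> 's set \<Rightarrow> real" where
  "wt t S \<sigma> = (1 - t \<sigma>) * (\<Prod>\<rho>\<in>{\<rho> \<in> S. \<sigma> \<subset> \<rho>}. t \<rho>)"

text \<open>A set with factor 1 leaves no trace. So a sum over a family independent of the point,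
  good for continuity, may be replaced by one over a nested family that depends on it, good for
  computation.\<close>

lemma sum_wt_support:
  assumes S: "finite S" and T: "T \<subseteq> S" and 1: "\<And>\<sigma>. \<sigma> \<in> S - T \<Longrightarrow> t \<sigma> = 1"
  shows "(\<Sum>\<sigma>\<in>S. wt t S \<sigma> * f \<sigma>) = (\<Sum>\<sigma>\<in>T. wt t T \<sigma> * f \<sigma>)"
proof (rule sum.mono_neutral_cong_right[OF S T])
  show "\<forall>\<sigma>\<in>S - T. wt t S \<sigma> * f \<sigma> = 0" using 1 by (simp add: wt_def)
  fix \<sigma> assume "\<sigma> \<in> T"
  have "(\<Prod>\<rho>\<in>{\<rho> \<in> S. \<sigma> \<subset> \<rho>}. t \<rho>) = (\<Prod>\<rho>\<in>{\<rho> \<in> T. \<sigma> \<subset> \<rho>}. t \<rho>)"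
    using S T 1 by (intro prod.mono_neutral_right) auto
  then show "wt t S \<sigma> * f \<sigma> = wt t T \<sigma> * f \<sigma>" by (simp add: wt_def)
qed

lemma wt_nonneg:
  assumes "\<And>\<rho>. \<rho> \<in> S \<Longrightarrow> 0 \<le> t \<rho>" "\<And>\<rho>. \<rho> \<in> S \<Longrightarrow> t \<rho> \<le> 1" "\<sigma> \<in> S"
  shows "0 \<le> wt t S \<sigma>"
  unfolding wt_def using assms by (intro mult_nonneg_nonneg prod_nonneg) auto

text \<open>Peeling off the smallest set telescopes the sum; the missing weight is that of the
  contracted point itself.\<close>

lemma wt_total:
  assumes "finite S" "\<And>\<sigma> \<rho>. \<sigma> \<in> S \<Longrightarrow> \<rho> \<in> S \<Longrightarrow> \<sigma> \<subseteq> \<rho> \<or> \<rho> \<subseteq> \<sigma>"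
  shows "(\<Sum>\<sigma>\<in>S. wt t S \<sigma>) = 1 - (\<Prod>\<sigma>\<in>S. t \<sigma>)"
  using assms
proof (induction S rule: finite_psubset_induct)
  case (psubset S)
  show ?case
  proof (cases "S = {}")
    case False
    obtain m where m: "m \<in> S" "\<And>\<sigma>. \<sigma> \<in> S \<Longrightarrow> \<sigma> \<subseteq> m \<Longrightarrow> \<sigma> = m"
      using finite_has_minimal[OF psubset(1) False] by blast
    have least: "m \<subseteq> \<sigma>" if "\<sigma> \<in> S" for \<sigma> using psubset.prems[of \<sigma> m] m that by auto
    let ?S = "S - {m}"
    have IH: "(\<Sum>\<sigma>\<in>?S. wt t ?S \<sigma>) = 1 - (\<Prod>\<sigma>\<in>?S. t \<sigma>)"
      using m(1) psubset.prems by (intro psubset.IH) auto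
    have "{\<rho> \<in> S. m \<subset> \<rho>} = ?S" using least by auto
    then have wm: "wt t S m = (1 - t m) * (\<Prod>\<sigma>\<in>?S. t \<sigma>)" by (simp add: wt_def)
    have "wt t S \<sigma> = wt t ?S \<sigma>" if "\<sigma> \<in> ?S" for \<sigma>
    proof -
      have "{\<rho> \<in> S. \<sigma> \<subset> \<rho>} = {\<rho> \<in> ?S. \<sigma> \<subset> \<rho>}" using least[of \<sigma>] that by auto
      then show ?thesis by (simp add: wt_def)
    qed
    then have "(\<Sum>\<sigma>\<in>S. wt t S \<sigma>) = wt t S m + (\<Sum>\<sigma>\<in>?S. wt t ?S \<sigma>)"
      using psubset(1) m(1) by (simp add: sum.remove)
    moreover have "(\<Prod>\<sigma>\<in>S. t \<sigma>) = t m * (\<Prod>\<sigma>\<in>?S. t \<sigma>)"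
      using psubset(1) m(1) by (simp add: prod.remove)
    ultimately show ?thesis using IH wm by (simp add: algebra_simps)
  qed simp
qed

context affine_setting
begin

text \<open>\<open>gap\<close> needs \<open>K \<ge> D * (8 * D + M)\<close>, and \<open>rel_err\<close> needs \<open>M \<ge> 80 * D\<^sup>2\<close>.\<close>

definition M :: real where "M = 80 * D\<^sup>2"
definition K :: real where "K = D * (8 * D + M)"

text \<open>Scaled so that \<open>eps (n + 1) = c\<close>: the distance of congruent elements acts
  as the bound for a fictitious pipe of size \<open>n + 1\<close>.\<close>

definition eps :: "nat \<Rightarrow> real" where
  "eps m = c * K ^ m / K ^ (n + 1)"

lemma M_ge: "80 * D \<le> M"
  using mult_left_mono[of 1 D D] D_ge_1 by (simp add: M_def power2_eq_square[of D])

lemma K_ge_M: "M \<le> K" and K_gt_1: "1 < K"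
proof -
  have "M \<ge> 80" using M_ge D_ge_1 by linarith
  have "8 * D + M \<le> D * (8 * D + M)"
    using D_ge_1 \<open>M \<ge> 80\<close> by (intro mult_right_mono[of 1 D "8 * D + M", simplified]) auto
  then show "M \<le> K" "1 < K" using D_ge_1 \<open>M \<ge> 80\<close> unfolding K_def by linarith+
qed

lemma K_pos: "0 < K" using K_gt_1 by simp

lemma eps_pos: "0 < eps m"
  using c_pos K_pos by (simp add: eps_def)

lemma eps_Suc: "eps (Suc m) = K * eps m"
  by (simp add: eps_def)

lemma eps_mono: "m \<le> m' \<Longrightarrow> eps m \<le> eps m'"
  using c_pos K_gt_1 unfolding eps_def
  by (intro divide_right_mono mult_left_mono power_increasing) auto

lemma eps_less: "m < m' \<Longrightarrow> K * eps m \<le> eps m'"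
  using eps_mono[of "Suc m" m'] by (simp add: eps_Suc)

lemma eps_le_c: "m \<le> n \<Longrightarrow> K * eps m \<le> c"
  using eps_less[of m "n + 1"] K_pos by (simp add: eps_def)

text \<open>The coordinate sum is not normalised here.\<close>

definition truncated :: "(int \<Rightarrow> real) \<Rightarrow> bool" where
  "truncated x \<longleftrightarrow> quasi_periodic x \<and> (\<forall>\<tau>. pp \<tau> \<longrightarrow> eps (card \<tau>) \<le> alpha le \<tau> x)"

lemma truncated_quasi_periodic: "truncated x \<Longrightarrow> quasi_periodic x"
  by (simp add: truncated_def)

lemma truncated_alpha: "truncated x \<Longrightarrow> pp \<tau> \<Longrightarrow> eps (card \<tau>) \<le> alpha le \<tau> x"
  by (simp add: truncated_def)

lemma mod_eq_shift:
  assumes "i mod int n = j mod int n"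
  obtains d where "j = i + d * int n"
  using assms by (metis add.commute diff_add_cancel dvdE mod_eq_dvd_iff mult.commute)

lemma alpha_pos_cov:
  assumes x: "quasi_periodic x" and pos: "\<And>\<tau>. pp \<tau> \<Longrightarrow> 0 < alpha le \<tau> x" and ij: "cov i j"
  shows "x i < x j"
proof (cases "i mod int n = j mod int n")
  case True
  then obtain d where d: "j = i + d * int n" by (rule mod_eq_shift)
  have "le (i + 0 * int n) (i + d * int n)" using cov_le[OF ij] d by simp
  then have "0 \<le> d" by (rule le_shift_self)
  moreover have "d \<noteq> 0" using cov_neq[OF ij] d by auto
  ultimately show ?thesis using quasi_periodic_shift[OF x, of i d] c_pos d by simp
next
  case False
  then have "0 < alpha le {i, j} x" by (intro pos cov_pair ij)
  then show ?thesis
    using cov_pair[OF ij False] by (simp add: alpha_edges edges_pair ij)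
qed

lemma truncated_alpha_pos: "truncated x \<Longrightarrow> pp \<tau> \<Longrightarrow> 0 < alpha le \<tau> x"
  using truncated_alpha[of x \<tau>] eps_pos[of "card \<tau>"] by linarith

lemma truncated_cov: "truncated x \<Longrightarrow> cov i j \<Longrightarrow> x i < x j"
  using alpha_pos_cov[OF truncated_quasi_periodic truncated_alpha_pos] by blast

lemma cov_mono_chain:
  assumes "\<And>i j. cov i j \<Longrightarrow> x i < (x j :: real)" "strict le i j"
  shows "x i < x j"
proof -
  have mono: "x a \<le> x b" if "(a, b) \<in> {(p, q). cov p q \<and> le i p \<and> le q j}\<^sup>*" for a b
    using that
  proof (induction rule: rtrancl_induct)
    case (step y z)
    then show ?case using assms(1)[of y z] by auto
  qed simp
  have "(i, j) \<in> {(p, q). cov p q \<and> le i p \<and> le q j}\<^sup>*"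
    using assms(2) by (intro saturated_chain) (simp add: strict_def)
  then show ?thesis
  proof (cases rule: converse_rtranclE)
    case base
    then show ?thesis using assms(2) by (simp add: strict_def)
  next
    case (step y)
    then show ?thesis using assms(1)[of i y] mono[of y j] by auto
  qed
qed

lemma truncated_strict: "truncated x \<Longrightarrow> strict le i j \<Longrightarrow> x i < x j"
  using cov_mono_chain truncated_cov by blast

lemma truncated_order_mono: "truncated x \<Longrightarrow> order_mono x"
  unfolding order_mono_def using truncated_strict unfolding strict_def by (metis less_eq_real_def)

text \<open>The threshold is twice that of \<open>near\<close>, since a pipe near its bound at one
  point has to stay in this class at every other point with the same image. Singletons stand in for
  elements outside all contracted pipes, so that \<open>gap\<close> applies to them too.\<close>

definition small :: "(int \<Rightarrow> real) \<Rightarrow> int set \<Rightarrow> bool" where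
  "small x \<sigma> \<longleftrightarrow> is_singleton \<sigma> \<or> pp \<sigma> \<and> alpha le \<sigma> x \<le> 4 * eps (card \<sigma>)"

lemma small_singleton [simp]: "small x {i}"
  by (simp add: small_def)

lemma small_pipe: "small x \<sigma> \<Longrightarrow> hasse_connected le \<sigma> \<and> finite \<sigma> \<and> card \<sigma> \<le> n"
proof (cases "is_singleton \<sigma>")
  case True
  then show ?thesis using n_pos by (auto simp: is_singleton_def hasse_connected_iff)
next
  case False
  then show "small x \<sigma> \<Longrightarrow> ?thesis" by (simp add: small_def pp_finite pp_card pp_connected)
qed

lemma small_spread:
  assumes "truncated x" "small x \<sigma>" "a \<in> \<sigma>" "b \<in> \<sigma>"
  shows "x a - x b \<le> 4 * D * eps (card \<sigma>)"
proof (cases "is_singleton \<sigma>")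
  case True
  then show ?thesis using assms eps_pos[of "card \<sigma>"] by (auto simp: is_singleton_def)
next
  case False
  then have \<sigma>: "pp \<sigma>" "alpha le \<sigma> x \<le> 4 * eps (card \<sigma>)" using assms by (auto simp: small_def)
  have "x a - x b \<le> D * alpha le \<sigma> x"
    by (rule spread_le_alpha[OF truncated_order_mono[OF assms(1)] \<sigma>(1) assms(3,4)])
  also have "\<dots> \<le> D * (4 * eps (card \<sigma>))" using \<sigma> by (intro mult_left_mono) auto
  finally show ?thesis by simp
qed

text \<open>Otherwise the order-convex hull of \<open>\<sigma> \<union> \<sigma>'\<close> would be a larger pipe with too small an
  \<open>alpha\<close>, or it would contain two congruent elements at distance less than \<open>c\<close>.\<close>

lemma gap:
  assumes x: "truncated x" and \<sigma>: "small x \<sigma>" and \<sigma>': "small x \<sigma>'"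
    and ij: "i \<in> \<sigma>" "j \<in> \<sigma>'" "le i j" and nn: "\<not> \<sigma> \<subseteq> \<sigma>'" "\<not> \<sigma>' \<subseteq> \<sigma>"
  shows "M * eps (card \<sigma>) \<le> x j - x i" "M * eps (card \<sigma>') \<le> x j - x i"
proof -
  define m where "m = max (card \<sigma>) (card \<sigma>')"
  define H where "H = hull2 \<sigma> \<sigma>'"
  have mono: "order_mono x" using x by (rule truncated_order_mono)
  have m_n: "m \<le> n" using small_pipe[OF \<sigma>] small_pipe[OF \<sigma>'] by (simp add: m_def)
  have s: "x a - x b \<le> 4 * D * eps m" if "a \<in> \<sigma> \<and> b \<in> \<sigma> \<or> a \<in> \<sigma>' \<and> b \<in> \<sigma>'" for a b
  proof -
    have "4 * D * eps (card \<sigma>) \<le> 4 * D * eps m" "4 * D * eps (card \<sigma>') \<le> 4 * D * eps m"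
      by (auto intro!: mult_left_mono eps_mono simp: m_def)
    then show ?thesis using that small_spread[OF x \<sigma>] small_spread[OF x \<sigma>'] by force
  qed
  have spread: "x k - x k' \<le> 8 * D * eps m + (x j - x i)" if "k \<in> H" "k' \<in> H" for k k'
    using hull2_spread[OF mono ij, of "4 * D * eps m" k k'] s that by (simp add: H_def)
  have conv: "order_convex le H" and conn: "hasse_connected le H"
    unfolding H_def using small_pipe[OF \<sigma>] small_pipe[OF \<sigma>'] ij
    by (auto intro: hull2_convex hull2_connected)
  have sup: "\<sigma> \<union> \<sigma>' \<subseteq> H" unfolding H_def by (rule hull2_superset)
  have main: "K * eps m \<le> D * (8 * D * eps m + (x j - x i))"
  proof (cases "\<forall>p\<in>H. \<forall>q\<in>H. p mod int n = q mod int n \<longrightarrow> p = q")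
    case True
    have "\<not> is_singleton H"
    proof
      assume "is_singleton H"
      then obtain h where "H = {h}" by (auto simp: is_singleton_def)
      then show False using sup ij nn by blast
    qed
    then have H: "pp H" using True conv conn sup ij by (auto simp: pp_iff)
    have "\<sigma> \<subset> H" "\<sigma>' \<subset> H" using sup nn by auto
    then have "card \<sigma> < card H" "card \<sigma>' < card H"
      using pp_finite[OF H] by (auto intro: psubset_card_mono)
    then have "K * eps m \<le> eps (card H)" by (intro eps_less) (auto simp: m_def)
    also have "\<dots> \<le> alpha le H x" by (rule truncated_alpha[OF x H])
    also have "\<dots> \<le> D * (8 * D * eps m + (x j - x i))"
      unfolding alpha_edges[OF H]
    proof (rule edges_sum_le[OF H])
      show "x b - x a \<le> 8 * D * eps m + (x j - x i)" if "(a, b) \<in> edges H" for a b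
        using that spread by (auto simp: edges_def)
      show "0 \<le> 8 * D * eps m + (x j - x i)"
        using spread[of i i] sup ij by auto
    qed
    finally show ?thesis .
  next
    case False
    then obtain p q where pq: "p \<in> H" "q \<in> H" "p mod int n = q mod int n" "p \<noteq> q" by blast
    obtain d where d: "q = p + d * int n" using pq(3) by (rule mod_eq_shift)
    have "x q = x p + real_of_int d * c" using d quasi_periodic_shift[OF truncated_quasi_periodic[OF x]] by simp
    moreover have "d \<noteq> 0" using pq d by auto
    then have "1 \<le> \<bar>real_of_int d\<bar>" by linarith
    then have "1 * c \<le> \<bar>real_of_int d\<bar> * c" using c_pos by (intro mult_right_mono) auto
    then have "c \<le> \<bar>real_of_int d * c\<bar>" using c_pos by (simp add: abs_mult)
    ultimately have w: "c \<le> 8 * D * eps m + (x j - x i)"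
      using spread[OF pq(1,2)] spread[OF pq(2,1)] by linarith
    have "K * eps m \<le> 1 * (8 * D * eps m + (x j - x i))"
      unfolding mult_1 using eps_le_c[OF m_n] w by (rule order_trans)
    also have "\<dots> \<le> D * (8 * D * eps m + (x j - x i))"
      using D_ge_1 c_pos w by (intro mult_right_mono) auto
    finally show ?thesis .
  qed
  have "K * eps m = D * (8 * D * eps m + M * eps m)" by (simp add: K_def algebra_simps)
  then have "D * (8 * D * eps m + M * eps m) \<le> D * (8 * D * eps m + (x j - x i))" using main by simp
  then have "8 * D * eps m + M * eps m \<le> 8 * D * eps m + (x j - x i)"
    by (rule mult_left_le_imp_le) (use n_pos in simp)
  then have "M * eps m \<le> x j - x i" by simp
  moreover have "M * eps (card \<sigma>) \<le> M * eps m" "M * eps (card \<sigma>') \<le> M * eps m"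
    using M_ge D_ge_1 by (auto intro!: mult_left_mono eps_mono simp: m_def)
  ultimately show "M * eps (card \<sigma>) \<le> x j - x i" "M * eps (card \<sigma>') \<le> x j - x i" by linarith+
qed

lemma M_pos: "0 < M" using M_ge D_ge_1 by linarith

lemma M_eps: "80 * D * eps m \<le> M * eps m"
  using M_ge eps_pos[of m] by (intro mult_right_mono) auto

text \<open>For \<open>j = i\<close> the gap would be a positive lower bound for
  \<open>x i - x i\<close>.\<close>

lemma small_nested:
  assumes "truncated x" "small x \<sigma>" "small x \<sigma>'" "i \<in> \<sigma>" "i \<in> \<sigma>'"
  shows "\<sigma> \<subseteq> \<sigma>' \<or> \<sigma>' \<subseteq> \<sigma>"
proof (rule ccontr)
  assume "\<not> ?thesis"
  then have "M * eps (card \<sigma>) \<le> x i - x i" using gap(1)[OF assms le_refl] by blast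
  then show False using M_pos eps_pos[of "card \<sigma>"] by (simp add: mult_le_0_iff)
qed

section \<open>Near pipes and their contraction\<close>

definition near :: "(int \<Rightarrow> real) \<Rightarrow> int set set" where
  "near x = {\<sigma>. pp \<sigma> \<and> alpha le \<sigma> x < 2 * eps (card \<sigma>)}"

lemma near_pp: "\<sigma> \<in> near x \<Longrightarrow> pp \<sigma>" by (simp add: near_def)

lemma near_small: "\<sigma> \<in> near x \<Longrightarrow> small x \<sigma>"
  using eps_pos[of "card \<sigma>"] by (simp add: near_def small_def)

lemma near_nested: "truncated x \<Longrightarrow> \<sigma> \<in> near x \<Longrightarrow> \<sigma>' \<in> near x \<Longrightarrow> i \<in> \<sigma> \<Longrightarrow> i \<in> \<sigma>' \<Longrightarrow> \<sigma> \<subseteq> \<sigma>' \<or> \<sigma>' \<subseteq> \<sigma>"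
  using small_nested near_small by blast

text \<open>Clipping at 1 makes the factor trivial off \<open>near x\<close> and continuous in
  \<open>x\<close>; the lower bound on \<open>alpha\<close> keeps it nonnegative.\<close>

definition shrink :: "(int \<Rightarrow> real) \<Rightarrow> int set \<Rightarrow> real" where
  "shrink x \<sigma> = min 1 (alpha le \<sigma> x / eps (card \<sigma>) - 1)"

lemma shrink_le_1: "shrink x \<sigma> \<le> 1" by (simp add: shrink_def)

lemma shrink_nonneg: "truncated x \<Longrightarrow> pp \<sigma> \<Longrightarrow> 0 \<le> shrink x \<sigma>"
  using truncated_alpha[of x \<sigma>] eps_pos[of "card \<sigma>"] by (simp add: shrink_def field_simps)

lemma shrink_eq_1: "pp \<sigma> \<Longrightarrow> shrink x \<sigma> = 1 \<longleftrightarrow> \<sigma> \<notin> near x"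
  using eps_pos[of "card \<sigma>"] by (auto simp: shrink_def near_def min_def field_simps)

lemma shrink_eq_0: "shrink x \<sigma> = 0 \<longleftrightarrow> alpha le \<sigma> x = eps (card \<sigma>)"
  using eps_pos[of "card \<sigma>"] by (auto simp: shrink_def min_def field_simps)

lemma shrink_mono: "alpha le \<sigma> x \<le> alpha le \<sigma> z \<Longrightarrow> shrink x \<sigma> \<le> shrink z \<sigma>"
  using eps_pos[of "card \<sigma>"] unfolding shrink_def
  by (intro min.mono diff_right_mono divide_right_mono) auto

text \<open>What matters is that the choice commutes with translations and is inherited by every
  subset containing the chosen element. The minimum is taken in the usual order of the integers, not
  in \<open>le\<close>.\<close>

definition base :: "int set \<Rightarrow> int" where "base \<sigma> = Min \<sigma>"

lemma base_in: "pp \<sigma> \<Longrightarrow> base \<sigma> \<in> \<sigma>"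
  unfolding base_def by (simp add: pp_finite pp_nonempty)

definition pset :: "int set \<Rightarrow> int \<Rightarrow> int set set" where
  "pset \<tau> i = {\<sigma>. pp \<sigma> \<and> i \<in> \<sigma> \<and> \<not> \<tau> \<subseteq> \<sigma>}"

text \<open>A class contains at most one pipe through \<open>i\<close>, since two different
  translates would put two congruent elements into one pipe.\<close>

lemma finite_pipes_at: "finite {\<sigma>. pp \<sigma> \<and> i \<in> \<sigma>}"
proof -
  let ?cls = "pipe_class n ` {\<tau>. pp \<tau>}"
  have "{\<sigma>. pp \<sigma> \<and> i \<in> \<sigma>} \<subseteq> (\<Union>C\<in>?cls. {\<sigma> \<in> C. i \<in> \<sigma>})"
  proof
    fix \<sigma> assume "\<sigma> \<in> {\<sigma>. pp \<sigma> \<and> i \<in> \<sigma>}"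
    moreover have "\<sigma> \<in> pipe_class n \<sigma>" unfolding pipe_class_def by (metis rangeI sh_0)
    ultimately show "\<sigma> \<in> (\<Union>C\<in>?cls. {\<sigma> \<in> C. i \<in> \<sigma>})" by blast
  qed
  moreover have "finite {\<sigma> \<in> C. i \<in> \<sigma>}" if "C \<in> ?cls" for C
  proof -
    obtain \<tau> where \<tau>: "pp \<tau>" "C = pipe_class n \<tau>" using \<open>C \<in> ?cls\<close> by auto
    have uniq: "\<sigma> = \<sigma>'" if \<sigma>: "\<sigma> \<in> C" "i \<in> \<sigma>" "\<sigma>' \<in> C" "i \<in> \<sigma>'" for \<sigma> \<sigma>'
    proof -
      obtain d e where de: "\<sigma> = sh d \<tau>" "\<sigma>' = sh e \<tau>" using \<sigma> \<tau> by (auto simp: pipe_class_def)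
      then have "i - d * int n \<in> \<tau>" "i - e * int n \<in> \<tau>" using \<sigma> by (auto simp: mem_sh)
      moreover have "(i - d * int n) mod int n = (i - e * int n) mod int n"
        using mod_mult_self1[of i "- d" "int n"] mod_mult_self1[of i "- e" "int n"] by simp
      ultimately have "i - d * int n = i - e * int n" by (rule pp_residue[OF \<tau>(1)])
      then show ?thesis using de n_pos by simp
    qed
    show ?thesis
    proof (cases "{\<sigma> \<in> C. i \<in> \<sigma>} = {}")
      case False
      then obtain \<sigma> where "\<sigma> \<in> C" "i \<in> \<sigma>" by blast
      then have "{\<sigma> \<in> C. i \<in> \<sigma>} \<subseteq> {\<sigma>}" using uniq by blast
      then show ?thesis by (rule finite_subset) simp
    next
      case True
      then show ?thesis by (metis finite.emptyI)
    qed
  qed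
  ultimately show ?thesis using finite_classes by (meson finite_UN finite_subset)
qed

lemma finite_pset: "finite (pset \<tau> i)"
  by (rule finite_subset[OF _ finite_pipes_at[of i]]) (auto simp: pset_def)

text \<open>\<open>contr x \<tau>\<close> is \<open>x\<close> with every pipe \<open>\<sigma>\<close> not containing \<open>\<tau>\<close> contracted towards its base point by
  \<open>shrink x \<sigma>\<close>. Only the nested pipes of \<open>near x\<close> move, and a pipe inside \<open>\<sigma>\<close> that contains the base
  point of \<open>\<sigma>\<close> has the same base point, so the contractions commute. This closed formula for their
  composition is visibly continuous in \<open>x\<close>.\<close>

definition contr :: "(int \<Rightarrow> real) \<Rightarrow> int set \<Rightarrow> int \<Rightarrow> real" where
  "contr x \<tau> i = x i + (\<Sum>\<sigma>\<in>pset \<tau> i. wt (shrink x) (pset \<tau> i) \<sigma> * (x (base \<sigma>) - x i))"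

definition nset :: "(int \<Rightarrow> real) \<Rightarrow> int set \<Rightarrow> int \<Rightarrow> int set set" where
  "nset x \<tau> i = {\<sigma> \<in> near x. i \<in> \<sigma> \<and> \<not> \<tau> \<subseteq> \<sigma>}"

lemma nset_sub: "nset x \<tau> i \<subseteq> pset \<tau> i"
proof
  fix \<sigma> assume "\<sigma> \<in> nset x \<tau> i"
  then show "\<sigma> \<in> pset \<tau> i" using near_pp[of \<sigma> x] by (simp add: nset_def pset_def)
qed

lemma finite_nset: "finite (nset x \<tau> i)"
  by (rule finite_subset[OF nset_sub finite_pset])

lemma nset_nested: "truncated x \<Longrightarrow> \<sigma> \<in> nset x \<tau> i \<Longrightarrow> \<rho> \<in> nset x \<tau> i \<Longrightarrow> \<sigma> \<subseteq> \<rho> \<or> \<rho> \<subseteq> \<sigma>"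
  unfolding nset_def mem_Collect_eq by (elim conjE) (rule near_nested)

lemma contr_nset: "contr x \<tau> i = x i + (\<Sum>\<sigma>\<in>nset x \<tau> i. wt (shrink x) (nset x \<tau> i) \<sigma> * (x (base \<sigma>) - x i))"
proof -
  have "shrink x \<sigma> = 1" if "\<sigma> \<in> pset \<tau> i - nset x \<tau> i" for \<sigma>
    using that by (subst shrink_eq_1) (auto simp: pset_def nset_def)
  then show ?thesis unfolding contr_def
    by (subst sum_wt_support[OF finite_pset nset_sub]) auto
qed

text \<open>\<open>contr x \<tau> i\<close> is a convex combination of \<open>x i\<close> and the
  values of \<open>x\<close> at base points of near pipes through \<open>i\<close>.\<close>

lemma contr_bound:
  assumes x: "truncated x" and B: "\<And>\<sigma>. \<sigma> \<in> nset x \<tau> i \<Longrightarrow> 4 * D * eps (card \<sigma>) \<le> B" "0 \<le> B"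
  shows "\<bar>contr x \<tau> i - x i\<bar> \<le> B"
proof -
  let ?S = "nset x \<tau> i"
  have t: "0 \<le> shrink x \<sigma>" "shrink x \<sigma> \<le> 1" if "\<sigma> \<in> ?S" for \<sigma>
    using that shrink_le_1 shrink_nonneg[OF x near_pp] by (auto simp: nset_def)
  have w: "0 \<le> wt (shrink x) ?S \<sigma>" if "\<sigma> \<in> ?S" for \<sigma> using t that by (intro wt_nonneg)
  have "\<bar>x (base \<sigma>) - x i\<bar> \<le> B" if "\<sigma> \<in> ?S" for \<sigma>
  proof -
    have "\<sigma> \<in> near x" "i \<in> \<sigma>" using that by (auto simp: nset_def)
    then show ?thesis
      using small_spread[OF x near_small, of \<sigma> i "base \<sigma>"] small_spread[OF x near_small, of \<sigma> "base \<sigma>" i]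
        base_in[OF near_pp] B(1)[OF that] by fastforce
  qed
  then have "\<bar>\<Sum>\<sigma>\<in>?S. wt (shrink x) ?S \<sigma> * (x (base \<sigma>) - x i)\<bar> \<le> (\<Sum>\<sigma>\<in>?S. wt (shrink x) ?S \<sigma> * B)"
    using w by (intro order_trans[OF sum_abs] sum_mono) (simp add: abs_mult mult_left_mono)
  also have "\<dots> = (1 - (\<Prod>\<sigma>\<in>?S. shrink x \<sigma>)) * B"
    unfolding sum_distrib_right[symmetric]
    by (subst wt_total[OF finite_nset nset_nested[OF x]]) auto
  also have "\<dots> \<le> B"
  proof -
    have "0 \<le> (\<Prod>\<sigma>\<in>?S. shrink x \<sigma>)" using t by (intro prod_nonneg) auto
    then show ?thesis using B(2) by (simp add: algebra_simps)
  qed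
  finally show ?thesis by (simp add: contr_nset)
qed

definition between :: "(int \<Rightarrow> real) \<Rightarrow> int set \<Rightarrow> int set \<Rightarrow> int set set" where
  "between x \<rho> \<tau> = {\<sigma> \<in> near x. \<rho> \<subseteq> \<sigma> \<and> \<not> \<tau> \<subseteq> \<sigma>}"

lemma finite_between: "\<rho> \<noteq> {} \<Longrightarrow> finite (between x \<rho> \<tau>)"
proof -
  assume "\<rho> \<noteq> {}"
  then obtain i where "i \<in> \<rho>" by blast
  then show ?thesis
    using near_pp unfolding between_def by (intro finite_subset[OF _ finite_pipes_at[of i]]) blast
qed

text \<open>The pipes through \<open>i\<close> contracted for \<open>\<tau>\<close> split into those
  already contracted for \<open>\<rho>\<close> and the larger ones in \<open>between\<close>. The
  latter act on all of \<open>\<rho>\<close> by one affine map, whose slope and offset do not depend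
  on \<open>i\<close>.\<close>

lemma contr_scale:
  assumes x: "truncated x" and \<rho>: "\<rho> \<subseteq> \<tau> \<or> \<rho> \<in> near x \<and> \<not> \<tau> \<subseteq> \<rho>"
    and i: "i \<in> \<rho>"
  shows "contr x \<tau> i = (\<Prod>\<sigma>\<in>between x \<rho> \<tau>. shrink x \<sigma>) * contr x \<rho> i +
    (\<Sum>\<sigma>\<in>between x \<rho> \<tau>. wt (shrink x) (between x \<rho> \<tau>) \<sigma> * x (base \<sigma>))"
proof -
  let ?C = "between x \<rho> \<tau>" and ?R = "nset x \<rho> i" and ?T = "nset x \<tau> i"
  define P where "P = (\<Prod>\<sigma>\<in>?C. shrink x \<sigma>)"
  have finC: "finite ?C" using finite_between i by blast
  have nest: "\<sigma> \<subseteq> \<sigma>' \<or> \<sigma>' \<subseteq> \<sigma>" if "\<sigma> \<in> near x" "\<sigma>' \<in> near x" "i \<in> \<sigma>" "i \<in> \<sigma>'" for \<sigma> \<sigma>'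
    using near_nested x that by blast
  have R_sub: "\<not> \<tau> \<subseteq> \<sigma>" if \<sigma>: "\<sigma> \<in> ?R" for \<sigma>
    using \<rho>
  proof
    assume "\<rho> \<subseteq> \<tau>"
    then show ?thesis using \<sigma> by (auto simp: nset_def)
  next
    assume "\<rho> \<in> near x \<and> \<not> \<tau> \<subseteq> \<rho>"
    then show ?thesis using \<sigma> nest[of \<sigma> \<rho>] i by (auto simp: nset_def)
  qed
  have T: "?T = ?R \<union> ?C" "?R \<inter> ?C = {}"
    using R_sub i by (auto simp: nset_def between_def)
  have C_above: "\<sigma> \<subset> \<pi>" if "\<sigma> \<in> ?R" "\<pi> \<in> ?C" for \<sigma> \<pi>
    using that nest[of \<sigma> \<pi>] i by (auto simp: nset_def between_def)
  have wR: "wt (shrink x) ?T \<sigma> = P * wt (shrink x) ?R \<sigma>" if \<sigma>: "\<sigma> \<in> ?R" for \<sigma>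
  proof -
    have "{\<pi> \<in> ?T. \<sigma> \<subset> \<pi>} = {\<pi> \<in> ?R. \<sigma> \<subset> \<pi>} \<union> ?C" using T(1) C_above[OF \<sigma>] by auto
    moreover have "{\<pi> \<in> ?R. \<sigma> \<subset> \<pi>} \<inter> ?C = {}" using T(2) by auto
    ultimately show ?thesis
      unfolding wt_def P_def using finC finite_nset by (simp add: prod.union_disjoint)
  qed
  have wC: "wt (shrink x) ?T \<sigma> = wt (shrink x) ?C \<sigma>" if "\<sigma> \<in> ?C" for \<sigma>
  proof -
    have "{\<pi> \<in> ?T. \<sigma> \<subset> \<pi>} = {\<pi> \<in> ?C. \<sigma> \<subset> \<pi>}" using T(1) that by (auto simp: nset_def between_def)
    then show ?thesis by (simp add: wt_def)
  qed
  have total: "(\<Sum>\<sigma>\<in>?C. wt (shrink x) ?C \<sigma>) = 1 - P"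
    unfolding P_def by (rule wt_total[OF finC]) (use nest i in \<open>auto simp: between_def\<close>)
  have "contr x \<tau> i = x i + (\<Sum>\<sigma>\<in>?R. P * wt (shrink x) ?R \<sigma> * (x (base \<sigma>) - x i)) +
      (\<Sum>\<sigma>\<in>?C. wt (shrink x) ?C \<sigma> * (x (base \<sigma>) - x i))"
  proof -
    have "(\<Sum>\<sigma>\<in>?T. wt (shrink x) ?T \<sigma> * (x (base \<sigma>) - x i)) =
        (\<Sum>\<sigma>\<in>?R. wt (shrink x) ?T \<sigma> * (x (base \<sigma>) - x i)) +
        (\<Sum>\<sigma>\<in>?C. wt (shrink x) ?T \<sigma> * (x (base \<sigma>) - x i))"
      by (rule sum.union_disjoint[OF finite_nset finC T(2), folded T(1)])
    then show ?thesis using wR wC by (simp add: contr_nset)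
  qed
  also have "(\<Sum>\<sigma>\<in>?R. P * wt (shrink x) ?R \<sigma> * (x (base \<sigma>) - x i)) = P * (contr x \<rho> i - x i)"
    by (simp add: contr_nset sum_distrib_left mult.assoc)
  also have "(\<Sum>\<sigma>\<in>?C. wt (shrink x) ?C \<sigma> * (x (base \<sigma>) - x i)) =
      (\<Sum>\<sigma>\<in>?C. wt (shrink x) ?C \<sigma> * x (base \<sigma>)) - (1 - P) * x i"
    by (simp add: total[symmetric] sum_distrib_right right_diff_distrib sum_subtractf)
  finally show ?thesis by (simp add: P_def algebra_simps)
qed

text \<open>The largest contracted pipe through \<open>i\<close> bounds the whole displacement,
  because its width bound dominates those of the smaller ones.\<close>

lemma top_set:
  assumes x: "truncated x"
  obtains S where "small x S" "i \<in> S" "S = {i} \<or> S \<in> near x \<and> \<not> \<tau> \<subseteq> S"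
    "\<bar>contr x \<tau> i - x i\<bar> \<le> 4 * D * eps (card S)"
proof (cases "nset x \<tau> i = {}")
  case True
  then have "\<bar>contr x \<tau> i - x i\<bar> \<le> 4 * D * eps (card {i})"
    using eps_pos[of "card {i}"] by (simp add: contr_nset)
  then show ?thesis using that[of "{i}"] by simp
next
  case False
  then obtain S where S: "S \<in> nset x \<tau> i" "\<And>\<sigma>. \<sigma> \<in> nset x \<tau> i \<Longrightarrow> S \<subseteq> \<sigma> \<Longrightarrow> \<sigma> = S"
    using finite_has_maximal[OF finite_nset False] by metis
  have SN: "S \<in> near x" "i \<in> S" "\<not> \<tau> \<subseteq> S" using S(1) by (auto simp: nset_def)
  have "\<bar>contr x \<tau> i - x i\<bar> \<le> 4 * D * eps (card S)"
  proof (rule contr_bound[OF x])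
    fix \<sigma> assume \<sigma>: "\<sigma> \<in> nset x \<tau> i"
    then have "\<sigma> \<subseteq> S" using nset_nested[OF x S(1) \<sigma>] S(2)[OF \<sigma>] by auto
    then have "card \<sigma> \<le> card S" using pp_finite[OF near_pp[OF SN(1)]] by (simp add: card_mono)
    then show "4 * D * eps (card \<sigma>) \<le> 4 * D * eps (card S)" by (intro mult_left_mono eps_mono) auto
  qed (use eps_pos[of "card S"] in auto)
  then show ?thesis using that[of S] SN near_small by blast
qed

text \<open>The top sets at \<open>i\<close> and \<open>j\<close> cannot be nested, so
  \<open>gap\<close> keeps them at least \<open>80 * D * eps\<close> apart for either size, far more
  than the two displacements of at most \<open>4 * D * eps\<close>.\<close>

lemma edge_pos:
  assumes x: "truncated x" and ij: "cov i j"
    and sep: "\<not> (\<exists>\<sigma>\<in>near x. i \<in> \<sigma> \<and> j \<in> \<sigma> \<and> \<not> \<tau> \<subseteq> \<sigma>)"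
  shows "contr x \<tau> i < contr x \<tau> j"
proof -
  obtain S where S: "small x S" "i \<in> S" "S = {i} \<or> S \<in> near x \<and> \<not> \<tau> \<subseteq> S"
    "\<bar>contr x \<tau> i - x i\<bar> \<le> 4 * D * eps (card S)" using top_set[OF x] by blast
  obtain S' where S': "small x S'" "j \<in> S'" "S' = {j} \<or> S' \<in> near x \<and> \<not> \<tau> \<subseteq> S'"
    "\<bar>contr x \<tau> j - x j\<bar> \<le> 4 * D * eps (card S')" using top_set[OF x] by blast
  have "j \<notin> S" "i \<notin> S'" using S S' sep cov_neq[OF ij] by auto
  then have "\<not> S \<subseteq> S'" "\<not> S' \<subseteq> S" using S S' by auto
  then have g: "M * eps (card S) \<le> x j - x i" "M * eps (card S') \<le> x j - x i"
    using gap[OF x S(1) S'(1) S(2) S'(2) cov_le[OF ij]] by auto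
  have "80 * D * eps (card S) \<le> x j - x i" "80 * D * eps (card S') \<le> x j - x i"
    using g order_trans[OF M_eps] by blast+
  moreover have "0 < x j - x i" using truncated_cov[OF x ij] by simp
  ultimately show ?thesis using S(4) S'(4) by linarith
qed

text \<open>As \<open>\<tau>\<close> is not inside the top set \<open>S\<close> at \<open>i\<close>,
  some covering edge of \<open>\<tau>\<close> leaves \<open>S\<close>, and \<open>gap\<close>
  against the singleton beyond it makes \<open>alpha le \<tau> x\<close> at least
  \<open>M * eps (card S)\<close>. \<open>M\<close> is the factor \<open>20 * D\<close> demanded
  here times the \<open>4 * D\<close> in the displacement.\<close>

lemma rel_err:
  assumes x: "truncated x" and \<tau>: "pp \<tau>" and i: "i \<in> \<tau>"
  shows "20 * D * \<bar>contr x \<tau> i - x i\<bar> \<le> alpha le \<tau> x"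
proof -
  obtain S where S: "small x S" "i \<in> S" "S = {i} \<or> S \<in> near x \<and> \<not> \<tau> \<subseteq> S"
    "\<bar>contr x \<tau> i - x i\<bar> \<le> 4 * D * eps (card S)" using top_set[OF x] by blast
  have "\<not> \<tau> \<subseteq> S" using S(3) \<tau> i by (auto simp: pp_iff is_singleton_def)
  then obtain k where k: "k \<in> \<tau>" "k \<notin> S" by blast
  have "(i, k) \<in> (adj \<tau>)\<^sup>*" using pp_connected[OF \<tau>] i k by (simp add: hasse_connected_iff)
  then obtain a b where ab: "(a, b) \<in> adj \<tau>" "a \<in> S" "b \<notin> S" using leaving_edge S(2) k(2) by blast
  have up: "x p \<le> x q" if "(p, q) \<in> edges \<tau>" for p q
    using that truncated_cov[OF x] by (force simp: edges_def)
  have nn: "\<not> S \<subseteq> {b}" "\<not> {b} \<subseteq> S" using ab by auto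
  have "M * eps (card S) \<le> alpha le \<tau> x"
  proof (cases "cov a b")
    case True
    then have "M * eps (card S) \<le> x b - x a"
      using gap(1)[OF x S(1) small_singleton ab(2) _ cov_le nn] by auto
    moreover have "x b - x a \<le> alpha le \<tau> x"
      using True ab by (intro edge_le_alpha up \<tau>) (auto simp: edges_def adj_def)
    ultimately show ?thesis by linarith
  next
    case False
    then have ba: "cov b a" using ab by (auto simp: adj_def)
    then have "M * eps (card S) \<le> x a - x b"
      using gap(2)[OF x small_singleton S(1) _ ab(2) cov_le nn(2,1)] by auto
    moreover have "x a - x b \<le> alpha le \<tau> x"
      using ba ab by (intro edge_le_alpha up \<tau>) (auto simp: edges_def adj_def)
    ultimately show ?thesis by linarith
  qed
  moreover have "20 * D * \<bar>contr x \<tau> i - x i\<bar> \<le> 20 * D * (4 * D * eps (card S))"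
    using S(4) by (intro mult_left_mono) auto
  moreover have "20 * D * (4 * D * eps (card S)) = M * eps (card S)"
    by (simp add: M_def power2_eq_square)
  ultimately show ?thesis by linarith
qed

lemma alpha_diff:
  "pp \<tau> \<Longrightarrow> alpha le \<tau> x - alpha le \<tau> y = (\<Sum>(i, j)\<in>edges \<tau>. (x j - x i) - (y j - y i))"
  by (simp add: alpha_edges case_prod_unfold sum_subtractf)

text \<open>At most \<open>D\<close> edges change, each by at most
  \<open>alpha le \<tau> x / (10 * D)\<close>, half of it at either end.\<close>

lemma alpha_contr:
  assumes x: "truncated x" and \<tau>: "pp \<tau>"
  shows "9 / 10 * alpha le \<tau> x \<le> alpha le \<tau> (contr x \<tau>)" "alpha le \<tau> (contr x \<tau>) \<le> 11 / 10 * alpha le \<tau> x"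
proof -
  define B where "B = alpha le \<tau> x / (10 * D)"
  have a0: "0 < alpha le \<tau> x" using truncated_alpha[OF x \<tau>] eps_pos[of "card \<tau>"] by linarith
  have B0: "0 \<le> B" using a0 by (simp add: B_def)
  have DB: "D * B = alpha le \<tau> x / 10" using n_pos by (simp add: B_def)
  have half: "\<bar>contr x \<tau> i - x i\<bar> \<le> B / 2" if "i \<in> \<tau>" for i
  proof -
    have "\<bar>contr x \<tau> i - x i\<bar> \<le> alpha le \<tau> x / (20 * D)"
      by (subst pos_le_divide_eq) (use rel_err[OF x \<tau> that] n_pos in \<open>auto simp: mult.commute\<close>)
    then show ?thesis by (simp add: B_def)
  qed
  have e: "(contr x \<tau> j - contr x \<tau> i) - (x j - x i) \<le> B" "(x j - x i) - (contr x \<tau> j - contr x \<tau> i) \<le> B"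
    if "(i, j) \<in> edges \<tau>" for i j
  proof -
    have "i \<in> \<tau>" "j \<in> \<tau>" using that by (auto simp: edges_def)
    then show "(contr x \<tau> j - contr x \<tau> i) - (x j - x i) \<le> B" "(x j - x i) - (contr x \<tau> j - contr x \<tau> i) \<le> B"
      using half[of i] half[of j] by linarith+
  qed
  have "alpha le \<tau> (contr x \<tau>) - alpha le \<tau> x \<le> D * B"
    unfolding alpha_diff[OF \<tau>] by (rule edges_sum_le[OF \<tau> e(1) B0])
  moreover have "alpha le \<tau> x - alpha le \<tau> (contr x \<tau>) \<le> D * B"
    unfolding alpha_diff[OF \<tau>] by (rule edges_sum_le[OF \<tau> e(2) B0])
  ultimately show "9 / 10 * alpha le \<tau> x \<le> alpha le \<tau> (contr x \<tau>)"
    "alpha le \<tau> (contr x \<tau>) \<le> 11 / 10 * alpha le \<tau> x" using DB by linarith+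
qed

lemma alpha_contr_pos: "truncated x \<Longrightarrow> pp \<tau> \<Longrightarrow> 0 < alpha le \<tau> (contr x \<tau>)"
  using alpha_contr(1)[of x \<tau>] truncated_alpha[of x \<tau>] eps_pos[of "card \<tau>"] by linarith

end

section \<open>The tight pipes of a point of the truncated polytope\<close>

context affine_setting
begin

definition tight :: "(int \<Rightarrow> real) \<Rightarrow> int set set" where
  "tight x = {\<sigma>. pp \<sigma> \<and> alpha le \<sigma> x = eps (card \<sigma>)}"

lemma tight_pp: "\<sigma> \<in> tight x \<Longrightarrow> pp \<sigma>"
  by (simp add: tight_def)

lemma tight_N: "\<sigma> \<in> tight x \<Longrightarrow> \<sigma> \<in> near x"
  using eps_pos[of "card \<sigma>"] by (simp add: tight_def near_def)

lemma tight_shrink: "\<sigma> \<in> near x \<Longrightarrow> shrink x \<sigma> = 0 \<longleftrightarrow> \<sigma> \<in> tight x"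
  by (simp add: shrink_eq_0 tight_def near_def)

lemma tight_nested:
  "truncated x \<Longrightarrow> \<sigma> \<in> tight x \<Longrightarrow> \<sigma>' \<in> tight x \<Longrightarrow> i \<in> \<sigma> \<Longrightarrow> i \<in> \<sigma>' \<Longrightarrow> \<sigma> \<subseteq> \<sigma>' \<or> \<sigma>' \<subseteq> \<sigma>"
  by (meson tight_N near_nested)

lemma finite_tight_at: "finite {\<sigma> \<in> tight x. i \<in> \<sigma> \<and> Q \<sigma>}"
  by (rule finite_subset[OF _ finite_pipes_at[of i]]) (auto simp: tight_def)

text \<open>For the smallest near pipe \<open>\<rho>\<close> around the edge,
  \<open>edge_pos\<close> shows that \<open>contr x \<rho>\<close> separates its ends. Passing to
  \<open>\<tau>\<close> multiplies their difference by the factors of the pipes in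
  \<open>between\<close>, and this product vanishes exactly when one of them is tight.\<close>

lemma edge_contr:
  assumes x: "truncated x" and ij: "cov i j"
  shows "contr x \<tau> i \<le> contr x \<tau> j"
    and "contr x \<tau> i = contr x \<tau> j \<longleftrightarrow> (\<exists>\<sigma>\<in>tight x. i \<in> \<sigma> \<and> j \<in> \<sigma> \<and> \<not> \<tau> \<subseteq> \<sigma>)"
proof -
  define E where "E = {\<sigma> \<in> near x. i \<in> \<sigma> \<and> j \<in> \<sigma> \<and> \<not> \<tau> \<subseteq> \<sigma>}"
  have "contr x \<tau> i \<le> contr x \<tau> j \<and>
    (contr x \<tau> i = contr x \<tau> j \<longleftrightarrow> (\<exists>\<sigma>\<in>tight x. i \<in> \<sigma> \<and> j \<in> \<sigma> \<and> \<not> \<tau> \<subseteq> \<sigma>))"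
  proof (cases "E = {}")
    case True
    then have "contr x \<tau> i < contr x \<tau> j" using edge_pos[OF x ij, of \<tau>] by (auto simp: E_def)
    moreover have "\<not> (\<exists>\<sigma>\<in>tight x. i \<in> \<sigma> \<and> j \<in> \<sigma> \<and> \<not> \<tau> \<subseteq> \<sigma>)"
      using True tight_N[of _ x] by (auto simp: E_def)
    ultimately show ?thesis by auto
  next
    case False
    have "finite E"
      by (rule finite_subset[OF _ finite_pipes_at[of i]]) (auto simp: E_def near_def)
    then obtain \<rho> where \<rho>: "\<rho> \<in> E" "\<And>\<sigma>. \<sigma> \<in> E \<Longrightarrow> \<sigma> \<subseteq> \<rho> \<Longrightarrow> \<sigma> = \<rho>"
      using finite_has_minimal[OF _ False] by metis
    have \<rho>near: "\<rho> \<in> near x" "i \<in> \<rho>" "j \<in> \<rho>" "\<not> \<tau> \<subseteq> \<rho>" using \<rho>(1) by (auto simp: E_def)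
    define P where "P = (\<Prod>\<sigma>\<in>between x \<rho> \<tau>. shrink x \<sigma>)"
    have diff: "contr x \<tau> j - contr x \<tau> i = P * (contr x \<rho> j - contr x \<rho> i)"
      using contr_scale[OF x, of \<rho> \<tau> i] contr_scale[OF x, of \<rho> \<tau> j] \<rho>near
      by (simp add: P_def algebra_simps)
    have "\<not> (\<exists>\<sigma>\<in>near x. i \<in> \<sigma> \<and> j \<in> \<sigma> \<and> \<not> \<rho> \<subseteq> \<sigma>)"
    proof
      assume "\<exists>\<sigma>\<in>near x. i \<in> \<sigma> \<and> j \<in> \<sigma> \<and> \<not> \<rho> \<subseteq> \<sigma>"
      then obtain \<sigma> where \<sigma>: "\<sigma> \<in> near x" "i \<in> \<sigma>" "j \<in> \<sigma>" "\<not> \<rho> \<subseteq> \<sigma>" by blast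
      then have "\<sigma> \<subseteq> \<rho>" using near_nested[OF x \<sigma>(1) \<rho>near(1) \<sigma>(2) \<rho>near(2)] by blast
      moreover from this have "\<sigma> \<in> E" using \<sigma> \<rho>near by (auto simp: E_def)
      ultimately show False using \<rho>(2) \<sigma>(4) by blast
    qed
    then have pos: "contr x \<rho> i < contr x \<rho> j" by (rule edge_pos[OF x ij])
    have "0 \<le> P" unfolding P_def
      using shrink_nonneg[OF x] by (intro prod_nonneg) (auto simp: between_def near_def)
    moreover have "P = 0 \<longleftrightarrow> (\<exists>\<sigma>\<in>tight x. i \<in> \<sigma> \<and> j \<in> \<sigma> \<and> \<not> \<tau> \<subseteq> \<sigma>)"
    proof -
      have fin: "finite (between x \<rho> \<tau>)" using finite_between \<rho>near(2) by blast
      have "P = 0 \<longleftrightarrow> (\<exists>\<sigma>\<in>between x \<rho> \<tau>. shrink x \<sigma> = 0)"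
        unfolding P_def by (rule prod_zero_iff[OF fin])
      also have "\<dots> \<longleftrightarrow> (\<exists>\<sigma>\<in>tight x. \<rho> \<subseteq> \<sigma> \<and> \<not> \<tau> \<subseteq> \<sigma>)"
        using tight_shrink[of _ x] tight_N[of _ x] unfolding between_def by blast
      also have "\<dots> \<longleftrightarrow> (\<exists>\<sigma>\<in>tight x. i \<in> \<sigma> \<and> j \<in> \<sigma> \<and> \<not> \<tau> \<subseteq> \<sigma>)"
      proof -
        have "\<rho> \<subseteq> \<sigma>" if "\<sigma> \<in> tight x" "i \<in> \<sigma>" "j \<in> \<sigma>" "\<not> \<tau> \<subseteq> \<sigma>" for \<sigma>
        proof -
          have "\<sigma> \<in> E" using that tight_N by (simp add: E_def)
          then show ?thesis
            using near_nested[OF x tight_N[OF that(1)] \<rho>near(1) that(2) \<rho>near(2)] \<rho>(2) by blast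
        qed
        then show ?thesis using \<rho>near by blast
      qed
      finally show ?thesis .
    qed
    moreover have "0 \<le> contr x \<tau> j - contr x \<tau> i"
      unfolding diff using \<open>0 \<le> P\<close> pos by (intro mult_nonneg_nonneg) auto
    moreover have "contr x \<tau> i = contr x \<tau> j \<longleftrightarrow> P = 0"
      using diff pos by (metis diff_gt_0_iff_gt eq_iff_diff_eq_0 less_irrefl mult_eq_0_iff)
    ultimately show ?thesis by simp
  qed
  then show "contr x \<tau> i \<le> contr x \<tau> j"
    and "contr x \<tau> i = contr x \<tau> j \<longleftrightarrow> (\<exists>\<sigma>\<in>tight x. i \<in> \<sigma> \<and> j \<in> \<sigma> \<and> \<not> \<tau> \<subseteq> \<sigma>)" by auto
qed

lemma contr_mono: "truncated x \<Longrightarrow> order_mono (contr x \<tau>)"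
  unfolding order_mono_def
proof (intro allI impI)
  fix i j assume x: "truncated x" and ij: "le i j"
  show "contr x \<tau> i \<le> contr x \<tau> j"
    using saturated_chain[OF ij]
  proof (induction rule: rtrancl_induct)
    case (step y z)
    then show ?case using edge_contr(1)[OF x, of y z \<tau>] by auto
  qed simp
qed

lemma adj_contr:
  assumes "truncated x" "(a, b) \<in> adj \<sigma>"
  shows "contr x \<tau> a = contr x \<tau> b \<longleftrightarrow> (\<exists>\<sigma>'\<in>tight x. a \<in> \<sigma>' \<and> b \<in> \<sigma>' \<and> \<not> \<tau> \<subseteq> \<sigma>')"
proof (cases "cov a b")
  case True
  then show ?thesis by (rule edge_contr(2)[OF assms(1)])
next
  case False
  then have "cov b a" using assms(2) by (auto simp: adj_def)
  have "contr x \<tau> a = contr x \<tau> b \<longleftrightarrow> contr x \<tau> b = contr x \<tau> a" by (rule eq_commute)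
  also have "\<dots> \<longleftrightarrow> (\<exists>\<sigma>'\<in>tight x. b \<in> \<sigma>' \<and> a \<in> \<sigma>' \<and> \<not> \<tau> \<subseteq> \<sigma>')"
    by (rule edge_contr(2)[OF assms(1) \<open>cov b a\<close>])
  finally show ?thesis by (simp add: conj_left_commute)
qed

lemma contr_const_tight:
  assumes x: "truncated x" and \<sigma>: "\<sigma> \<in> tight x" "\<not> \<tau> \<subseteq> \<sigma>" and ij: "i \<in> \<sigma>" "j \<in> \<sigma>"
  shows "contr x \<tau> i = contr x \<tau> j"
proof -
  have "(i, j) \<in> (adj \<sigma>)\<^sup>*" using pp_connected[OF tight_pp[OF \<sigma>(1)]] ij by (simp add: hasse_connected_iff)
  then show ?thesis
  proof (induction rule: rtrancl_induct)
    case (step y z)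
    have "y \<in> \<sigma>" "z \<in> \<sigma>" using step(2) by (auto simp: adj_def)
    then have "contr x \<tau> y = contr x \<tau> z" using adj_contr[OF x step(2), of \<tau>] \<sigma> by blast
    then show ?case using step.IH by simp
  qed simp
qed

text \<open>Every covering edge of \<open>\<sigma>\<close> lies in a tight pipe not containing
  \<open>\<tau>\<close>. If a maximal such pipe around \<open>i\<close> missed part of
  \<open>\<sigma>\<close>, an edge leaving it would lie in another one, which nestedness makes
  larger.\<close>

lemma contr_const_pipe:
  assumes x: "truncated x" and \<sigma>: "hasse_connected le \<sigma>" "\<not> is_singleton \<sigma>" "\<sigma> \<noteq> {}"
    and const: "\<And>i j. i \<in> \<sigma> \<Longrightarrow> j \<in> \<sigma> \<Longrightarrow> contr x \<tau> i = contr x \<tau> j"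
  obtains \<sigma>' where "\<sigma>' \<in> tight x" "\<sigma> \<subseteq> \<sigma>'" "\<not> \<tau> \<subseteq> \<sigma>'"
proof -
  obtain i where i: "i \<in> \<sigma>" using \<sigma> by blast
  have edge: "\<exists>\<sigma>'\<in>tight x. a \<in> \<sigma>' \<and> b \<in> \<sigma>' \<and> \<not> \<tau> \<subseteq> \<sigma>'" if "(a, b) \<in> adj \<sigma>" for a b
  proof -
    have "a \<in> \<sigma>" "b \<in> \<sigma>" using that by (auto simp: adj_def)
    then have "contr x \<tau> a = contr x \<tau> b" by (rule const)
    then show ?thesis using adj_contr[OF x that, of \<tau>] by simp
  qed
  have leave: "\<exists>a b. (a, b) \<in> adj \<sigma> \<and> a \<in> S \<and> b \<notin> S" if S: "i \<in> S" "\<not> \<sigma> \<subseteq> S" for S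
  proof -
    obtain k where k: "k \<in> \<sigma>" "k \<notin> S" using S by blast
    then have "(i, k) \<in> (adj \<sigma>)\<^sup>*" using \<sigma>(1) i by (simp add: hasse_connected_iff)
    then show ?thesis using leaving_edge[of i k \<sigma> S] S(1) k(2) by metis
  qed
  define E where "E = {\<sigma>' \<in> tight x. i \<in> \<sigma>' \<and> \<not> \<tau> \<subseteq> \<sigma>'}"
  have "\<not> \<sigma> \<subseteq> {i}" using \<sigma>(2) i by (auto simp: is_singleton_def)
  then obtain b where "(i, b) \<in> adj \<sigma>" using leave[of "{i}"] by auto
  then have "E \<noteq> {}" using edge[of i b] unfolding E_def by auto
  moreover have "finite E" unfolding E_def by (rule finite_tight_at)
  ultimately obtain S where S: "S \<in> E" "\<And>\<sigma>'. \<sigma>' \<in> E \<Longrightarrow> S \<subseteq> \<sigma>' \<Longrightarrow> \<sigma>' = S"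
    using finite_has_maximal[of E] by metis
  have "\<sigma> \<subseteq> S"
  proof (rule ccontr)
    assume "\<not> \<sigma> \<subseteq> S"
    then obtain a b where ab: "(a, b) \<in> adj \<sigma>" "a \<in> S" "b \<notin> S" using leave[of S] S(1) by (auto simp: E_def)
    then obtain \<sigma>' where \<sigma>': "\<sigma>' \<in> tight x" "a \<in> \<sigma>'" "b \<in> \<sigma>'" "\<not> \<tau> \<subseteq> \<sigma>'" using edge[OF ab(1)] by auto
    have "S \<subseteq> \<sigma>'" using tight_nested[OF x _ \<sigma>'(1) ab(2) \<sigma>'(2)] S(1) ab(3) \<sigma>'(3) unfolding E_def by blast
    moreover from this have "\<sigma>' \<in> E" using \<sigma>' S(1) unfolding E_def by blast
    ultimately show False using S(2) ab(3) \<sigma>'(3) by blast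
  qed
  then show ?thesis using that S(1) unfolding E_def by blast
qed

section \<open>The image of a point and its piping\<close>

definition ctr :: "(int \<Rightarrow> real) \<Rightarrow> int \<Rightarrow> real" where
  "ctr v i = v i - (\<Sum>k\<in>{1..int n}. v k) / real n"

text \<open>The contraction depends on the coordinate. Pipes containing \<open>\<tau>\<close>, and
  \<open>\<tau>\<close> itself, would act on it by a mere rescaling, which destroys it when they are
  tight; so the coordinate is taken before they act.\<close>

definition comp_map :: "(int \<Rightarrow> real) \<Rightarrow> int set \<Rightarrow> int \<Rightarrow> real" where
  "comp_map x = (\<lambda>\<tau>\<in>{\<tau>. nontriv_pipe n le \<tau>}. coord le (if \<tau> = UNIV then ctr (contr x \<tau>) else contr x \<tau>) \<tau>)"

lemma comp_map_UNIV: "comp_map x UNIV = ctr (contr x UNIV)"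
  by (simp add: comp_map_def nontriv_UNIV coord_def)

lemma comp_map_pp: "pp \<tau> \<Longrightarrow> comp_map x \<tau> = coord le (contr x \<tau>) \<tau>"
  by (simp add: comp_map_def nontriv_iff pp_not_UNIV)

lemma coord_pp:
  "pp \<tau> \<Longrightarrow> i \<in> \<tau> \<Longrightarrow> coord le v \<tau> i = (v i - (\<Sum>k\<in>\<tau>. v k) / real (card \<tau>)) / alpha le \<tau> v"
  by (simp add: coord_def pp_not_UNIV)

lemma comp_map_diff_pp:
  "pp \<tau> \<Longrightarrow> i \<in> \<tau> \<Longrightarrow> j \<in> \<tau> \<Longrightarrow> comp_map x \<tau> i - comp_map x \<tau> j = (contr x \<tau> i - contr x \<tau> j) / alpha le \<tau> (contr x \<tau>)"
  by (simp add: comp_map_pp coord_pp diff_divide_distrib)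

lemma comp_map_diff_UNIV: "comp_map x UNIV i - comp_map x UNIV j = contr x UNIV i - contr x UNIV j"
  by (simp add: comp_map_UNIV ctr_def)

lemma comp_map_eq_iff:
  assumes "truncated x" "\<tau> = UNIV \<or> pp \<tau>" "i \<in> \<tau>" "j \<in> \<tau>"
  shows "comp_map x \<tau> i = comp_map x \<tau> j \<longleftrightarrow> contr x \<tau> i = contr x \<tau> j"
  using assms(2)
proof
  assume "\<tau> = UNIV"
  then show ?thesis using comp_map_diff_UNIV[of x i j] by auto
next
  assume "pp \<tau>"
  then show ?thesis using comp_map_diff_pp[OF _ assms(3,4), of x] alpha_contr_pos[OF assms(1), of \<tau>] by auto
qed

lemma const_pipes_comp_map:
  assumes "truncated x" "\<tau> = UNIV \<or> pp \<tau>"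
  shows "const_pipes n le \<tau> (comp_map x \<tau>) =
    {\<sigma>. pipe n le \<sigma> \<and> \<sigma> \<subseteq> \<tau> \<and> (\<forall>i\<in>\<sigma>. \<forall>j\<in>\<sigma>. contr x \<tau> i = contr x \<tau> j)}"
  unfolding const_pipes_def using comp_map_eq_iff[OF assms] by blast

lemma pipe_connected: "pipe n le \<sigma> \<Longrightarrow> hasse_connected le \<sigma> \<and> \<sigma> \<noteq> {}"
  by (simp add: pipe_def)

lemma const_pipes_tight:
  assumes "truncated x" "\<tau> = UNIV \<or> \<tau> \<in> tight x" "\<sigma> \<in> const_pipes n le \<tau> (comp_map x \<tau>)" "\<not> is_singleton \<sigma>"
  obtains \<sigma>' where "\<sigma>' \<in> tight x" "\<sigma> \<subseteq> \<sigma>'" "\<sigma>' \<subset> \<tau>"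
proof -
  have \<tau>: "\<tau> = UNIV \<or> pp \<tau>" using assms(2) tight_pp by blast
  have \<sigma>: "pipe n le \<sigma>" "\<sigma> \<subseteq> \<tau>" "\<And>i j. i \<in> \<sigma> \<Longrightarrow> j \<in> \<sigma> \<Longrightarrow> contr x \<tau> i = contr x \<tau> j"
  proof -
    have *: "pipe n le \<sigma> \<and> \<sigma> \<subseteq> \<tau> \<and> (\<forall>i\<in>\<sigma>. \<forall>j\<in>\<sigma>. contr x \<tau> i = contr x \<tau> j)"
      using assms(3) unfolding const_pipes_comp_map[OF assms(1) \<tau>] by (rule CollectD)
    then show "pipe n le \<sigma>" "\<sigma> \<subseteq> \<tau>" by simp_all
    show "contr x \<tau> i = contr x \<tau> j" if "i \<in> \<sigma>" "j \<in> \<sigma>" for i j using * that by metis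
  qed
  obtain i where i: "i \<in> \<sigma>" using pipe_connected[OF \<sigma>(1)] by blast
  obtain \<sigma>' where \<sigma>': "\<sigma>' \<in> tight x" "\<sigma> \<subseteq> \<sigma>'" "\<not> \<tau> \<subseteq> \<sigma>'"
    using contr_const_pipe[OF assms(1) _ assms(4) _ \<sigma>(3)] pipe_connected[OF \<sigma>(1)] by blast
  have "\<sigma>' \<subseteq> \<tau>"
    using assms(2) tight_nested[OF assms(1) \<sigma>'(1), of \<tau> i] i \<sigma>(2) \<sigma>'(2,3) by blast
  then show ?thesis using that \<sigma>' by blast
qed

lemma tight_const_pipes:
  assumes "truncated x" "\<tau> = UNIV \<or> \<tau> \<in> tight x" "\<sigma> \<in> tight x" "\<sigma> \<subset> \<tau>"
  shows "\<sigma> \<in> const_pipes n le \<tau> (comp_map x \<tau>)"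
proof -
  have \<tau>: "\<tau> = UNIV \<or> pp \<tau>" using assms(2) tight_pp by blast
  show ?thesis
    unfolding const_pipes_comp_map[OF assms(1) \<tau>]
    using contr_const_tight[OF assms(1,3)] assms(4) tight_pp[OF assms(3)] pipe_iff by blast
qed

lemma T_hat_comp_map_sub:
  assumes "truncated x" "\<tau> \<in> T_hat n le (comp_map x)"
  shows "\<tau> = UNIV \<or> \<tau> \<in> tight x \<or> is_singleton \<tau>"
  using assms(2)
proof (induction rule: T_hat.induct)
  case (step \<tau> \<sigma>)
  then have \<tau>: "\<tau> = UNIV \<or> \<tau> \<in> tight x" by blast
  have \<sigma>: "\<sigma> \<in> const_pipes n le \<tau> (comp_map x \<tau>)"
    "\<And>\<sigma>'. \<sigma>' \<in> const_pipes n le \<tau> (comp_map x \<tau>) \<Longrightarrow> \<sigma> \<subseteq> \<sigma>' \<Longrightarrow> \<sigma>' = \<sigma>"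
    using step(3) by (auto simp: B_pipes_def)
  show ?case
  proof (cases "is_singleton \<sigma>")
    case False
    then obtain \<sigma>' where "\<sigma>' \<in> tight x" "\<sigma> \<subseteq> \<sigma>'" "\<sigma>' \<subset> \<tau>"
      using const_pipes_tight[OF assms(1) \<tau> \<sigma>(1)] by blast
    then show ?thesis using \<sigma>(2) tight_const_pipes[OF assms(1) \<tau>] by blast
  qed simp
qed simp

text \<open>Induction from large pipes to small: a tight pipe is a maximal constant pipe in the
  coordinate of its parent, the next larger tight pipe or \<open>UNIV\<close>.\<close>

lemma tight_T_hat:
  assumes x: "truncated x"
  shows "\<sigma> \<in> tight x \<Longrightarrow> \<sigma> \<in> T_hat n le (comp_map x)"
proof (induction "n - card \<sigma>" arbitrary: \<sigma> rule: less_induct)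
  case less
  obtain i where i: "i \<in> \<sigma>" using pp_nonempty[OF tight_pp[OF less.prems]] by blast
  define E where "E = {\<rho> \<in> tight x. i \<in> \<rho> \<and> \<sigma> \<subset> \<rho>}"
  have E_iff: "\<rho> \<in> E \<longleftrightarrow> \<rho> \<in> tight x \<and> \<sigma> \<subset> \<rho>" for \<rho> using i by (auto simp: E_def)
  have finE: "finite E" unfolding E_def by (rule finite_tight_at)
  obtain \<rho> where \<rho>: "\<rho> = UNIV \<or> \<rho> \<in> tight x" "\<sigma> \<subset> \<rho>" "\<rho> \<in> T_hat n le (comp_map x)"
    "\<And>\<sigma>'. \<sigma>' \<in> E \<Longrightarrow> \<not> \<sigma>' \<subset> \<rho>"
  proof (cases "E = {}")
    case True
    have "\<sigma> \<noteq> UNIV" using pp_not_UNIV[OF tight_pp[OF less.prems]] .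
    then show ?thesis using that[of UNIV] True T_hat.top by blast
  next
    case False
    then obtain \<rho> where \<rho>: "\<rho> \<in> E" "\<And>\<sigma>'. \<sigma>' \<in> E \<Longrightarrow> \<sigma>' \<subseteq> \<rho> \<Longrightarrow> \<sigma>' = \<rho>"
      using finite_has_minimal[OF finE] by metis
    then have A: "\<rho> \<in> tight x" "\<sigma> \<subset> \<rho>" by (auto simp: E_iff)
    have "card \<sigma> < card \<rho>" "card \<rho> \<le> n"
      using A pp_finite[OF tight_pp] pp_card[OF tight_pp] psubset_card_mono by blast+
    then have "\<rho> \<in> T_hat n le (comp_map x)" using less.hyps[of \<rho>] A(1) by simp
    then show ?thesis using that[of \<rho>] A \<rho>(2) by blast
  qed
  have "\<not> is_singleton \<rho>"
  proof
    assume "is_singleton \<rho>"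
    then show False using \<rho>(2) i by (auto simp: is_singleton_def)
  qed
  moreover have "\<sigma> \<in> B_pipes n le \<rho> (comp_map x \<rho>)"
    unfolding B_pipes_def
  proof (intro CollectI conjI ballI impI)
    show "\<sigma> \<in> const_pipes n le \<rho> (comp_map x \<rho>)" by (rule tight_const_pipes[OF x \<rho>(1) less.prems \<rho>(2)])
    fix \<sigma>'' assume \<sigma>'': "\<sigma>'' \<in> const_pipes n le \<rho> (comp_map x \<rho>)" "\<sigma> \<subseteq> \<sigma>''"
    have "\<not> is_singleton \<sigma>''"
    proof
      assume "is_singleton \<sigma>''"
      then have "is_singleton \<sigma>" using \<sigma>''(2) i by (auto simp: is_singleton_def)
      then show False using tight_pp[OF less.prems] by (simp add: pp_iff)
    qed
    then obtain \<sigma>' where \<sigma>': "\<sigma>' \<in> tight x" "\<sigma>'' \<subseteq> \<sigma>'" "\<sigma>' \<subset> \<rho>"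
      using const_pipes_tight[OF x \<rho>(1) \<sigma>''(1)] by blast
    then have "\<not> \<sigma> \<subset> \<sigma>'" using \<rho>(4)[of \<sigma>'] E_iff by blast
    then show "\<sigma>'' = \<sigma>" using \<sigma>''(2) \<sigma>'(2) by blast
  qed
  ultimately show ?case using T_hat.step[OF \<rho>(3)] by blast
qed

lemma piping_of_comp_map: "truncated x \<Longrightarrow> piping_of n le (comp_map x) = tight x"
  unfolding piping_of_def
  using T_hat_comp_map_sub[of x] tight_T_hat[of x] tight_pp pp_not_UNIV pp_iff by blast

lemma alpha_eps_sh: "quasi_periodic x \<Longrightarrow> pp \<sigma> \<Longrightarrow> sh d \<sigma> \<in> tight x \<longleftrightarrow> \<sigma> \<in> tight x"
  by (simp add: tight_def alpha_sh_quasi_periodic)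

lemma tight_piping:
  assumes x: "truncated x"
  shows "proper_piping n le (tight x)"
  unfolding proper_piping_def piping_def
proof (intro conjI ballI)
  show "pipe n le \<tau>" if "\<tau> \<in> tight x" for \<tau> using tight_pp[OF that] pipe_iff by blast
  show "pp \<tau>" if "\<tau> \<in> tight x" for \<tau> using tight_pp[OF that] .
  show "pipe_class n \<tau> \<subseteq> tight x" if "\<tau> \<in> tight x" for \<tau>
    using that alpha_eps_sh[OF truncated_quasi_periodic[OF x] tight_pp[OF that]] by (auto simp: pipe_class_def)
  show "\<tau> \<subseteq> \<tau>' \<or> \<tau>' \<subseteq> \<tau> \<or> \<tau> \<inter> \<tau>' = {}" if "\<tau> \<in> tight x" "\<tau>' \<in> tight x" for \<tau> \<tau>'
    using tight_nested[OF x that] by blast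
  let ?r = "{(\<tau>, \<tau>'). \<tau> \<in> tight x \<and> \<tau>' \<in> tight x \<and> \<tau> \<inter> \<tau>' = {} \<and> (\<exists>i\<in>\<tau>. \<exists>j\<in>\<tau>'. strict le i j)}"
  show "acyclic ?r"
  \<comment> \<open>\<open>x\<close> at base points increases along the edges of the graph, since
    the gap between two disjoint tight pipes exceeds their widths together.\<close>
  proof (rule acyclicI_order[where f = "\<lambda>\<tau>. - x (base \<tau>)"])
    fix \<tau> \<tau>' assume "(\<tau>, \<tau>') \<in> ?r"
    then obtain i j where *: "\<tau> \<in> tight x" "\<tau>' \<in> tight x" "\<tau> \<inter> \<tau>' = {}" "i \<in> \<tau>" "j \<in> \<tau>'" "strict le i j"
      by blast
    have sm: "small x \<tau>" "small x \<tau>'" using * tight_N near_small by blast+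
    have nn: "\<not> \<tau> \<subseteq> \<tau>'" "\<not> \<tau>' \<subseteq> \<tau>" using * by blast+
    have lij: "le i j" using *(6) by (simp add: strict_def)
    have "80 * D * eps (card \<tau>) \<le> x j - x i" "80 * D * eps (card \<tau>') \<le> x j - x i"
      using gap[OF x sm *(4,5) lij nn] order_trans[OF M_eps] by blast+
    moreover have "x (base \<tau>) - x i \<le> 4 * D * eps (card \<tau>)"
      using small_spread[OF x sm(1) base_in[OF tight_pp[OF *(1)]] *(4)] .
    moreover have "x j - x (base \<tau>') \<le> 4 * D * eps (card \<tau>')"
      using small_spread[OF x sm(2) *(5) base_in[OF tight_pp[OF *(2)]]] .
    moreover have "x i < x j" using truncated_strict[OF x *(6)] .
    ultimately show "- x (base \<tau>') < - x (base \<tau>)" by linarith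
  qed
qed

end

section \<open>The map to the compactification\<close>

context affine_setting
begin

lemma inj_sh: "inj_on (sh d) S"
  by (auto simp: inj_on_def)

lemma sh_psubset [simp]: "sh d \<sigma> \<subset> sh d \<tau> \<longleftrightarrow> \<sigma> \<subset> \<tau>"
  by (simp add: psubset_eq)

lemma shrink_sh: "quasi_periodic x \<Longrightarrow> pp \<sigma> \<Longrightarrow> shrink x (sh d \<sigma>) = shrink x \<sigma>"
  by (simp add: shrink_def alpha_sh_quasi_periodic)

lemma base_sh: "pp \<sigma> \<Longrightarrow> base (sh d \<sigma>) = base \<sigma> + d * int n"
  unfolding base_def shift_def
  by (rule mono_Min_commute[symmetric]) (auto simp: mono_def pp_finite pp_nonempty)

lemma pset_sh: "pset (sh d \<tau>) (i + d * int n) = sh d ` pset \<tau> i"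
proof
  show "sh d ` pset \<tau> i \<subseteq> pset (sh d \<tau>) (i + d * int n)" by (auto simp: pset_def)
  show "pset (sh d \<tau>) (i + d * int n) \<subseteq> sh d ` pset \<tau> i"
  proof
    fix \<sigma> assume \<sigma>: "\<sigma> \<in> pset (sh d \<tau>) (i + d * int n)"
    have eq: "\<sigma> = sh d (sh (- d) \<sigma>)" by (simp add: sh_sh)
    have "sh (- d) \<sigma> \<in> pset \<tau> i"
      using \<sigma> sh_subset[of d \<tau> "sh (- d) \<sigma>"] by (simp add: pset_def mem_sh sh_sh)
    then show "\<sigma> \<in> sh d ` pset \<tau> i" using eq by blast
  qed
qed

lemma contr_sh:
  assumes x: "quasi_periodic x"
  shows "contr x (sh d \<tau>) (i + d * int n) = contr x \<tau> i + real_of_int d * c"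
proof -
  let ?S = "pset \<tau> i"
  have pp: "pp \<sigma>" if "\<sigma> \<in> ?S" for \<sigma> using that by (simp add: pset_def)
  have w: "wt (shrink x) (sh d ` ?S) (sh d \<sigma>) = wt (shrink x) ?S \<sigma>" if "\<sigma> \<in> ?S" for \<sigma>
  proof -
    have "{\<rho> \<in> sh d ` ?S. sh d \<sigma> \<subset> \<rho>} = sh d ` {\<rho> \<in> ?S. \<sigma> \<subset> \<rho>}"
      by (simp add: Compr_image_eq)
    then have "(\<Prod>\<rho>\<in>{\<rho> \<in> sh d ` ?S. sh d \<sigma> \<subset> \<rho>}. shrink x \<rho>) = (\<Prod>\<rho>\<in>{\<rho> \<in> ?S. \<sigma> \<subset> \<rho>}. shrink x (sh d \<rho>))"
      by (simp add: prod.reindex[OF inj_sh] comp_def)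
    also have "\<dots> = (\<Prod>\<rho>\<in>{\<rho> \<in> ?S. \<sigma> \<subset> \<rho>}. shrink x \<rho>)"
      by (rule prod.cong) (auto simp: shrink_sh x pp)
    finally show ?thesis using that by (simp add: wt_def shrink_sh x pp)
  qed
  have "contr x (sh d \<tau>) (i + d * int n) = x (i + d * int n) +
      (\<Sum>\<sigma>\<in>?S. wt (shrink x) (sh d ` ?S) (sh d \<sigma>) * (x (base (sh d \<sigma>)) - x (i + d * int n)))"
    by (simp add: contr_def pset_sh sum.reindex[OF inj_sh] comp_def)
  also have "\<dots> = x i + real_of_int d * c + (\<Sum>\<sigma>\<in>?S. wt (shrink x) ?S \<sigma> * (x (base \<sigma>) - x i))"
    using w by (simp add: base_sh pp quasi_periodic_shift[OF x] cong: sum.cong)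
  finally show ?thesis by (simp add: contr_def)
qed

lemma quasi_periodic_contr: "quasi_periodic x \<Longrightarrow> quasi_periodic (contr x UNIV)"
  using contr_sh[of x 1 UNIV] by (simp add: quasi_periodic_def)

lemma alpha_contr_sh: "quasi_periodic x \<Longrightarrow> pp \<tau> \<Longrightarrow> alpha le (sh d \<tau>) (contr x (sh d \<tau>)) = alpha le \<tau> (contr x \<tau>)"
  by (rule alpha_sh) (simp_all add: contr_sh)

lemma ctr_seq_space: "quasi_periodic v \<Longrightarrow> ctr v \<in> seq_space n c"
  using n_pos by (simp add: seq_space_def quasi_periodic_def ctr_def sum_subtractf)

lemma coord_sh:
  assumes v: "\<And>k. k \<in> \<tau> \<Longrightarrow> v' (k + d * int n) = v k + b" and \<tau>: "pp \<tau>" and i: "i \<in> \<tau>"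
  shows "coord le v' (sh d \<tau>) (i + d * int n) = coord le v \<tau> i"
proof -
  have "alpha le (sh d \<tau>) v' = alpha le \<tau> v"
    using v by (intro alpha_sh \<tau>) (simp add: edges_def)
  moreover have "(\<Sum>k\<in>sh d \<tau>. v' k) = (\<Sum>k\<in>\<tau>. v k) + real (card \<tau>) * b"
  proof -
    have "(\<Sum>k\<in>sh d \<tau>. v' k) = (\<Sum>k\<in>\<tau>. v' (k + d * int n))"
      unfolding shift_def by (subst sum.reindex) (auto simp: inj_on_def)
    then show ?thesis using v by (simp add: sum.distrib)
  qed
  moreover have "real (card \<tau>) \<noteq> 0" using pp_finite[OF \<tau>] pp_nonempty[OF \<tau>] by simp
  ultimately show ?thesis using v[OF i] i \<tau> by (simp add: coord_pp add_divide_distrib)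
qed

lemma coord_affine:
  assumes v: "\<And>k. k \<in> \<tau> \<Longrightarrow> v k = P * w k + b" and P: "P > 0" and \<tau>: "pp \<tau>"
  shows "coord le v \<tau> = coord le w \<tau>"
proof (rule ext)
  fix i
  show "coord le v \<tau> i = coord le w \<tau> i"
  proof (cases "i \<in> \<tau>")
    case True
    have "alpha le \<tau> v = (\<Sum>(i, j)\<in>edges \<tau>. P * (w j - w i))"
      unfolding alpha_edges[OF \<tau>] by (rule sum.cong) (auto simp: edges_def v algebra_simps)
    then have a: "alpha le \<tau> v = P * alpha le \<tau> w"
      by (simp add: alpha_edges[OF \<tau>] sum_distrib_left case_prod_unfold)
    have card0: "real (card \<tau>) \<noteq> 0" using pp_finite[OF \<tau>] pp_nonempty[OF \<tau>] by simp
    have "(\<Sum>k\<in>\<tau>. v k) = P * (\<Sum>k\<in>\<tau>. w k) + real (card \<tau>) * b"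
      using v by (simp add: sum.distrib sum_distrib_left)
    then have "v i - (\<Sum>k\<in>\<tau>. v k) / real (card \<tau>) = P * (w i - (\<Sum>k\<in>\<tau>. w k) / real (card \<tau>))"
      using v[OF True] card0 by (simp add: field_simps)
    then show ?thesis using P a by (simp add: coord_pp[OF \<tau> True])
  next
    case False
    then show ?thesis using pp_not_UNIV[OF \<tau>] by (simp add: coord_def)
  qed
qed

lemma coord_O_pipe:
  assumes v: "order_mono v" and a: "0 < alpha le \<tau> v" and \<tau>: "pp \<tau>"
  shows "coord le v \<tau> \<in> O_pipe le \<tau>"
proof -
  define b where "b = (\<Sum>k\<in>\<tau>. v k) / real (card \<tau>)"
  have card0: "real (card \<tau>) \<noteq> 0" using pp_finite[OF \<tau>] pp_nonempty[OF \<tau>] by simp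
  have eq: "coord le v \<tau> i = (v i - b) / alpha le \<tau> v" if "i \<in> \<tau>" for i
    using coord_pp[OF \<tau> that] by (simp add: b_def)
  have "coord le v \<tau> \<in> extensional \<tau>" using pp_not_UNIV[OF \<tau>] by (simp add: coord_def)
  moreover have "(\<Sum>i\<in>\<tau>. coord le v \<tau> i) = 0"
  proof -
    have "(\<Sum>i\<in>\<tau>. coord le v \<tau> i) = (\<Sum>i\<in>\<tau>. v i - b) / alpha le \<tau> v"
      by (simp add: eq sum_divide_distrib)
    also have "(\<Sum>i\<in>\<tau>. v i - b) = 0" using card0 by (simp add: sum_subtractf b_def)
    finally show ?thesis by simp
  qed
  moreover have "coord le v \<tau> i \<le> coord le v \<tau> j" if "i \<in> \<tau>" "j \<in> \<tau>" "le i j" for i j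
    using that v a by (simp add: eq order_mono_def divide_right_mono)
  moreover have "alpha le \<tau> (coord le v \<tau>) = 1"
  proof -
    have "alpha le \<tau> (coord le v \<tau>) = (\<Sum>(i, j)\<in>edges \<tau>. (v j - v i) / alpha le \<tau> v)"
      unfolding alpha_edges[OF \<tau>, of "coord le v \<tau>"]
      by (rule sum.cong) (auto simp: edges_def eq diff_divide_distrib)
    also have "\<dots> = (\<Sum>(i, j)\<in>edges \<tau>. v j - v i) / alpha le \<tau> v"
      by (simp add: sum_divide_distrib case_prod_unfold)
    also have "\<dots> = alpha le \<tau> v / alpha le \<tau> v" by (simp only: alpha_edges[OF \<tau>])
    finally show ?thesis using a by simp
  qed
  ultimately show ?thesis by (simp add: O_pipe_def)
qed

lemma comp_map_compat: assumes x: "truncated x" shows "comp_map x \<in> compat_prod n le c"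
proof -
  have "comp_map x \<tau> \<in> (if \<tau> = UNIV then O_affine n le c else O_pipe le \<tau>)" if "nontriv_pipe n le \<tau>" for \<tau>
  proof (cases "\<tau> = UNIV")
    case True
    have "ctr (contr x UNIV) \<in> seq_space n c" using ctr_seq_space quasi_periodic_contr truncated_quasi_periodic x by blast
    moreover have "ctr (contr x UNIV) i \<le> ctr (contr x UNIV) j" if "le i j" for i j
      using contr_mono[OF x, of UNIV] that by (simp add: order_mono_def ctr_def)
    ultimately show ?thesis using True by (simp add: comp_map_UNIV O_affine_def)
  next
    case False
    then have "pp \<tau>" using that nontriv_iff by blast
    then show ?thesis using False coord_O_pipe[OF contr_mono[OF x] alpha_contr_pos[OF x]] by (simp add: comp_map_pp)
  qed
  moreover have "comp_map x (sh d \<tau>) (i + d * int n) = comp_map x \<tau> i" if "pp \<tau>" "i \<in> \<tau>" for \<tau> d i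
    using that coord_sh[of \<tau> "contr x (sh d \<tau>)" d "contr x \<tau>" "real_of_int d * c" i]
    by (simp add: comp_map_pp contr_sh truncated_quasi_periodic x)
  ultimately show ?thesis by (auto simp: compat_prod_def comp_map_def)
qed

text \<open>Without tight pipes all factors are positive, so on each \<open>\<tau>\<close> the
  contraction for \<open>UNIV\<close> is a positive affine image of the one for
  \<open>\<tau>\<close>, and normalising identifies the two.\<close>

lemma comp_map_interior:
  assumes x: "truncated x" and int: "tight x = {}"
  shows "ctr (contr x UNIV) \<in> O_open n le c" "comp_map x = rho n le (ctr (contr x UNIV))"
proof -
  have "contr x UNIV i < contr x UNIV j" if "cov i j" for i j
    using edge_contr[OF x that, of UNIV] int by auto
  then have "contr x UNIV i < contr x UNIV j" if "strict le i j" for i j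
    using cov_mono_chain that by blast
  moreover have "ctr (contr x UNIV) \<in> seq_space n c" using ctr_seq_space quasi_periodic_contr truncated_quasi_periodic x by blast
  ultimately show "ctr (contr x UNIV) \<in> O_open n le c" by (simp add: O_open_def ctr_def)
  show "comp_map x = rho n le (ctr (contr x UNIV))"
  proof (rule ext)
    fix \<tau>
    consider "\<tau> = UNIV" | "pp \<tau>" | "\<not> nontriv_pipe n le \<tau>" using nontriv_iff by blast
    then show "comp_map x \<tau> = rho n le (ctr (contr x UNIV)) \<tau>"
    proof cases
      case 1
      then show ?thesis by (simp add: comp_map_UNIV rho_def coord_def nontriv_UNIV)
    next
      case 2
      define P where "P = (\<Prod>\<sigma>\<in>between x \<tau> UNIV. shrink x \<sigma>)"
      have "0 < shrink x \<sigma>" if "\<sigma> \<in> between x \<tau> UNIV" for \<sigma>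
      proof -
        have "\<sigma> \<in> near x" using that by (simp add: between_def)
        then have "shrink x \<sigma> \<noteq> 0" using tight_shrink int by blast
        then show ?thesis using shrink_nonneg[OF x near_pp[OF \<open>\<sigma> \<in> near x\<close>]] by simp
      qed
      then have P: "0 < P" unfolding P_def by (rule prod_pos)
      define b where "b = (\<Sum>\<sigma>\<in>between x \<tau> UNIV. wt (shrink x) (between x \<tau> UNIV) \<sigma> * x (base \<sigma>))"
      have "ctr (contr x UNIV) k = P * contr x \<tau> k + (b - (\<Sum>k\<in>{1..int n}. contr x UNIV k) / real n)"
        if "k \<in> \<tau>" for k
        using contr_scale[OF x, of \<tau> UNIV k] that by (simp add: ctr_def P_def b_def)
      then have "coord le (ctr (contr x UNIV)) \<tau> = coord le (contr x \<tau>) \<tau>"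
        by (rule coord_affine[OF _ P 2])
      then show ?thesis using 2 by (simp add: comp_map_pp rho_def pp_nontriv)
    next
      case 3
      then show ?thesis by (simp add: comp_map_def rho_def)
    qed
  qed
qed

text \<open>A tight pipe is collapsed in the coordinate at \<open>UNIV\<close>, whereas
  \<open>y\<close> is strictly monotone.\<close>

lemma comp_map_rho_tight:
  assumes x: "truncated x" and y: "y \<in> O_open n le c" and eq: "comp_map x = rho n le y"
  shows "tight x = {}"
proof (rule ccontr)
  assume "tight x \<noteq> {}"
  then obtain \<sigma> where \<sigma>: "\<sigma> \<in> tight x" by blast
  then have pp: "pp \<sigma>" by (rule tight_pp)
  have "0 < alpha le \<sigma> (contr x \<sigma>)" by (rule alpha_contr_pos[OF x pp])
  then have "edges \<sigma> \<noteq> {}" by (auto simp: alpha_edges[OF pp])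
  then obtain i j where ij: "i \<in> \<sigma>" "j \<in> \<sigma>" "cov i j" by (auto simp: edges_def)
  have "\<not> UNIV \<subseteq> \<sigma>" using pp_not_UNIV[OF pp] by blast
  then have "contr x UNIV i = contr x UNIV j" by (rule contr_const_tight[OF x \<sigma> _ ij(1,2)])
  then have "comp_map x UNIV i = comp_map x UNIV j" by (simp add: comp_map_UNIV ctr_def)
  then have "y i = y j" by (simp add: eq rho_def nontriv_UNIV coord_def)
  moreover have "y i < y j" using y ij(3) by (simp add: O_open_def cov_iff)
  ultimately show False by simp
qed

section \<open>The scales of two points with the same image\<close>

definition ratio :: "(int \<Rightarrow> real) \<Rightarrow> (int \<Rightarrow> real) \<Rightarrow> int set \<Rightarrow> real" where
  "ratio x z \<tau> = (if \<tau> = UNIV then 1 else alpha le \<tau> (contr x \<tau>) / alpha le \<tau> (contr z \<tau>))"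

lemma ratio_swap: "ratio z x \<tau> = 1 / ratio x z \<tau>"
  by (simp add: ratio_def)

lemma ratio_pos: "truncated x \<Longrightarrow> truncated z \<Longrightarrow> \<tau> = UNIV \<or> pp \<tau> \<Longrightarrow> 0 < ratio x z \<tau>"
  by (auto simp: ratio_def alpha_contr_pos)

text \<open>The normalised coordinates agree, so differences before normalising are proportional; at
  \<open>UNIV\<close> nothing is rescaled and the factor is 1.\<close>

lemma ratio_diff:
  assumes x: "truncated x" and z: "truncated z" and eq: "comp_map x = comp_map z" and \<tau>: "\<tau> = UNIV \<or> pp \<tau>"
    and ij: "i \<in> \<tau>" "j \<in> \<tau>"
  shows "contr x \<tau> i - contr x \<tau> j = ratio x z \<tau> * (contr z \<tau> i - contr z \<tau> j)"
proof (cases "\<tau> = UNIV")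
  case True
  then show ?thesis using comp_map_diff_UNIV[of x i j] comp_map_diff_UNIV[of z i j] eq by (simp add: ratio_def)
next
  case False
  then have pp: "pp \<tau>" using \<tau> by blast
  have "(contr x \<tau> i - contr x \<tau> j) / alpha le \<tau> (contr x \<tau>) = (contr z \<tau> i - contr z \<tau> j) / alpha le \<tau> (contr z \<tau>)"
    using comp_map_diff_pp[OF pp ij, of x] comp_map_diff_pp[OF pp ij, of z] eq by simp
  then show ?thesis
    using False alpha_contr_pos[OF x pp] alpha_contr_pos[OF z pp] by (simp add: ratio_def field_simps)
qed

text \<open>When \<open>\<rho>\<close> is the next pipe above \<open>\<tau>\<close> in the union of
  both near families, passing from \<open>\<tau>\<close> to \<open>\<rho>\<close> multiplies
  differences within \<open>\<tau>\<close> by the single factor \<open>shrink\<close>, for either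
  point.\<close>

lemma ratio_step:
  assumes x: "truncated x" and z: "truncated z" and eq: "comp_map x = comp_map z" and \<tau>: "pp \<tau>"
    and \<rho>: "\<rho> = UNIV \<or> pp \<rho>" "\<tau> \<subset> \<rho>" and above: "\<And>\<pi>. \<pi> \<in> near x \<union> near z \<Longrightarrow> \<tau> \<subset> \<pi> \<Longrightarrow> \<rho> \<subseteq> \<pi>"
  shows "shrink x \<tau> * ratio x z \<tau> = ratio x z \<rho> * shrink z \<tau>"
proof -
  have scale: "contr y \<rho> i - contr y \<rho> j = shrink y \<tau> * (contr y \<tau> i - contr y \<tau> j)"
    if y: "truncated y" and Ny: "near y \<subseteq> near x \<union> near z" and ij: "i \<in> \<tau>" "j \<in> \<tau>" for y i j
  proof -
    have "between y \<tau> \<rho> = (if \<tau> \<in> near y then {\<tau>} else {})"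
      using above Ny \<rho>(2) by (auto simp: between_def)
    then have "(\<Prod>\<sigma>\<in>between y \<tau> \<rho>. shrink y \<sigma>) = shrink y \<tau>" using shrink_eq_1[OF \<tau>, of y] by auto
    then show ?thesis
      using contr_scale[OF y disjI1[OF psubset_imp_subset[OF \<rho>(2)]] ij(1)]
        contr_scale[OF y disjI1[OF psubset_imp_subset[OF \<rho>(2)]] ij(2)]
      by (simp add: right_diff_distrib)
  qed
  obtain i j where ij: "i \<in> \<tau>" "j \<in> \<tau>" "contr z \<tau> i - contr z \<tau> j \<noteq> 0"
  proof -
    have "\<exists>i j. i \<in> \<tau> \<and> j \<in> \<tau> \<and> contr z \<tau> i - contr z \<tau> j \<noteq> 0"
    proof (rule ccontr)
      assume "\<not> ?thesis"
      then have "(\<Sum>(i, j)\<in>edges \<tau>. contr z \<tau> j - contr z \<tau> i) = 0"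
        by (intro sum.neutral) (auto simp: edges_def)
      then show False using alpha_contr_pos[OF z \<tau>] by (simp add: alpha_edges[OF \<tau>])
    qed
    then show ?thesis using that by blast
  qed
  have "shrink x \<tau> * (ratio x z \<tau> * (contr z \<tau> i - contr z \<tau> j)) = shrink x \<tau> * (contr x \<tau> i - contr x \<tau> j)"
    using ratio_diff[OF x z eq _ ij(1,2)] \<tau> by simp
  also have "\<dots> = contr x \<rho> i - contr x \<rho> j" using scale[OF x _ ij(1,2)] by simp
  also have "\<dots> = ratio x z \<rho> * (contr z \<rho> i - contr z \<rho> j)"
    using ratio_diff[OF x z eq \<rho>(1)] ij \<rho>(2) by blast
  also have "\<dots> = ratio x z \<rho> * (shrink z \<tau> * (contr z \<tau> i - contr z \<tau> j))" using scale[OF z _ ij(1,2)] by simp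
  finally have "(shrink x \<tau> * ratio x z \<tau>) * (contr z \<tau> i - contr z \<tau> j) = (ratio x z \<rho> * shrink z \<tau>) * (contr z \<tau> i - contr z \<tau> j)"
    by (simp add: mult.assoc)
  then show ?thesis using ij(3) by simp
qed

lemma ratio_step_le:
  assumes x: "truncated x" and z: "truncated z" and eq: "comp_map x = comp_map z" and \<tau>: "pp \<tau>"
    and \<rho>: "\<rho> = UNIV \<or> pp \<rho>" "\<tau> \<subset> \<rho>" and above: "\<And>\<pi>. \<pi> \<in> near x \<union> near z \<Longrightarrow> \<tau> \<subset> \<pi> \<Longrightarrow> \<rho> \<subseteq> \<pi>"
    and less: "alpha le \<tau> z < alpha le \<tau> x"
  shows "ratio x z \<tau> \<le> ratio x z \<rho>"
proof -
  \<comment> \<open>Being larger than at \<open>z\<close>, the value at \<open>x\<close> lies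
    strictly above its bound, which allows division by \<open>shrink x \<tau>\<close>.\<close>
  have "alpha le \<tau> x \<noteq> eps (card \<tau>)" using truncated_alpha[OF z \<tau>] less by simp
  then have "shrink x \<tau> \<noteq> 0" by (simp add: shrink_eq_0)
  then have pos: "0 < shrink x \<tau>" using shrink_nonneg[OF x \<tau>] by simp
  have "shrink x \<tau> * ratio x z \<tau> = ratio x z \<rho> * shrink z \<tau>" by (rule ratio_step) fact+
  also have "\<dots> \<le> ratio x z \<rho> * shrink x \<tau>"
    using shrink_mono[of \<tau> z x] less ratio_pos[OF x z \<rho>(1)] by (intro mult_left_mono) auto
  finally have "shrink x \<tau> * ratio x z \<tau> \<le> shrink x \<tau> * ratio x z \<rho>" by (simp add: mult.commute)
  then show ?thesis using pos by simp
qed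

lemma parent:
  assumes fin: "finite E" and nest: "\<And>\<pi> \<pi>'. \<pi> \<in> E \<Longrightarrow> \<pi>' \<in> E \<Longrightarrow> \<pi> \<subseteq> \<pi>' \<or> \<pi>' \<subseteq> \<pi>"
  obtains \<rho> where "\<rho> = UNIV \<or> \<rho> \<in> E" "\<And>\<pi>. \<pi> \<in> E \<Longrightarrow> \<rho> \<subseteq> \<pi>" | "E = {}"
proof (cases "E = {}")
  case False
  then obtain \<rho> where "\<rho> \<in> E" "\<And>\<pi>. \<pi> \<in> E \<Longrightarrow> \<pi> \<subseteq> \<rho> \<Longrightarrow> \<pi> = \<rho>"
    using finite_has_minimal[OF fin] by metis
  then show ?thesis using that(1)[of \<rho>] nest by blast
qed (use that in blast)

text \<open>The ratio compares \<open>alpha\<close> after contraction, which differs from the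
  original by at most a tenth; \<open>11 / 9\<close> is the quotient of \<open>11 / 10\<close> and
  \<open>9 / 10\<close>, and its square is below 2.\<close>

lemma alpha_ratio:
  assumes x: "truncated x" and z: "truncated z" and \<tau>: "pp \<tau>"
  shows "ratio x z \<tau> \<le> 11 / 9 \<Longrightarrow> alpha le \<tau> x \<le> 2 * alpha le \<tau> z"
    and "11 / 9 < ratio x z \<tau> \<Longrightarrow> alpha le \<tau> z < alpha le \<tau> x"
proof -
  have pos: "0 < alpha le \<tau> (contr z \<tau>)" "0 < alpha le \<tau> z"
    using alpha_contr_pos[OF z \<tau>] truncated_alpha[OF z \<tau>] eps_pos[of "card \<tau>"] by linarith+
  have k: "alpha le \<tau> (contr x \<tau>) = ratio x z \<tau> * alpha le \<tau> (contr z \<tau>)"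
    using pos(1) pp_not_UNIV[OF \<tau>] by (simp add: ratio_def)
  show "alpha le \<tau> x \<le> 2 * alpha le \<tau> z" if "ratio x z \<tau> \<le> 11 / 9"
  proof -
    have "alpha le \<tau> (contr x \<tau>) \<le> 11 / 9 * alpha le \<tau> (contr z \<tau>)"
      unfolding k using that pos by (intro mult_right_mono) auto
    then show ?thesis using alpha_contr[OF x \<tau>] alpha_contr[OF z \<tau>] pos(2) by linarith
  qed
  show "alpha le \<tau> z < alpha le \<tau> x" if "11 / 9 < ratio x z \<tau>"
  proof -
    have "11 / 9 * alpha le \<tau> (contr z \<tau>) < alpha le \<tau> (contr x \<tau>)"
      unfolding k using that pos by (intro mult_strict_right_mono) auto
    then show ?thesis using alpha_contr[OF x \<tau>] alpha_contr[OF z \<tau>] by linarith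
  qed
qed

text \<open>A factor 2 between the two points, applied to the near threshold \<open>2 * eps\<close>,
  is the origin of \<open>4 * eps\<close> in \<open>small\<close>.\<close>

lemma near_small_both:
  assumes x: "truncated x" and z: "truncated z" and \<pi>: "\<pi> \<in> near x \<union> near z"
    and k: "ratio x z \<pi> \<le> 11 / 9" "ratio z x \<pi> \<le> 11 / 9"
  shows "small x \<pi>" "small z \<pi>"
proof -
  have pp: "pp \<pi>" using \<pi> near_pp by blast
  have "alpha le \<pi> x \<le> 2 * alpha le \<pi> z" "alpha le \<pi> z \<le> 2 * alpha le \<pi> x"
    using alpha_ratio(1)[OF x z pp k(1)] alpha_ratio(1)[OF z x pp k(2)] by auto
  moreover have "alpha le \<pi> x < 2 * eps (card \<pi>) \<or> alpha le \<pi> z < 2 * eps (card \<pi>)"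
    using \<pi> by (auto simp: near_def)
  ultimately have "alpha le \<pi> x \<le> 4 * eps (card \<pi>) \<and> alpha le \<pi> z \<le> 4 * eps (card \<pi>)"
    using eps_pos[of "card \<pi>"] by linarith
  then show "small x \<pi>" "small z \<pi>" using pp by (auto simp: small_def)
qed

text \<open>If the ratio at \<open>\<tau>\<close> were too large then \<open>\<tau>\<close> would be bigger in \<open>x\<close> than in \<open>z\<close>, hence contracted
  less, and the ratio at the next larger pipe would be at least as large.\<close>

lemma ratio_bound:
  assumes x: "truncated x" and z: "truncated z" and eq: "comp_map x = comp_map z" and \<tau>: "pp \<tau>"
  shows "ratio x z \<tau> \<le> 11 / 9 \<and> ratio z x \<tau> \<le> 11 / 9"
  using \<tau>
proof (induction "n - card \<tau>" arbitrary: \<tau> rule: less_induct)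
  case less
  obtain i where i: "i \<in> \<tau>" using pp_nonempty[OF less.prems] by blast
  define E where "E = {\<pi> \<in> near x \<union> near z. \<tau> \<subset> \<pi>}"
  have Epp: "pp \<pi>" if "\<pi> \<in> E" for \<pi> using that near_pp unfolding E_def by blast
  have IH: "ratio x z \<pi> \<le> 11 / 9" "ratio z x \<pi> \<le> 11 / 9" if "pp \<pi>" "\<tau> \<subset> \<pi>" for \<pi>
  proof -
    have "card \<tau> < card \<pi>" "card \<pi> \<le> n"
      using that pp_finite pp_card psubset_card_mono by auto
    then show "ratio x z \<pi> \<le> 11 / 9" "ratio z x \<pi> \<le> 11 / 9" using less.hyps[of \<pi>] that by auto
  qed
  \<comment> \<open>The induction hypothesis makes all near pipes of either point that properly
    contain \<open>\<tau>\<close> small for \<open>x\<close>. This is what nests the two near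
    families with each other and gives \<open>\<tau>\<close> a parent.\<close>
  have sm: "small x \<pi>" if "\<pi> \<in> E" for \<pi>
    using near_small_both(1)[OF x z _ IH[OF Epp[OF that]]] that by (auto simp: E_def)
  have nest: "\<pi> \<subseteq> \<pi>' \<or> \<pi>' \<subseteq> \<pi>" if "\<pi> \<in> E" "\<pi>' \<in> E" for \<pi> \<pi>'
    using small_nested[OF x sm[OF that(1)] sm[OF that(2)], of i] that i unfolding E_def by blast
  have fin: "finite E"
    by (rule finite_subset[OF _ finite_pipes_at[of i]]) (use Epp i in \<open>auto simp: E_def\<close>)
  obtain \<rho> where \<rho>: "\<rho> = UNIV \<or> \<rho> \<in> E" "\<And>\<pi>. \<pi> \<in> E \<Longrightarrow> \<rho> \<subseteq> \<pi>"
    using parent[OF fin nest] by (metis empty_iff)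
  have \<rho>': "\<rho> = UNIV \<or> pp \<rho>" using \<rho>(1) Epp by blast
  have sub: "\<tau> \<subset> \<rho>" using \<rho>(1) pp_not_UNIV[OF less.prems] unfolding E_def by blast
  have above: "\<rho> \<subseteq> \<pi>" if "\<pi> \<in> near x \<union> near z" "\<tau> \<subset> \<pi>" for \<pi> using that \<rho>(2) by (auto simp: E_def)
  have above': "\<rho> \<subseteq> \<pi>" if "\<pi> \<in> near z \<union> near x" "\<tau> \<subset> \<pi>" for \<pi> using that above by blast
  have k\<rho>: "ratio x z \<rho> \<le> 11 / 9" "ratio z x \<rho> \<le> 11 / 9"
  proof (atomize (full), cases "\<rho> = UNIV")
    case False
    then show "ratio x z \<rho> \<le> 11 / 9 \<and> ratio z x \<rho> \<le> 11 / 9" using \<rho>' IH[of \<rho>] sub by blast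
  qed (simp add: ratio_def)
  have "ratio x z \<tau> \<le> 11 / 9"
  proof (rule ccontr)
    assume "\<not> ?thesis"
    moreover from this have "ratio x z \<tau> \<le> ratio x z \<rho>"
      using ratio_step_le[OF x z eq less.prems \<rho>' sub above] alpha_ratio(2)[OF x z less.prems] by simp
    ultimately show False using k\<rho> by simp
  qed
  moreover have "ratio z x \<tau> \<le> 11 / 9"
  proof (rule ccontr)
    assume "\<not> ?thesis"
    moreover from this have "ratio z x \<tau> \<le> ratio z x \<rho>"
      using ratio_step_le[OF z x eq[symmetric] less.prems \<rho>' sub above'] alpha_ratio(2)[OF z x less.prems] by simp
    ultimately show False using k\<rho> by simp
  qed
  ultimately show ?case by simp
qed

end

section \<open>Injectivity\<close>

context affine_setting
begin

lemma ratio_sh: "quasi_periodic x \<Longrightarrow> quasi_periodic z \<Longrightarrow> pp \<tau> \<Longrightarrow> ratio x z (sh d \<tau>) = ratio x z \<tau>"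
  using pp_not_UNIV[of \<tau>] pp_not_UNIV[of "sh d \<tau>"] by (simp add: ratio_def alpha_contr_sh)

text \<open>Ratios are invariant under translation, and every pipe has a translate meeting
  \<open>{0..<n}\<close>.\<close>

lemma finite_ratio_values:
  assumes "quasi_periodic x" "quasi_periodic z"
  shows "finite (ratio x z ` {\<tau>. pp \<tau>})"
proof -
  let ?R = "\<Union>r\<in>{0..<int n}. {\<tau>. pp \<tau> \<and> r \<in> \<tau>}"
  have "ratio x z ` {\<tau>. pp \<tau>} \<subseteq> ratio x z ` ?R"
  proof
    fix v assume "v \<in> ratio x z ` {\<tau>. pp \<tau>}"
    then obtain \<tau> where \<tau>: "pp \<tau>" "v = ratio x z \<tau>" by blast
    obtain i where i: "i \<in> \<tau>" using pp_nonempty[OF \<tau>(1)] by blast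
    let ?d = "- (i div int n)"
    have "i mod int n = i + ?d * int n" by (simp add: minus_div_mult_eq_mod[symmetric])
    then have "i mod int n \<in> sh ?d \<tau>" using i by (simp only: mem_sh')
    then have "sh ?d \<tau> \<in> ?R" using \<tau>(1) n_pos by auto
    moreover have "v = ratio x z (sh ?d \<tau>)" using ratio_sh[OF assms \<tau>(1), of ?d] \<tau>(2) by simp
    ultimately show "v \<in> ratio x z ` ?R" by blast
  qed
  moreover have "finite ?R" using finite_pipes_at by blast
  ultimately show ?thesis using finite_subset by blast
qed

lemma contr_at_base:
  assumes "\<And>\<pi>. \<pi> \<in> nset x \<tau> p \<Longrightarrow> base \<pi> = p"
  shows "contr x \<tau> p = x p"
  unfolding contr_nset using assms by simp

lemma base_subset:
  assumes "pp \<sigma>" "\<pi> \<subseteq> \<sigma>" "base \<sigma> \<in> \<pi>"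
  shows "base \<pi> = base \<sigma>"
proof -
  have fin: "finite \<pi>" using assms pp_finite finite_subset by blast
  have "base \<pi> \<le> base \<sigma>" unfolding base_def[of \<pi>] using fin assms(3) by simp
  moreover have "base \<sigma> \<le> base \<pi>"
    unfolding base_def using assms pp_finite[OF assms(1)] by (intro Min_antimono) auto
  ultimately show ?thesis by simp
qed

definition spread_bound :: "nat \<Rightarrow> real" where
  "spread_bound m = 4 * D * eps m"

context
  fixes x z
  assumes x: "truncated x" and z: "truncated z" and eq: "comp_map x = comp_map z"
begin

definition NN :: "int set set" where "NN = near x \<union> near z"

lemma NN_pp: "\<pi> \<in> NN \<Longrightarrow> pp \<pi>"
  using near_pp by (auto simp: NN_def)

lemma NN_small: "\<pi> \<in> NN \<Longrightarrow> small x \<pi>" "\<pi> \<in> NN \<Longrightarrow> small z \<pi>"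
proof -
  assume \<pi>: "\<pi> \<in> NN"
  have "ratio x z \<pi> \<le> 11 / 9" "ratio z x \<pi> \<le> 11 / 9" using ratio_bound[OF x z eq NN_pp[OF \<pi>]] by auto
  then show "small x \<pi>" "small z \<pi>" using near_small_both[OF x z] \<pi> unfolding NN_def by blast+
qed

lemma NN_nested: "\<pi> \<in> NN \<Longrightarrow> \<pi>' \<in> NN \<Longrightarrow> i \<in> \<pi> \<Longrightarrow> i \<in> \<pi>' \<Longrightarrow> \<pi> \<subseteq> \<pi>' \<or> \<pi>' \<subseteq> \<pi>"
  using small_nested[OF x NN_small(1) NN_small(1)] by blast

lemma finite_NN_at: "finite {\<pi> \<in> NN. i \<in> \<pi> \<and> Q \<pi>}"
  by (rule finite_subset[OF _ finite_pipes_at[of i]]) (use NN_pp in blast)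

lemma NN_parent:
  assumes \<tau>: "\<tau> \<in> NN"
  obtains \<rho> where "\<rho> = UNIV \<or> \<rho> \<in> NN" "\<tau> \<subset> \<rho>" "\<And>\<pi>. \<pi> \<in> NN \<Longrightarrow> \<tau> \<subset> \<pi> \<Longrightarrow> \<rho> \<subseteq> \<pi>"
proof -
  obtain i where i: "i \<in> \<tau>" using pp_nonempty[OF NN_pp[OF \<tau>]] by blast
  define E where "E = {\<pi> \<in> NN. i \<in> \<pi> \<and> \<tau> \<subset> \<pi>}"
  have E: "\<pi> \<in> E \<longleftrightarrow> \<pi> \<in> NN \<and> \<tau> \<subset> \<pi>" for \<pi> using i by (auto simp: E_def)
  have fin: "finite E" unfolding E_def by (rule finite_NN_at)
  have nest: "\<pi> \<subseteq> \<pi>' \<or> \<pi>' \<subseteq> \<pi>" if "\<pi> \<in> E" "\<pi>' \<in> E" for \<pi> \<pi>'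
    using that NN_nested[of \<pi> \<pi>' i] by (simp add: E_def)
  obtain \<rho> where \<rho>: "\<rho> = UNIV \<or> \<rho> \<in> E" "\<And>\<pi>. \<pi> \<in> E \<Longrightarrow> \<rho> \<subseteq> \<pi>"
    using parent[OF fin nest] by (metis empty_iff)
  have "\<tau> \<subset> \<rho>" using \<rho>(1) pp_not_UNIV[OF NN_pp[OF \<tau>]] E by blast
  then show ?thesis using that[of \<rho>] \<rho> E by blast
qed

lemma ratio_diff_fixed:
  assumes "\<sigma> = UNIV \<or> \<sigma> \<in> NN" "p \<in> \<sigma>" "q \<in> \<sigma>"
    "contr x \<sigma> p = x p" "contr z \<sigma> p = z p" "contr x \<sigma> q = x q" "contr z \<sigma> q = z q"
  shows "x p - x q = ratio x z \<sigma> * (z p - z q)"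
  using ratio_diff[OF x z eq _ assms(2,3)] assms(1,4-7) NN_pp by auto

text \<open>One step of descent from \<open>\<sigma>\<close> towards \<open>i\<close>. Either no
  contraction below \<open>\<sigma>\<close> touches \<open>i\<close>, or a maximal pipe
  \<open>C\<close> around \<open>i\<close> below \<open>\<sigma>\<close> has an unmoved base point:
  every pipe of \<open>NN\<close> through it below \<open>\<sigma>\<close> lies in \<open>C\<close>
  and inherits the base. Between unmoved points the differences are those of \<open>x\<close> and
  \<open>z\<close> themselves.\<close>

lemma child:
  assumes \<sigma>: "\<sigma> = UNIV \<or> \<sigma> \<in> NN" and i: "i \<in> \<sigma>"
  obtains p where "p = i" "contr x \<sigma> p = x p" "contr z \<sigma> p = z p" "p \<in> \<sigma>"
    | p C where "C \<in> NN" "C \<subset> \<sigma>" "i \<in> C" "p = base C" "contr x \<sigma> p = x p" "contr z \<sigma> p = z p" "p \<in> \<sigma>"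
proof -
  define E where "E = {\<pi> \<in> NN. i \<in> \<pi> \<and> \<pi> \<subset> \<sigma>}"
  have inside: "\<pi> \<subset> \<sigma>" if "\<pi> \<in> NN" "p \<in> \<pi>" "p \<in> \<sigma>" "\<not> \<sigma> \<subseteq> \<pi>" for \<pi> p
    using that \<sigma> NN_nested[of \<pi> \<sigma> p] by blast
  show ?thesis
  proof (cases "E = {}")
    case True
    have "nset x \<sigma> i = {}" "nset z \<sigma> i = {}"
      using True inside[of _ i] i unfolding nset_def E_def NN_def by blast+
    then show ?thesis using that(1)[of i] i by (simp add: contr_nset)
  next
    case False
    have "finite E" unfolding E_def by (rule finite_NN_at)
    then obtain C where C: "C \<in> E" "\<And>\<pi>. \<pi> \<in> E \<Longrightarrow> C \<subseteq> \<pi> \<Longrightarrow> \<pi> = C"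
      using finite_has_maximal[OF _ False] by metis
    have CN: "C \<in> NN" "i \<in> C" "C \<subset> \<sigma>" using C(1) by (auto simp: E_def)
    have b: "base C \<in> C" by (rule base_in[OF NN_pp[OF CN(1)]])
    have bases: "base \<pi> = base C" if \<pi>: "\<pi> \<in> NN" "base C \<in> \<pi>" "\<not> \<sigma> \<subseteq> \<pi>" for \<pi>
    proof -
      have "\<pi> \<subset> \<sigma>" using inside[OF \<pi>(1,2) _ \<pi>(3)] b CN(3) by blast
      have "\<pi> \<subseteq> C"
      proof (rule ccontr)
        assume "\<not> \<pi> \<subseteq> C"
        then have "C \<subseteq> \<pi>" using NN_nested[OF \<pi>(1) CN(1) \<pi>(2) b] by blast
        moreover from this have "\<pi> \<in> E" using \<pi>(1) \<open>\<pi> \<subset> \<sigma>\<close> CN(2) unfolding E_def by blast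
        ultimately show False using C(2) \<open>\<not> \<pi> \<subseteq> C\<close> by blast
      qed
      then show ?thesis using base_subset[OF NN_pp[OF CN(1)]] \<pi>(2) by blast
    qed
    have "contr x \<sigma> (base C) = x (base C)" "contr z \<sigma> (base C) = z (base C)"
      by (rule contr_at_base, rule bases; simp add: nset_def NN_def)+
    then show ?thesis using that(2)[of C "base C"] CN b by blast
  qed
qed

lemma spread_bound_z:
  assumes "C \<in> NN" "i \<in> C" "j \<in> C"
  shows "\<bar>z i - z j\<bar> \<le> spread_bound (card C)"
  using small_spread[OF z NN_small(2)[OF assms(1)] assms(2,3)]
    small_spread[OF z NN_small(2)[OF assms(1)] assms(3,2)] by (simp add: spread_bound_def abs_le_iff)

context
  fixes q assumes q: "\<And>\<sigma>. \<sigma> \<in> NN \<Longrightarrow> ratio x z \<sigma> \<le> q" "\<And>\<sigma>. \<sigma> \<in> NN \<Longrightarrow> ratio z x \<sigma> \<le> q" and q1: "1 \<le> q"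
begin

text \<open>The bound on the inverse ratio controls the deviation below 1, because
  \<open>2 - k \<le> 1 / k\<close> for positive \<open>k\<close>.\<close>

lemma ratio_dev: "\<sigma> \<in> NN \<Longrightarrow> \<bar>ratio x z \<sigma> - 1\<bar> \<le> q - 1"
proof -
  assume \<sigma>: "\<sigma> \<in> NN"
  have k: "0 < ratio x z \<sigma>" using ratio_pos[OF x z] NN_pp[OF \<sigma>] by blast
  have "1 / ratio x z \<sigma> \<le> q" using q(2)[OF \<sigma>] ratio_swap[of z x \<sigma>] by simp
  then have "1 \<le> q * ratio x z \<sigma>" using k by (simp add: field_simps)
  moreover have "(2 - ratio x z \<sigma>) * ratio x z \<sigma> \<le> 1"
    using zero_le_power2[of "ratio x z \<sigma> - 1"] by (simp add: power2_eq_square algebra_simps)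
  ultimately have "(2 - ratio x z \<sigma>) * ratio x z \<sigma> \<le> q * ratio x z \<sigma>" by linarith
  then show ?thesis using k q(1)[OF \<sigma>] by (simp add: abs_le_iff)
qed

text \<open>Descending from \<open>\<sigma>\<close> to \<open>i\<close> through unmoved base points
  splits the difference into at most \<open>card \<sigma>\<close> pieces, each being
  \<open>ratio x z - 1\<close> at one pipe times a difference of \<open>z\<close> inside it. The
  factor \<open>q - 1\<close> is essential: the error vanishes together with the deviation of the
  ratios.\<close>

lemma telescope:
  "\<sigma> \<in> NN \<Longrightarrow> i \<in> \<sigma> \<Longrightarrow>
    \<bar>(x i - x (base \<sigma>)) - (z i - z (base \<sigma>))\<bar> \<le> (q - 1) * (real (card \<sigma>) * spread_bound (card \<sigma>))"
proof (induction "card \<sigma>" arbitrary: \<sigma> rule: less_induct)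
  case less
  have pp: "pp \<sigma>" using NN_pp less.prems by blast
  have b: "base \<sigma> \<in> \<sigma>" by (rule base_in[OF pp])
  have bases: "base \<pi> = base \<sigma>" if "\<pi> \<in> NN" "base \<sigma> \<in> \<pi>" "\<not> \<sigma> \<subseteq> \<pi>" for \<pi>
    using that NN_nested[OF that(1) less.prems(1) that(2) b] base_subset[OF pp] by blast
  have fix_b: "contr x \<sigma> (base \<sigma>) = x (base \<sigma>)" "contr z \<sigma> (base \<sigma>) = z (base \<sigma>)"
    by (rule contr_at_base, rule bases; simp add: nset_def NN_def)+
  have first: "\<bar>(x p - x (base \<sigma>)) - (z p - z (base \<sigma>))\<bar> \<le> (q - 1) * spread_bound (card \<sigma>)"
    if p: "contr x \<sigma> p = x p" "contr z \<sigma> p = z p" "p \<in> \<sigma>" for p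
  proof -
    have "x p - x (base \<sigma>) = ratio x z \<sigma> * (z p - z (base \<sigma>))"
      by (rule ratio_diff_fixed) (use less.prems p b fix_b in auto)
    then have "(x p - x (base \<sigma>)) - (z p - z (base \<sigma>)) = (ratio x z \<sigma> - 1) * (z p - z (base \<sigma>))"
      by (simp add: algebra_simps)
    also have "\<bar>\<dots>\<bar> \<le> (q - 1) * spread_bound (card \<sigma>)"
      unfolding abs_mult using ratio_dev[OF less.prems(1)] spread_bound_z[OF less.prems(1) p(3) b] q1
      by (intro mult_mono) auto
    finally show ?thesis .
  qed
  have drop0: "0 \<le> spread_bound m" for m using eps_pos[of m] by (simp add: spread_bound_def)
  have card1: "1 \<le> real (card \<sigma>)" using pp_finite[OF pp] pp_nonempty[OF pp]
    by (metis One_nat_def Suc_leI card_gt_0_iff of_nat_1 of_nat_mono)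
  show ?case
    using disjI2[OF less.prems(1)] less.prems(2)
  proof (cases rule: child)
    case (1 p)
    have "(q - 1) * (1 * spread_bound (card \<sigma>)) \<le> (q - 1) * (real (card \<sigma>) * spread_bound (card \<sigma>))"
      using card1 drop0 q1 by (intro mult_left_mono mult_right_mono) auto
    then show ?thesis using first[of i] 1 by simp
  next
    case (2 p C)
    have less_card: "card C < card \<sigma>" using 2 pp_finite[OF pp] by (simp add: psubset_card_mono)
    have "\<bar>(x i - x p) - (z i - z p)\<bar> \<le> (q - 1) * (real (card C) * spread_bound (card C))"
      using less.hyps[OF less_card 2(1,3)] 2(4) by simp
    also have "\<dots> \<le> (q - 1) * ((real (card \<sigma>) - 1) * spread_bound (card \<sigma>))"
    proof (intro mult_left_mono mult_mono)
      show "spread_bound (card C) \<le> spread_bound (card \<sigma>)"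
        unfolding spread_bound_def using less_card by (intro mult_left_mono eps_mono) auto
    qed (use less_card card1 drop0 q1 in auto)
    finally have "\<bar>(x i - x p) - (z i - z p)\<bar> \<le> (q - 1) * ((real (card \<sigma>) - 1) * spread_bound (card \<sigma>))" .
    moreover have "(q - 1) * ((real (card \<sigma>) - 1) * spread_bound (card \<sigma>)) + (q - 1) * spread_bound (card \<sigma>) =
        (q - 1) * (real (card \<sigma>) * spread_bound (card \<sigma>))" by (simp add: algebra_simps)
    ultimately show ?thesis using first[OF 2(5,6,7)] by linarith
  qed
qed

text \<open>Trades \<open>i\<close> for a point unmoved by both contractions, to which
  \<open>ratio_diff_fixed\<close> applies; the cost is governed by the widths of proper
  subpipes.\<close>

lemma near_fixed:
  assumes \<sigma>: "\<sigma> = UNIV \<or> \<sigma> \<in> NN" and i: "i \<in> \<sigma>"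
    and B: "\<And>C. C \<in> NN \<Longrightarrow> C \<subset> \<sigma> \<Longrightarrow> spread_bound (card C) \<le> B" "0 \<le> B"
  obtains p where "p \<in> \<sigma>" "contr x \<sigma> p = x p" "contr z \<sigma> p = z p"
    "\<bar>z i - z p\<bar> \<le> B" "\<bar>(x i - x p) - (z i - z p)\<bar> \<le> (q - 1) * (real n * B)"
  using \<sigma> i
proof (cases rule: child)
  case (1 p)
  then show ?thesis using that[of p] B(2) q1 by simp
next
  case (2 p C)
  have dB: "spread_bound (card C) \<le> B" by (rule B(1)) fact+
  have drop0: "0 \<le> spread_bound (card C)" using eps_pos[of "card C"] by (simp add: spread_bound_def)
  have pC: "p \<in> C" using base_in[OF NN_pp[OF 2(1)]] 2(4) by simp
  have "\<bar>(x i - x p) - (z i - z p)\<bar> \<le> (q - 1) * (real (card C) * spread_bound (card C))"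
    using telescope[OF 2(1,3)] 2(4) by simp
  also have "\<dots> \<le> (q - 1) * (real n * B)"
    using pp_card[OF NN_pp[OF 2(1)]] dB drop0 q1 by (intro mult_left_mono mult_mono) auto
  finally show ?thesis using that[of p] 2 spread_bound_z[OF 2(1,3) pC] dB by simp
qed

text \<open>Along the edges of \<open>\<tau>\<close> the differences of \<open>x\<close> are those
  of \<open>z\<close> times \<open>q\<close>, up to errors from proper subpipes. These errors are at
  most \<open>(q - 1) * G\<close> with \<open>D * G < eps (card \<tau>)\<close>, so the gain
  \<open>(q - 1) * alpha le \<tau> z\<close> outweighs them however close \<open>q\<close> is to
  1.\<close>

lemma ratio_max_alpha:
  assumes \<tau>: "\<tau> \<in> NN" and k: "ratio x z \<tau> = q" and q2: "1 < q"
  shows "alpha le \<tau> z < alpha le \<tau> x"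
proof -
  have pp: "pp \<tau>" by (rule NN_pp[OF \<tau>])
  \<comment> \<open>A proper subpipe has fewer elements, so its width bound is smaller by a factor
    of at least \<open>K\<close>.\<close>
  define B where "B = 4 * D * eps (card \<tau>) / K"
  have B0: "0 \<le> B" using eps_pos[of "card \<tau>"] K_pos by (simp add: B_def)
  have Bd: "spread_bound (card C) \<le> B" if "C \<in> NN" "C \<subset> \<tau>" for C
  proof -
    have "card C < card \<tau>" using that pp_finite[OF pp] by (simp add: psubset_card_mono)
    then have "K * eps (card C) \<le> eps (card \<tau>)" by (rule eps_less)
    then have "eps (card C) \<le> eps (card \<tau>) / K" using K_pos by (simp add: pos_le_divide_eq mult.commute)
    then have "4 * D * eps (card C) \<le> 4 * D * (eps (card \<tau>) / K)" by (intro mult_left_mono) auto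
    then show ?thesis by (simp add: spread_bound_def B_def)
  qed
  \<comment> \<open>Each end of an edge is replaced by an unmoved point: the displacements in
    \<open>z\<close> cost \<open>2 * B\<close>, the accumulated deviations
    \<open>2 * (real n * B)\<close>.\<close>
  define G where "G = 2 * B + 2 * (real n * B)"
  have G0: "0 \<le> G" using B0 by (simp add: G_def)
  have edge: "(q - 1) * ((z j - z i) - G) \<le> (x j - x i) - (z j - z i)" if "(i, j) \<in> edges \<tau>" for i j
  proof -
    have ij: "i \<in> \<tau>" "j \<in> \<tau>" using that by (auto simp: edges_def)
    obtain p where p: "p \<in> \<tau>" "contr x \<tau> p = x p" "contr z \<tau> p = z p"
      "\<bar>z i - z p\<bar> \<le> B" "\<bar>(x i - x p) - (z i - z p)\<bar> \<le> (q - 1) * (real n * B)"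
      using near_fixed[OF disjI2[OF \<tau>] ij(1) Bd B0] by metis
    obtain r where r: "r \<in> \<tau>" "contr x \<tau> r = x r" "contr z \<tau> r = z r"
      "\<bar>z j - z r\<bar> \<le> B" "\<bar>(x j - x r) - (z j - z r)\<bar> \<le> (q - 1) * (real n * B)"
      using near_fixed[OF disjI2[OF \<tau>] ij(2) Bd B0] by metis
    have "x r - x p = q * (z r - z p)"
      using ratio_diff_fixed[OF disjI2[OF \<tau>] r(1) p(1) r(2,3) p(2,3)] k by simp
    then have "(x r - x p) - (z r - z p) = (q - 1) * (z r - z p)" by (simp add: algebra_simps)
    moreover have "(q - 1) * ((z j - z i) - 2 * B) \<le> (q - 1) * (z r - z p)"
      using p(4) r(4) q1 by (intro mult_left_mono) auto
    moreover have "(q - 1) * ((z j - z i) - G) =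
        (q - 1) * ((z j - z i) - 2 * B) - 2 * ((q - 1) * (real n * B))"
      by (simp add: G_def algebra_simps)
    ultimately show ?thesis using p(5) r(5) by linarith
  qed
  have "(q - 1) * alpha le \<tau> z - (alpha le \<tau> x - alpha le \<tau> z) =
      (\<Sum>(i, j)\<in>edges \<tau>. (q - 1) * (z j - z i) - ((x j - x i) - (z j - z i)))"
  proof -
    have "(q - 1) * alpha le \<tau> z = (\<Sum>(i, j)\<in>edges \<tau>. (q - 1) * (z j - z i))"
      unfolding alpha_edges[OF pp] sum_distrib_left by (simp only: case_prod_unfold)
    then show ?thesis unfolding alpha_diff[OF pp] by (simp only: case_prod_unfold sum_subtractf)
  qed
  also have "\<dots> \<le> D * ((q - 1) * G)"
  proof (rule edges_sum_le[OF pp])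
    show "(q - 1) * (z j - z i) - ((x j - x i) - (z j - z i)) \<le> (q - 1) * G" if "(i, j) \<in> edges \<tau>" for i j
      using edge[OF that] unfolding right_diff_distrib by linarith
    show "0 \<le> (q - 1) * G" using G0 q1 by simp
  qed
  finally have main: "(q - 1) * (alpha le \<tau> z - D * G) \<le> alpha le \<tau> x - alpha le \<tau> z"
    by (simp add: algebra_simps)
  have "D * G < eps (card \<tau>)"
  proof -
    have "D * G = 8 * D\<^sup>2 * (1 + real n) * (eps (card \<tau>) / K)"
      by (simp add: G_def B_def power2_eq_square algebra_simps add_divide_distrib)
    also have "\<dots> \<le> 8 * D\<^sup>2 * (2 * D) * (eps (card \<tau>) / K)"
    proof (intro mult_right_mono mult_left_mono)
      show "1 + real n \<le> 2 * D" using D_ge_n D_ge_1 by linarith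
    qed (use eps_pos[of "card \<tau>"] K_pos in auto)
    also have "\<dots> < K * (eps (card \<tau>) / K)"
    proof (rule mult_strict_right_mono)
      have K: "K = 8 * D\<^sup>2 + 80 * (D\<^sup>2 * D)" by (simp add: K_def M_def power2_eq_square algebra_simps)
      have "0 < D\<^sup>2" "0 \<le> D\<^sup>2 * D" using n_pos by auto
      then show "8 * D\<^sup>2 * (2 * D) < K" unfolding K by linarith
    qed (use eps_pos K_pos in auto)
    finally show ?thesis using K_pos by simp
  qed
  then have "0 < (q - 1) * (alpha le \<tau> z - D * G)"
    using truncated_alpha[OF z pp] q2 by (intro mult_pos_pos) auto
  then show ?thesis using main by simp
qed

end

text \<open>The case \<open>q = 1\<close> of \<open>near_fixed\<close>: all errors vanish, and the
  factor at \<open>UNIV\<close> is 1.\<close>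

lemma differences_eq:
  assumes "\<And>\<sigma>. \<sigma> \<in> NN \<Longrightarrow> ratio x z \<sigma> \<le> 1" "\<And>\<sigma>. \<sigma> \<in> NN \<Longrightarrow> ratio z x \<sigma> \<le> 1"
  shows "x i - x j = z i - z j"
proof -
  define B where "B = spread_bound n"
  have B: "spread_bound (card C) \<le> B" if "C \<in> NN" for C
    unfolding B_def spread_bound_def using pp_card[OF NN_pp[OF that]] by (intro mult_left_mono eps_mono) auto
  have B0: "0 \<le> B" using eps_pos[of n] by (simp add: B_def spread_bound_def)
  obtain p where p: "contr x UNIV p = x p" "contr z UNIV p = z p" "\<bar>(x i - x p) - (z i - z p)\<bar> \<le> (1 - 1) * (real n * B)"
    using near_fixed[OF assms order_refl disjI1[OF refl] UNIV_I[of i] B B0] by metis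
  obtain r where r: "contr x UNIV r = x r" "contr z UNIV r = z r" "\<bar>(x j - x r) - (z j - z r)\<bar> \<le> (1 - 1) * (real n * B)"
    using near_fixed[OF assms order_refl disjI1[OF refl] UNIV_I[of j] B B0] by metis
  have "x p - x r = z p - z r"
    using ratio_diff_fixed[OF disjI1[OF refl] UNIV_I UNIV_I p(1,2) r(1,2)] by (simp add: ratio_def)
  then show ?thesis using p(3) r(3) by simp
qed

text \<open>At a pipe where the ratio is maximal and which is as large as possible, \<open>ratio_max_alpha\<close> and
  \<open>ratio_step_le\<close> contradict each other.\<close>

lemma no_max:
  assumes q: "\<And>\<sigma>. \<sigma> \<in> NN \<Longrightarrow> ratio x z \<sigma> \<le> q" "\<And>\<sigma>. \<sigma> \<in> NN \<Longrightarrow> ratio z x \<sigma> \<le> q" and q1: "1 < q"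
    and \<tau>: "\<tau> \<in> NN" "ratio x z \<tau> = q"
    and largest: "\<And>\<sigma>. \<sigma> \<in> NN \<Longrightarrow> \<tau> \<subset> \<sigma> \<Longrightarrow> ratio x z \<sigma> \<noteq> q"
  shows False
proof -
  have "alpha le \<tau> z < alpha le \<tau> x" using ratio_max_alpha[OF q _ \<tau> q1] q1 by simp
  moreover obtain \<rho> where \<rho>: "\<rho> = UNIV \<or> \<rho> \<in> NN" "\<tau> \<subset> \<rho>" "\<And>\<pi>. \<pi> \<in> NN \<Longrightarrow> \<tau> \<subset> \<pi> \<Longrightarrow> \<rho> \<subseteq> \<pi>"
    using NN_parent[OF \<tau>(1)] by blast
  moreover have "\<rho> = UNIV \<or> pp \<rho>" using \<rho>(1) NN_pp by blast
  ultimately have "ratio x z \<tau> \<le> ratio x z \<rho>"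
    using ratio_step_le[OF x z eq NN_pp[OF \<tau>(1)]] unfolding NN_def by blast
  moreover have "ratio x z \<rho> < q"
  proof (cases "\<rho> = UNIV")
    case False
    then show ?thesis using \<rho>(1,2) q(1)[of \<rho>] largest[of \<rho>] by force
  qed (simp add: ratio_def q1)
  ultimately show False using \<tau>(2) by simp
qed

end

text \<open>Taking the maximum over the ratios in both directions makes the situation symmetric in
  \<open>x\<close> and \<open>z\<close>, so a largest pipe attaining it in either direction can be
  chosen. Differences are what can be recovered, as \<open>ctr\<close> forgets a common
  constant.\<close>

theorem comp_map_inj:
  assumes x: "truncated x" and z: "truncated z" and eq: "comp_map x = comp_map z"
  shows "x i - x j = z i - z j"
proof -
  define all_near where "all_near = near x \<union> near z"
  have all_near: "NN x z = all_near" "NN z x = all_near"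
    by (simp_all add: NN_def[OF x z eq] NN_def[OF z x eq[symmetric]] all_near_def Un_commute)
  define W where "W = ratio x z ` all_near \<union> ratio z x ` all_near"
  have "finite W"
  proof -
    have "W \<subseteq> ratio x z ` {\<tau>. pp \<tau>} \<union> ratio z x ` {\<tau>. pp \<tau>}"
      unfolding W_def all_near_def using near_pp by blast
    then show ?thesis
      using finite_ratio_values truncated_quasi_periodic x z by (meson finite_UnI finite_subset)
  qed
  define q where "q = Max (insert 1 W)"
  have q: "ratio x z \<sigma> \<le> q" "ratio z x \<sigma> \<le> q" if "\<sigma> \<in> all_near" for \<sigma>
    unfolding q_def using \<open>finite W\<close> that by (auto simp: W_def intro!: Max_ge)
  have "q = 1"
  proof (rule ccontr)
    assume "q \<noteq> 1"
    moreover have "1 \<le> q" unfolding q_def using \<open>finite W\<close> by simp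
    ultimately have q1: "1 < q" by simp
    have "q \<in> insert 1 W" unfolding q_def using \<open>finite W\<close> by (intro Max_in) auto
    then have "\<exists>\<sigma>. \<sigma> \<in> all_near \<and> (ratio x z \<sigma> = q \<or> ratio z x \<sigma> = q)" using \<open>q \<noteq> 1\<close> by (auto simp: W_def)
    moreover have card: "card \<sigma> < Suc n" if "\<sigma> \<in> all_near \<and> (ratio x z \<sigma> = q \<or> ratio z x \<sigma> = q)" for \<sigma>
      using that pp_card[of \<sigma>] near_pp by (auto simp: all_near_def)
    ultimately obtain \<tau> where \<tau>: "\<tau> \<in> all_near" "ratio x z \<tau> = q \<or> ratio z x \<tau> = q"
      and max: "\<And>\<sigma>. \<sigma> \<in> all_near \<and> (ratio x z \<sigma> = q \<or> ratio z x \<sigma> = q) \<Longrightarrow> card \<sigma> \<le> card \<tau>"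
      using ex_has_greatest_nat[of "\<lambda>\<sigma>. \<sigma> \<in> all_near \<and> (ratio x z \<sigma> = q \<or> ratio z x \<sigma> = q)" _ card "Suc n"]
      by metis
    have largest: "ratio x z \<sigma> \<noteq> q" "ratio z x \<sigma> \<noteq> q" if "\<sigma> \<in> all_near" "\<tau> \<subset> \<sigma>" for \<sigma>
    proof -
      have "pp \<sigma>" using that(1) near_pp by (auto simp: all_near_def)
      then have "card \<tau> < card \<sigma>" using that(2) pp_finite by (simp add: psubset_card_mono)
      then show "ratio x z \<sigma> \<noteq> q" "ratio z x \<sigma> \<noteq> q" using max[of \<sigma>] that(1) by auto
    qed
    show False
      using \<tau>(2)
    proof
      assume "ratio x z \<tau> = q"
      then show False
        using no_max[OF x z eq, unfolded all_near, OF q(1,2) q1 \<tau>(1) _ largest(1)] by blast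
    next
      assume "ratio z x \<tau> = q"
      then show False
        using no_max[OF z x eq[symmetric], unfolded all_near, OF q(2,1) q1 \<tau>(1) _ largest(2)] by blast
    qed
  qed
  then show ?thesis using differences_eq[OF x z eq, unfolded all_near] q by simp
qed

end

section \<open>Coordinates on the truncated polytope\<close>

context affine_setting
begin

lemma Max_shift_exists: "\<exists>g. le (r + g * int n) i \<and> (\<forall>d. le (r + d * int n) i \<longrightarrow> d \<le> g)"
proof -
  obtain k where k: "le (r - int k * int n) i" using le_coinitial by blast
  obtain l where l: "le i (r + int l * int n)" using le_cofinal by blast
  have ub: "d \<le> int l" if "le (r + d * int n) i" for d
    using le_shift_self le_trans[OF that l] by blast
  let ?S = "{d. - int k \<le> d \<and> d \<le> int l \<and> le (r + d * int n) i}"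
  have fin: "finite ?S" by (rule finite_subset[of _ "{- int k..int l}"]) auto
  have k_in: "- int k \<in> ?S" using k ub[of "- int k"] by simp
  have "Max ?S \<in> ?S" using fin k_in by (intro Max_in) auto
  moreover have "d \<le> Max ?S" if d: "le (r + d * int n) i" for d
  proof (cases "- int k \<le> d")
    case True
    then show ?thesis using fin d ub by (intro Max_ge) auto
  next
    case False
    then show ?thesis using Max_ge[OF fin k_in] by simp
  qed
  ultimately show ?thesis by blast
qed

text \<open>The witness counts, over all residue classes, how far each class reaches below \<open>i\<close>.\<close>

lemma strict_height:
  obtains h :: "int \<Rightarrow> int" where "\<And>i. h (i + int n) = h i + int n" "\<And>i j. strict le i j \<Longrightarrow> h i < h j"
proof -
  define g where "g r i = (SOME g. le (r + g * int n) i \<and> (\<forall>d. le (r + d * int n) i \<longrightarrow> d \<le> g))" for r i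
  have "le (r + g r i * int n) i \<and> (\<forall>d. le (r + d * int n) i \<longrightarrow> d \<le> g r i)" for r i
    unfolding g_def by (rule someI_ex) (rule Max_shift_exists)
  then have g: "le (r + g r i * int n) i" "\<And>d. le (r + d * int n) i \<Longrightarrow> d \<le> g r i" for r i by blast+
  have g_mono: "g r i \<le> g r j" if "le i j" for r i j using g(2) le_trans[OF g(1) that] by blast
  have g_shift: "g r (i + int n) = g r i + 1" for r i
  proof (rule antisym)
    have "le (r + (g r i + 1) * int n) (i + int n)"
      using le_shift[of "r + g r i * int n" 1 i] g(1)[of r i] by (simp add: algebra_simps)
    then show "g r i + 1 \<le> g r (i + int n)" by (rule g(2))
    have "le (r + (g r (i + int n) - 1) * int n) i"
      using le_shift[of "r + (g r (i + int n) - 1) * int n" 1 i] g(1)[of r "i + int n"]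
      by (simp add: algebra_simps)
    then show "g r (i + int n) \<le> g r i + 1" using g(2) by fastforce
  qed
  define h where "h i = (\<Sum>r\<in>{0..<int n}. g r i)" for i
  show ?thesis
  proof (rule that)
    show "h (i + int n) = h i + int n" for i by (simp add: h_def g_shift sum.distrib)
    show "h i < h j" if ij: "strict le i j" for i j
      unfolding h_def
    proof (rule sum_strict_mono_ex1)
      have lij: "le i j" "i \<noteq> j" using ij by (auto simp: strict_def)
      show "\<forall>r\<in>{0..<int n}. g r i \<le> g r j" using g_mono lij by blast
      let ?r = "j mod int n"
      \<comment> \<open>The residue class of \<open>j\<close> itself separates: if it reached as far
        below \<open>i\<close> as below \<open>j\<close>, then \<open>j\<close> would lie below
        \<open>i\<close>.\<close>
      have "g ?r i < g ?r j"
      proof (rule ccontr)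
        assume "\<not> g ?r i < g ?r j"
        then have "g ?r i = g ?r j" using g_mono[OF lij(1), of ?r] by simp
        moreover have jr: "?r + (j div int n) * int n = j" by (rule mod_div_mult_eq)
        then have "j div int n \<le> g ?r j" by (intro g(2)) simp
        ultimately have "le j (j + (g ?r i - j div int n) * int n)" by (intro le_up) simp
        moreover have "j + (g ?r i - j div int n) * int n = ?r + g ?r i * int n"
          by (simp add: left_diff_distrib minus_div_mult_eq_mod)
        ultimately have "le j (?r + g ?r i * int n)" by simp
        then have "le j i" using g(1) by (rule le_trans)
        then show False using lij le_antisym by blast
      qed
      moreover have "?r \<in> {0..<int n}" using n_pos by simp
      ultimately show "\<exists>r\<in>{0..<int n}. g r i < g r j" by blast
    qed simp
  qed
qed

lemma edges_nonempty: "pp \<tau> \<Longrightarrow> edges \<tau> \<noteq> {}"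
proof
  assume \<tau>: "pp \<tau>" and e: "edges \<tau> = {}"
  obtain i where i: "i \<in> \<tau>" using pp_nonempty[OF \<tau>] by blast
  have "adj \<tau> = {}" using e by (auto simp: adj_def edges_def)
  then have "k = i" if "k \<in> \<tau>" for k
    using pp_connected[OF \<tau>] i that by (auto simp: hasse_connected_iff)
  then have "\<tau> = {i}" using i by blast
  then show False using \<tau> by (simp add: pp_iff)
qed

lemma seq_space_quasi_periodic: "v \<in> seq_space n c \<Longrightarrow> quasi_periodic v"
  by (simp add: seq_space_def quasi_periodic_def)

lemma alpha_ctr: "pp \<tau> \<Longrightarrow> alpha le \<tau> (ctr v) = alpha le \<tau> v"
  by (simp add: alpha_edges ctr_def)

text \<open>A strict height of period \<open>n\<close>, scaled by \<open>c / n\<close>, gives every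
  covering edge at least \<open>c / n\<close>, which exceeds all \<open>eps (card \<tau>)\<close>
  because \<open>K\<close> is larger than \<open>n\<close>.\<close>

lemma interior_point:
  obtains x where "x \<in> seq_space n c" "\<And>\<tau>. pp \<tau> \<Longrightarrow> eps (card \<tau>) < alpha le \<tau> x"
proof -
  obtain h :: "int \<Rightarrow> int" where h: "\<And>i. h (i + int n) = h i + int n" "\<And>i j. strict le i j \<Longrightarrow> h i < h j"
    using strict_height by blast
  define v where "v i = c / real n * real_of_int (h i)" for i
  have "quasi_periodic v" using n_pos by (simp add: quasi_periodic_def v_def h(1) field_simps)
  then have "ctr v \<in> seq_space n c" by (rule ctr_seq_space)
  moreover have "eps (card \<tau>) < alpha le \<tau> (ctr v)" if \<tau>: "pp \<tau>" for \<tau>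
  proof -
    have gap: "c / real n \<le> v j - v i" if "(i, j) \<in> edges \<tau>" for i j
    proof -
      have "h i < h j" using that h(2) by (simp add: edges_def cov_iff)
      then have "1 \<le> real_of_int (h j) - real_of_int (h i)" by linarith
      then have "c / real n * 1 \<le> c / real n * (real_of_int (h j) - real_of_int (h i))"
        using c_pos by (intro mult_left_mono) auto
      then show ?thesis by (simp add: v_def right_diff_distrib)
    qed
    have up: "v i \<le> v j" if "(i, j) \<in> edges \<tau>" for i j
    proof -
      have "0 \<le> c / real n" using c_pos by simp
      then show ?thesis using gap[OF that] by linarith
    qed
    obtain i j where ij: "(i, j) \<in> edges \<tau>" using edges_nonempty[OF \<tau>] by auto
    have "K * eps n \<le> c" by (rule eps_le_c) simp
    moreover have "real n < K"
      using K_ge_M M_ge D_ge_n D_ge_1 by linarith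
    then have "real n * eps n < K * eps n" using eps_pos by (intro mult_strict_right_mono)
    ultimately have "eps n < c / real n" using n_pos by (simp add: field_simps)
    moreover have "eps (card \<tau>) \<le> eps n" by (intro eps_mono pp_card \<tau>)
    moreover have "v j - v i \<le> alpha le \<tau> v" by (rule edge_le_alpha[OF up \<tau> ij])
    ultimately show ?thesis using gap[OF ij] by (simp add: alpha_ctr \<tau>)
  qed
  ultimately show ?thesis using that by blast
qed

text \<open>The relations between \<open>i\<close> and the translates of \<open>j\<close> bound all
  differences by a common multiple of \<open>c\<close>, and a vanishing sum forces both a
  nonpositive and a nonnegative coordinate.\<close>

lemma seq_bound: "\<exists>B. \<forall>x\<in>seq_space n c. order_mono x \<longrightarrow> (\<forall>i\<in>{1..int n}. \<bar>x i\<bar> \<le> B)"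
proof -
  let ?I = "{1..int n}"
  define k where "k i j = (SOME k::nat. le i (j + int k * int n))" for i j
  have k: "le i (j + int (k i j) * int n)" for i j
    unfolding k_def by (rule someI_ex) (rule le_cofinal)
  define m where "m = Max ((\<lambda>(i, j). k i j) ` (?I \<times> ?I))"
  have km: "k i j \<le> m" if "i \<in> ?I" "j \<in> ?I" for i j
    unfolding m_def using that by (intro Max_ge) (auto intro: image_eqI[of _ _ "(i, j)"])
  have "\<bar>x i\<bar> \<le> real m * c" if x: "x \<in> seq_space n c" "order_mono x" and i: "i \<in> ?I" for x i
  proof -
    have diff: "x p \<le> x q + real m * c" if "p \<in> ?I" "q \<in> ?I" for p q
    proof -
      have "x p \<le> x (q + int (k p q) * int n)" using x(2) k by (simp add: order_mono_def)
      also have "\<dots> = x q + real (k p q) * c" using quasi_periodic_shift[OF seq_space_quasi_periodic[OF x(1)]] by simp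
      also have "\<dots> \<le> x q + real m * c" using km[OF that] c_pos by simp
      finally show ?thesis .
    qed
    have sum0: "(\<Sum>i\<in>?I. x i) = 0" using x(1) by (simp add: seq_space_def)
    have "\<exists>j\<in>?I. x j \<le> 0"
    proof (rule ccontr)
      assume "\<not> ?thesis"
      then have "0 < (\<Sum>i\<in>?I. x i)" using n_pos by (intro sum_pos) (auto simp: not_le)
      then show False using sum0 by simp
    qed
    moreover have "\<exists>j\<in>?I. 0 \<le> x j"
    proof (rule ccontr)
      assume "\<not> ?thesis"
      then have "0 < (\<Sum>i\<in>?I. - x i)" using n_pos by (intro sum_pos) (auto simp: not_le)
      then show False using sum0 by (simp add: sum_negf)
    qed
    ultimately obtain j j' where j: "j \<in> ?I" "x j \<le> 0" "j' \<in> ?I" "0 \<le> x j'" by blast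
    show ?thesis using diff[OF i j(1)] diff[OF j(3) i] j by (simp add: abs_le_iff)
  qed
  then show ?thesis by blast
qed

section \<open>Representatives of classes and continuity in the point\<close>

lemma class_self: "\<tau> \<in> pipe_class n \<tau>"
  unfolding pipe_class_def by (metis rangeI sh_0)

lemma class_eq: "pipe_class n \<tau> = pipe_class n \<tau>' \<longleftrightarrow> (\<exists>d. \<tau>' = sh d \<tau>)"
proof
  assume "pipe_class n \<tau> = pipe_class n \<tau>'"
  then have "\<tau>' \<in> pipe_class n \<tau>" using class_self by blast
  then show "\<exists>d. \<tau>' = sh d \<tau>" by (auto simp: pipe_class_def)
next
  assume "\<exists>d. \<tau>' = sh d \<tau>"
  then obtain d where d: "\<tau>' = sh d \<tau>" by blast
  have "sh e \<tau> \<in> range (\<lambda>e. sh (e + d) \<tau>)" for e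
    by (rule image_eqI[of _ _ "e - d"]) simp_all
  then have "range (\<lambda>e. sh e \<tau>) = range (\<lambda>e. sh (e + d) \<tau>)" by blast
  then show "pipe_class n \<tau> = pipe_class n \<tau>'" by (simp add: pipe_class_def d sh_sh)
qed

abbreviation classes :: "int set set set" where
  "classes \<equiv> pipe_class n ` {\<tau>. pp \<tau>}"

definition rep :: "int set set \<Rightarrow> int set" where
  "rep C = (SOME \<tau>. pp \<tau> \<and> pipe_class n \<tau> = C)"

lemma rep: "C \<in> classes \<Longrightarrow> pp (rep C) \<and> pipe_class n (rep C) = C"
  unfolding rep_def by (rule someI_ex) auto

lemma rep_class: "pp \<tau> \<Longrightarrow> \<exists>d. rep (pipe_class n \<tau>) = sh d \<tau>"
  using rep[of "pipe_class n \<tau>"] by (auto simp: class_eq[of \<tau>, symmetric])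

lemma alpha_cont:
  assumes "\<And>i. continuous_on S (\<lambda>y. v y i)" "pp \<tau>"
  shows "continuous_on S (\<lambda>y. alpha le \<tau> (v y))"
  unfolding alpha_edges[OF assms(2)] case_prod_unfold using assms(1) by (intro continuous_intros)

lemma coord_cont:
  assumes v: "\<And>i. continuous_on S (\<lambda>y. v y i)" and \<tau>: "pp \<tau>"
    and pos: "\<And>y. y \<in> S \<Longrightarrow> 0 < alpha le \<tau> (v y)"
  shows "continuous_on S (\<lambda>y. coord le (v y) \<tau> i)"
proof (cases "i \<in> \<tau>")
  case True
  have "continuous_on S (\<lambda>y. (v y i - (\<Sum>k\<in>\<tau>. v y k) / real (card \<tau>)) / alpha le \<tau> (v y))"
    using v alpha_cont[OF v \<tau>] pos pp_finite[OF \<tau>] pp_nonempty[OF \<tau>]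
    by (intro continuous_intros) (auto simp: less_imp_neq[symmetric])
  then show ?thesis by (simp add: coord_pp[OF \<tau> True])
next
  case False
  then show ?thesis using pp_not_UNIV[OF \<tau>] by (simp add: coord_def)
qed

text \<open>The index set \<open>pset \<tau> i\<close> does not depend on the point, so the formula
  is a fixed finite sum of continuous terms.\<close>

lemma contr_cont:
  assumes v: "\<And>i. continuous_on S (\<lambda>y. v y i)"
  shows "continuous_on S (\<lambda>y. contr (v y) \<tau> i)"
proof -
  have shrink_cont: "continuous_on S (\<lambda>y. shrink (v y) \<sigma>)" if "pp \<sigma>" for \<sigma>
    unfolding shrink_def using alpha_cont[OF v that] eps_pos[of "card \<sigma>"]
    by (intro continuous_intros) auto
  have "continuous_on S (\<lambda>y. wt (shrink (v y)) (pset \<tau> i) \<sigma> * (v y (base \<sigma>) - v y i))"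
    if "\<sigma> \<in> pset \<tau> i" for \<sigma>
    unfolding wt_def using v shrink_cont that
    by (intro continuous_intros) (auto simp: pset_def)
  then show ?thesis unfolding contr_def by (intro continuous_on_add continuous_on_sum v)
qed

lemma comp_map_cont:
  assumes v: "\<And>i. continuous_on S (\<lambda>y. v y i)" and A: "\<And>y. y \<in> S \<Longrightarrow> truncated (v y)"
  shows "continuous_on S (\<lambda>y. comp_map (v y))"
proof (intro continuous_on_coordinatewise_then_product)
  fix \<tau> i
  consider "\<tau> = UNIV" | "pp \<tau>" | "\<not> nontriv_pipe n le \<tau>" using nontriv_iff by blast
  then show "continuous_on S (\<lambda>y. comp_map (v y) \<tau> i)"
  proof cases
    case 1
    then show ?thesis unfolding 1 comp_map_UNIV ctr_def using n_pos
      by (intro continuous_intros contr_cont v) auto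
  next
    case 2
    then show ?thesis unfolding comp_map_pp[OF 2] using alpha_contr_pos[OF A 2] by (intro coord_cont contr_cont v)
  next
    case 3
    then show ?thesis by (simp add: comp_map_def)
  qed
qed

lemma rho_cont:
  assumes v: "\<And>i. continuous_on S (\<lambda>y. v y i)" and A: "\<And>y \<tau>. y \<in> S \<Longrightarrow> pp \<tau> \<Longrightarrow> 0 < alpha le \<tau> (v y)"
  shows "continuous_on S (\<lambda>y. rho n le (v y))"
proof (intro continuous_on_coordinatewise_then_product)
  fix \<tau> i
  consider "\<tau> = UNIV" | "pp \<tau>" | "\<not> nontriv_pipe n le \<tau>" using nontriv_iff by blast
  then show "continuous_on S (\<lambda>y. rho n le (v y) \<tau> i)"
  proof cases
    case 1
    then show ?thesis using v by (simp add: rho_def nontriv_UNIV coord_def)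
  next
    case 2
    then have "rho n le (v y) \<tau> i = coord le (v y) \<tau> i" for y by (simp add: rho_def pp_nontriv)
    then show ?thesis using coord_cont[OF v 2 A[OF _ 2]] by simp
  next
    case 3
    then show ?thesis by (simp add: rho_def)
  qed
qed

text \<open>Describes the domain of \<open>rho\<close> by the positivity conditions that the bounds
  \<open>eps\<close> tighten to cut out the truncated polytope.\<close>

lemma O_open_iff:
  "v \<in> O_open n le c \<longleftrightarrow> v \<in> seq_space n c \<and> (\<forall>\<tau>. pp \<tau> \<longrightarrow> 0 < alpha le \<tau> v)"
proof
  assume v: "v \<in> O_open n le c"
  have "0 < alpha le \<tau> v" if \<tau>: "pp \<tau>" for \<tau>
  proof -
    have "0 < (\<Sum>(i, j)\<in>edges \<tau>. v j - v i)"
      using edges_nonempty[OF \<tau>] edges_finite[OF \<tau>] v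
      by (intro sum_pos) (auto simp: O_open_def edges_def cov_iff)
    then show ?thesis by (simp add: alpha_edges[OF \<tau>])
  qed
  then show "v \<in> seq_space n c \<and> (\<forall>\<tau>. pp \<tau> \<longrightarrow> 0 < alpha le \<tau> v)" using v by (simp add: O_open_def)
next
  assume *: "v \<in> seq_space n c \<and> (\<forall>\<tau>. pp \<tau> \<longrightarrow> 0 < alpha le \<tau> v)"
  then have "v i < v j" if "cov i j" for i j
    using alpha_pos_cov[OF seq_space_quasi_periodic _ that] by blast
  then show "v \<in> O_open n le c" using * cov_mono_chain by (simp add: O_open_def)
qed

end

section \<open>The homeomorphism onto the compactification\<close>

context slack_system
begin

text \<open>From \<open>a\<close> one can go slightly beyond a relative interior point; a slack
  vanishing there but not at \<open>a\<close> would become negative. Conversely, slacks positive at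
  a point stay positive nearby, and the others vanish on the whole affine hull.\<close>

lemma rel_interior_face:
  assumes a: "a \<in> cell"
  shows "rel_interior {y \<in> cell. zeros a \<subseteq> zeros y} = {y \<in> cell. zeros y = zeros a}"
proof -
  define H where "H = {y \<in> cell. zeros a \<subseteq> zeros y}"
  have aH: "a \<in> H" using a by (simp add: H_def)
  have "ray y r z \<in> H" if "y \<in> H" "z \<in> H" "0 \<le> r" "r \<le> 1" for y z r
  proof -
    have yz: "y \<in> U" "z \<in> U" "\<And>v. v \<in> V \<Longrightarrow> 0 \<le> s v y \<and> 0 \<le> s v z"
      "\<And>v. v \<in> zeros a \<Longrightarrow> v \<in> V \<and> s v y = 0 \<and> s v z = 0"
      using that(1,2) by (auto simp: H_def cell_def zeros_def)
    have "0 \<le> s v (ray y r z)" if "v \<in> V" for v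
      unfolding slack_ray[OF that] using yz(3)[OF that] \<open>0 \<le> r\<close> \<open>r \<le> 1\<close> by simp
    moreover have "s v (ray y r z) = 0" if "v \<in> zeros a" for v
      using yz(4)[OF that] by (simp add: slack_ray)
    ultimately show ?thesis using ray_U[OF yz(1,2)] by (auto simp: H_def cell_def zeros_def)
  qed
  then have convH: "convex H" unfolding convex_alt ray_def by blast
  have "zeros y = zeros a" "y \<in> cell" if y: "y \<in> rel_interior H" for y
  proof -
    have yH: "y \<in> H" using y rel_interior_subset by blast
    then show "y \<in> cell" by (simp add: H_def)
    obtain r where r: "1 < r" "(1 - r) *\<^sub>R a + r *\<^sub>R y \<in> H"
      using y convex_rel_interior_iff[OF convH, of y] aH by blast
    then have "ray a r y \<in> cell" by (simp add: ray_def H_def)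
    then have nonneg: "0 \<le> (1 - r) * s v a + r * s v y" if "v \<in> V" for v
    proof -
      have "0 \<le> s v (ray a r y)" using \<open>ray a r y \<in> cell\<close> that by (simp add: cell_def)
      then show ?thesis by (simp add: slack_ray that)
    qed
    have "v \<in> zeros a" if v: "v \<in> zeros y" for v
    proof (rule ccontr)
      assume "v \<notin> zeros a"
      then have "v \<in> V" "s v y = 0" "0 < s v a" using v slack_pos[OF a] by (auto simp: zeros_def)
      then have "(1 - r) * s v a < 0" using r(1) by (simp add: mult_neg_pos)
      then show False using nonneg[OF \<open>v \<in> V\<close>] \<open>s v y = 0\<close> by simp
    qed
    then show "zeros y = zeros a" using yH by (auto simp: H_def)
  qed
  moreover have "y \<in> rel_interior H" if y: "y \<in> cell" "zeros y = zeros a" for y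
  proof -
    define L where "L = {z \<in> U. \<forall>v\<in>zeros a. s v z = 0}"
    define W where "W = (\<Inter>v\<in>V - zeros a. {z. 0 < s v z})"
    have "p *\<^sub>R w + q *\<^sub>R z \<in> L" if "w \<in> L" "z \<in> L" "p + q = 1" for w z p q
    proof -
      have p: "p = 1 - q" using that(3) by simp
      have "p *\<^sub>R w + q *\<^sub>R z = ray w q z" by (simp add: ray_def p)
      moreover have "ray w q z \<in> L" using that ray_U by (auto simp: L_def zeros_def slack_ray)
      ultimately show ?thesis by simp
    qed
    then have "affine L" unfolding affine_def by blast
    moreover have "H \<subseteq> L" by (auto simp: H_def L_def cell_def zeros_def)
    ultimately have hull: "affine hull H \<subseteq> L" by (simp add: hull_minimal)
    have "open W" unfolding W_def using finite_V slack_cont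
      by (intro open_INT ballI open_Collect_less) auto
    moreover have "y \<in> W \<inter> H"
      using y slack_pos[OF y(1)] by (auto simp: W_def H_def)
    moreover have "W \<inter> L \<subseteq> H"
    proof
      fix z assume z: "z \<in> W \<inter> L"
      have "0 \<le> s v z" if "v \<in> V" for v
        using z that by (cases "v \<in> zeros a") (auto simp: W_def L_def intro: less_imp_le)
      moreover have "zeros a \<subseteq> zeros z" using z by (auto simp: L_def zeros_def)
      ultimately show "z \<in> H" using z by (simp add: H_def cell_def L_def)
    qed
    ultimately show ?thesis unfolding mem_rel_interior using hull by blast
  qed
  ultimately show ?thesis unfolding H_def[symmetric] by blast
qed

end

context affine_setting
begin

text \<open>\<open>A.cell\<close> is the truncated polytope in a chart on \<open>U\<close>.
  \<open>G\<close> maps it to the compactification and \<open>\<Phi>\<close> to the given cell, both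
  respecting tight pipes; the result is \<open>G\<close> after the inverse of
  \<open>\<Phi>\<close>.\<close>

lemma Comp_homeomorphism:
  fixes U :: "'a::euclidean_space set" and t :: "int set set \<Rightarrow> 'a \<Rightarrow> real"
  assumes U: "subspace U" and dim: "dim U + 1 = n" and X: "slack_system U classes t"
    and patterns: "\<And>T. proper_piping n le T \<Longrightarrow>
      \<exists>y\<in>slack_system.cell U classes t. slack_system.zeros classes t y = pipe_class n ` T"
  shows "\<exists>f g. homeomorphism (slack_system.cell U classes t) (Comp n le c) f g \<and>
    (\<forall>T. proper_piping n le T \<longrightarrow>
      f ` {y \<in> slack_system.cell U classes t. slack_system.zeros classes t y = pipe_class n ` T} =
      Comp_stratum n le c T)"
proof -
  interpret X: slack_system U classes t by fact
  obtain e b :: "int \<Rightarrow> 'a" where e: "\<And>i. e (i + int n) = e i" "\<And>i. e i \<in> U" and bU: "\<And>i. b i \<in> U"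
    and e_sum: "(\<Sum>i\<in>{1..int n}. e i) = 0"
    and solve: "\<And>v j. (\<Sum>i\<in>{1..int n}. v i) = (0::real) \<Longrightarrow> j \<in> {1..int n} \<Longrightarrow>
      (\<Sum>i\<in>{1..int n}. v i *\<^sub>R b i) \<bullet> e j = v j"
    and expand: "\<And>y. y \<in> U \<Longrightarrow> (\<Sum>i\<in>{1..int n}. (y \<bullet> e i) *\<^sub>R b i) = y"
    using zero_sum_coordinates[OF U dim] by blast
  \<comment> \<open>The centred arithmetic progression with step \<open>c / n\<close>, serving as
    origin of the affine chart \<open>seqv\<close>.\<close>
  define x0 where "x0 = ctr (\<lambda>i. c / real n * real_of_int i)"
  have "quasi_periodic (\<lambda>i. c / real n * real_of_int i)" using n_pos by (simp add: quasi_periodic_def field_simps)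
  then have x0: "x0 \<in> seq_space n c" unfolding x0_def by (rule ctr_seq_space)
  define seqv where "seqv y i = x0 i + y \<bullet> e i" for y i
  define unseq where "unseq v = (\<Sum>i\<in>{1..int n}. (v i - x0 i) *\<^sub>R b i)" for v
  have seqv_space: "seqv y \<in> seq_space n c" for y
  proof -
    have "(\<Sum>i\<in>{1..int n}. y \<bullet> e i) = 0" using e_sum by (simp add: inner_sum_right[symmetric])
    then show ?thesis using x0 e(1) by (simp add: seq_space_def seqv_def sum.distrib)
  qed
  have unseq_U: "unseq v \<in> U" for v
    unfolding unseq_def using U bU by (intro subspace_sum subspace_scale)
  have unseq_seqv: "unseq (seqv y) = y" if "y \<in> U" for y
    using expand[OF that] by (simp add: unseq_def seqv_def)
  have seqv_unseq: "seqv (unseq v) = v" if v: "v \<in> seq_space n c" for v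
  proof
    fix i
    have base_case: "seqv (unseq v) j = v j" if "j \<in> {1..int n}" for j
    proof -
      have "(\<Sum>i\<in>{1..int n}. v i - x0 i) = 0" using v x0 by (simp add: seq_space_def sum_subtractf)
      then show ?thesis using solve[of "\<lambda>i. v i - x0 i" j] that by (simp add: seqv_def unseq_def)
    qed
    define j where "j = (i - 1) mod int n + 1"
    define d where "d = (i - 1) div int n"
    have i: "i = j + d * int n" unfolding j_def d_def using mod_div_mult_eq[of "i - 1" "int n"] by simp
    have "(i - 1) mod int n < int n" "0 \<le> (i - 1) mod int n"
      using n_pos by (auto intro: pos_mod_bound pos_mod_sign)
    then have "j \<in> {1..int n}" by (simp add: j_def)
    then show "seqv (unseq v) i = v i"
      using base_case quasi_periodic_shift[OF seq_space_quasi_periodic[OF v], of j d]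
        quasi_periodic_shift[OF seq_space_quasi_periodic[OF seqv_space], of "unseq v" j d] i by simp
  qed
  have seqv_inj: "y = z" if "y \<in> U" "z \<in> U" "seqv y = seqv z" for y z
    using unseq_seqv that by metis
  have seqv_affine: "seqv ((1 - r) *\<^sub>R y + r *\<^sub>R z) i = (1 - r) * seqv y i + r * seqv z i" for r y z i
    by (simp add: seqv_def inner_add_left algebra_simps)
  have seqv_cont: "continuous_on S (\<lambda>y. seqv y i)" for S i
    unfolding seqv_def by (intro continuous_intros)
  have alpha_affine: "alpha le \<tau> (seqv ((1 - r) *\<^sub>R y + r *\<^sub>R z)) =
      (1 - r) * alpha le \<tau> (seqv y) + r * alpha le \<tau> (seqv z)" if "pp \<tau>" for \<tau> r y z
    unfolding alpha_edges[OF that] sum_distrib_left sum.distrib[symmetric]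
    by (rule sum.cong[OF refl]) (clarify, simp only: seqv_affine, simp add: algebra_simps)
  \<comment> \<open>\<open>alpha\<close> is invariant under translation, so one slack at the
    representative accounts for the entire class.\<close>
  define s where "s C y = alpha le (rep C) (seqv y) - eps (card (rep C))" for C y
  have s_class: "s (pipe_class n \<tau>) y = alpha le \<tau> (seqv y) - eps (card \<tau>)" if \<tau>: "pp \<tau>" for \<tau> y
  proof -
    obtain d where "rep (pipe_class n \<tau>) = sh d \<tau>" using rep_class[OF \<tau>] by blast
    then show ?thesis using alpha_sh_quasi_periodic[OF seq_space_quasi_periodic[OF seqv_space] \<tau>] by (simp add: s_def)
  qed
  have cell_iff: "(y \<in> U \<and> (\<forall>C\<in>classes. 0 \<le> s C y)) \<longleftrightarrow> y \<in> U \<and> truncated (seqv y)" for y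
    using seq_space_quasi_periodic[OF seqv_space, of y] by (auto simp: truncated_def s_class)
  have s_cont: "continuous_on UNIV (s C)" if "C \<in> classes" for C
    unfolding s_def using rep[OF that] by (intro continuous_intros alpha_cont seqv_cont) auto
  have compact: "compact {y \<in> U. \<forall>C\<in>classes. 0 \<le> s C y}"
  proof -
    have "{y \<in> U. \<forall>C\<in>classes. 0 \<le> s C y} = U \<inter> (\<Inter>C\<in>classes. {y. 0 \<le> s C y})" by auto
    moreover have "closed {y. 0 \<le> s C y}" if "C \<in> classes" for C
      using s_cont[OF that] by (intro closed_Collect_le) auto
    ultimately have "closed {y \<in> U. \<forall>C\<in>classes. 0 \<le> s C y}"
      using closed_subspace[OF U] by (simp add: closed_Int closed_INT)
    moreover have "bounded {y \<in> U. \<forall>C\<in>classes. 0 \<le> s C y}"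
    proof -
      obtain B where B: "\<And>x i. x \<in> seq_space n c \<Longrightarrow> order_mono x \<Longrightarrow> i \<in> {1..int n} \<Longrightarrow> \<bar>x i\<bar> \<le> B"
        using seq_bound by blast
      have "norm y \<le> (\<Sum>i\<in>{1..int n}. (B + \<bar>x0 i\<bar>) * norm (b i))" if y: "y \<in> U" "truncated (seqv y)" for y
      proof -
        have "norm y = norm (\<Sum>i\<in>{1..int n}. (y \<bullet> e i) *\<^sub>R b i)" using expand[OF y(1)] by simp
        also have "\<dots> \<le> (\<Sum>i\<in>{1..int n}. (B + \<bar>x0 i\<bar>) * norm (b i))"
        proof (rule sum_norm_le)
          fix i assume i: "i \<in> {1..int n}"
          have "\<bar>seqv y i\<bar> \<le> B" using B[OF seqv_space truncated_order_mono[OF y(2)] i] .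
          then have "\<bar>y \<bullet> e i\<bar> \<le> B + \<bar>x0 i\<bar>" by (simp add: seqv_def)
          then show "norm ((y \<bullet> e i) *\<^sub>R b i) \<le> (B + \<bar>x0 i\<bar>) * norm (b i)" by (simp add: mult_right_mono)
        qed
        finally show ?thesis .
      qed
      then show ?thesis unfolding cell_iff bounded_iff by blast
    qed
    ultimately show ?thesis by (simp add: compact_eq_bounded_closed)
  qed
  have sA: "slack_system U classes s"
  proof
    show "affine U" using U by (rule subspace_imp_affine)
    show "finite classes" by (rule finite_classes)
    show "s C ((1 - r) *\<^sub>R y + r *\<^sub>R z) = (1 - r) * s C y + r * s C z" if "C \<in> classes" for C y z r
      unfolding s_def alpha_affine[OF conjunct1[OF rep[OF that]]] by (simp add: algebra_simps)
  qed (fact s_cont compact)+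
  interpret A: slack_system U classes s by (rule sA)
  have cell: "y \<in> A.cell \<longleftrightarrow> y \<in> U \<and> truncated (seqv y)" for y
    unfolding A.cell_def using cell_iff by simp
  have zeros: "A.zeros y = pipe_class n ` tight (seqv y)" for y
  proof -
    have "C \<in> A.zeros y \<longleftrightarrow> C \<in> pipe_class n ` tight (seqv y)" for C
    proof
      assume "C \<in> A.zeros y"
      then obtain \<tau> where "pp \<tau>" "C = pipe_class n \<tau>" "s C y = 0" by (auto simp: A.zeros_def)
      then show "C \<in> pipe_class n ` tight (seqv y)" using s_class by (auto simp: tight_def)
    next
      assume "C \<in> pipe_class n ` tight (seqv y)"
      then show "C \<in> A.zeros y" using s_class by (auto simp: tight_def A.zeros_def)
    qed
    then show ?thesis by blast
  qed
  have patterns': "\<exists>x\<in>X.cell. X.zeros x = A.zeros y" if "y \<in> A.cell" for y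
    unfolding zeros using patterns[OF tight_piping] that cell by blast
  have inter: "\<exists>a\<in>A.cell. A.zeros a = {}"
  proof -
    obtain x where x: "x \<in> seq_space n c" "\<And>\<tau>. pp \<tau> \<Longrightarrow> eps (card \<tau>) < alpha le \<tau> x"
      using interior_point by blast
    have "truncated x" using x(2) seq_space_quasi_periodic[OF x(1)] by (auto simp: truncated_def less_imp_le)
    then have "unseq x \<in> A.cell" using unseq_U seqv_unseq[OF x(1)] cell by simp
    moreover have "alpha le \<tau> x \<noteq> eps (card \<tau>)" if "pp \<tau>" for \<tau> using x(2)[OF that] by simp
    then have "tight x = {}" by (auto simp: tight_def)
    ultimately show ?thesis using zeros seqv_unseq[OF x(1)] by (intro bexI[of _ "unseq x"]) auto
  qed
  obtain \<Phi> \<Psi> where \<Phi>: "homeomorphism A.cell X.cell \<Phi> \<Psi>" "\<And>y. y \<in> A.cell \<Longrightarrow> X.zeros (\<Phi> y) = A.zeros y"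
    using slack_system_homeomorphism[OF U sA X patterns' inter] by blast
  define G where "G y = comp_map (seqv y)" for y
  have G_cont: "continuous_on A.cell G" unfolding G_def using cell by (intro comp_map_cont seqv_cont) auto
  have G_inj: "inj_on G A.cell"
  proof (rule inj_onI)
    fix y z assume yz: "y \<in> A.cell" "z \<in> A.cell" "G y = G z"
    have diff: "seqv y i - seqv y j = seqv z i - seqv z j" for i j
      using comp_map_inj[of "seqv y" "seqv z"] yz cell by (simp add: G_def)
    have "seqv y i = seqv z i" for i
    proof -
      have "(\<Sum>j\<in>{1..int n}. seqv y i - seqv y j) = (\<Sum>j\<in>{1..int n}. seqv z i - seqv z j)"
        using diff by simp
      then show ?thesis using seqv_space n_pos by (simp add: sum_subtractf seq_space_def)
    qed
    then show "y = z" using seqv_inj yz cell by blast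
  qed
  have compactA: "compact A.cell" using A.compact_cell by (simp add: A.cell_def)
  have closed_G: "closed (G ` A.cell)"
    by (intro compact_imp_closed_fun2 compact_continuous_image G_cont compactA)
  define S where "S = {y \<in> A.cell. A.zeros y = {}}"
  define T where "T = {y \<in> U. seqv y \<in> O_open n le c}"
  \<comment> \<open>On the open cell \<open>G\<close> factors through \<open>rho\<close>;
    \<open>g\<close> is the inner map in the chart, read off from the coordinate at
    \<open>UNIV\<close>.\<close>
  define g where "g y = unseq (ctr (contr (seqv y) UNIV))" for y
  have S: "truncated (seqv y)" "tight (seqv y) = {}" "y \<in> U" if "y \<in> S" for y
    using that cell zeros by (auto simp: S_def)
  have g_seqv: "seqv (g y) = ctr (contr (seqv y) UNIV)" if "y \<in> S" for y
    unfolding g_def using comp_map_interior(1)[OF S(1,2)[OF that]] by (intro seqv_unseq) (simp add: O_open_def)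
  have G_rho: "G y = rho n le (seqv (g y))" if "y \<in> S" for y
    using comp_map_interior(2)[OF S(1,2)[OF that]] g_seqv[OF that] by (simp add: G_def)
  have T_iff: "y \<in> T \<longleftrightarrow> y \<in> U \<and> (\<forall>\<tau>. pp \<tau> \<longrightarrow> 0 < alpha le \<tau> (seqv y))" for y
    using seqv_space by (simp add: T_def O_open_iff)
  have rho_contT: "continuous_on T (\<lambda>y. rho n le (seqv y))"
    using T_iff by (intro rho_cont seqv_cont) auto
  \<comment> \<open>A point of \<open>T\<close> that \<open>rho\<close> sends into the image of
    \<open>G\<close> comes from a point without tight pipes. Hence the image of \<open>g\<close> is
    the preimage of a closed set.\<close>
  have gS: "g ` S = T \<inter> (\<lambda>y. rho n le (seqv y)) -` (G ` A.cell)"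
  proof (intro equalityI subsetI)
    fix w assume "w \<in> g ` S"
    then obtain y where y: "y \<in> S" "w = g y" by blast
    then have "w \<in> T" using comp_map_interior(1)[OF S(1,2)] g_seqv unseq_U by (simp add: T_def g_def)
    moreover have "rho n le (seqv w) \<in> G ` A.cell" using G_rho[OF y(1)] y by (force simp: S_def)
    ultimately show "w \<in> T \<inter> (\<lambda>y. rho n le (seqv y)) -` (G ` A.cell)" by simp
  next
    fix w assume w: "w \<in> T \<inter> (\<lambda>y. rho n le (seqv y)) -` (G ` A.cell)"
    then obtain y where y: "y \<in> A.cell" "rho n le (seqv w) = comp_map (seqv y)" by (auto simp: G_def)
    have ay: "truncated (seqv y)" using y(1) cell by blast
    have wT: "w \<in> U" "seqv w \<in> O_open n le c" using w by (auto simp: T_def)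
    have "tight (seqv y) = {}" by (rule comp_map_rho_tight[OF ay wT(2) y(2)[symmetric]])
    then have yS: "y \<in> S" using y(1) zeros by (simp add: S_def)
    have "rho n le (seqv w) = rho n le (seqv (g y))" using y(2) G_rho[OF yS] by (simp add: G_def)
    then have "rho n le (seqv w) UNIV = rho n le (seqv (g y)) UNIV" by simp
    then have "seqv w = seqv (g y)" by (simp add: rho_def nontriv_UNIV coord_def)
    then have "w = g y" using seqv_inj wT(1) unseq_U by (simp add: g_def)
    then show "w \<in> g ` S" using yS by blast
  qed
  have "g ` S = T"
  proof (rule clopen_surj[OF U])
    show "openin (top_of_set U) S" unfolding S_def by (rule A.open_cell_openin)
    show "S \<noteq> {}" using inter by (auto simp: S_def)
    show "T \<subseteq> U" by (auto simp: T_def)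
    have "convex T"
      unfolding convex_alt
    proof (intro ballI allI impI)
      fix y z and r :: real assume *: "y \<in> T" "z \<in> T" "0 \<le> r \<and> r \<le> 1"
      have "0 < alpha le \<tau> (seqv ((1 - r) *\<^sub>R y + r *\<^sub>R z))" if \<tau>: "pp \<tau>" for \<tau>
      proof -
        have p: "0 < alpha le \<tau> (seqv y)" "0 < alpha le \<tau> (seqv z)" using * \<tau> T_iff by blast+
        show ?thesis
        proof (cases "r = 1")
          case False
          then have "0 < (1 - r) * alpha le \<tau> (seqv y)" "0 \<le> r * alpha le \<tau> (seqv z)" using p * by simp_all
          then show ?thesis by (simp add: alpha_affine \<tau>)
        qed (simp add: p)
      qed
      moreover have "(1 - r) *\<^sub>R y + r *\<^sub>R z \<in> U"
        using * U T_iff by (intro subspace_add subspace_scale) auto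
      ultimately show "(1 - r) *\<^sub>R y + r *\<^sub>R z \<in> T" using T_iff by blast
    qed
    then show "connected T" by (rule convex_connected)
    show "continuous_on S g"
      unfolding g_def unseq_def ctr_def using n_pos by (intro continuous_intros contr_cont seqv_cont) auto
    show "inj_on g S"
    proof (rule inj_onI)
      fix y z assume "y \<in> S" "z \<in> S" "g y = g z"
      then show "y = z" using G_rho[of y] G_rho[of z] G_inj by (auto simp: S_def inj_on_def)
    qed
    show "g ` S \<subseteq> T" using gS by blast
    show "closedin (top_of_set T) (g ` S)"
      unfolding gS by (rule continuous_closedin_preimage[OF rho_contT closed_G])
  qed
  have rho_image: "rho n le ` O_open n le c \<subseteq> G ` A.cell"
  proof
    fix p assume "p \<in> rho n le ` O_open n le c"
    then obtain v where v: "v \<in> O_open n le c" "p = rho n le v" by blast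
    then have v': "seqv (unseq v) = v" by (intro seqv_unseq) (simp add: O_open_def)
    then have "unseq v \<in> T" using v unseq_U by (simp add: T_def)
    then obtain y where y: "y \<in> S" "g y = unseq v" using \<open>g ` S = T\<close> by (metis imageE)
    then have "p = G y" using G_rho[OF y(1)] v v' by simp
    then show "p \<in> G ` A.cell" using y(1) by (auto simp: S_def)
  qed
  have G_compat: "G ` A.cell \<subseteq> compat_prod n le c" using comp_map_compat cell by (auto simp: G_def)
  have "G ` A.cell = Comp n le c"
  proof
    show "Comp n le c \<subseteq> G ` A.cell"
      unfolding Comp_def by (rule closure_of_minimal[OF rho_image closed_subset[OF G_compat closed_G]])
    \<comment> \<open>The points that \<open>G\<close> sends into the closure form a closed set
      containing the dense open cell. Intersecting with \<open>compat_prod\<close> is the form in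
      which a closure in a subspace unfolds.\<close>
    let ?R = "compat_prod n le c \<inter> rho n le ` O_open n le c"
    define Z where "Z = {y \<in> A.cell. G y \<in> closure ?R}"
    obtain a where a: "a \<in> A.cell" "A.zeros a = {}" using inter by blast
    have "closed Z"
    proof -
      have "closedin (top_of_set A.cell) (A.cell \<inter> G -` closure ?R)"
        by (rule continuous_closedin_preimage[OF G_cont closed_closure])
      then have "closed (A.cell \<inter> G -` closure ?R)"
        using compact_imp_closed[OF compactA] closedin_closed_trans by blast
      moreover have "Z = A.cell \<inter> G -` closure ?R" by (auto simp: Z_def)
      ultimately show ?thesis by simp
    qed
    moreover have "{y \<in> A.cell. A.zeros y = {}} \<subseteq> Z"
    proof
      fix y assume "y \<in> {y \<in> A.cell. A.zeros y = {}}"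
      then have y: "y \<in> S" "y \<in> A.cell" by (simp_all add: S_def)
      have "G y \<in> rho n le ` O_open n le c"
        using G_rho[OF y(1)] \<open>g ` S = T\<close> y(1) by (auto simp: T_def)
      then have "G y \<in> ?R" using G_compat y(2) by blast
      then have "G y \<in> closure ?R" by (rule subsetD[OF closure_subset])
      then show "y \<in> Z" using y(2) by (simp add: Z_def)
    qed
    ultimately have "A.cell \<subseteq> Z" by (rule A.open_cell_dense[OF a])
    then show "G ` A.cell \<subseteq> Comp n le c"
      unfolding Comp_def closure_of_subtopology using G_compat by (auto simp: Z_def)
  qed
  have hom: "homeomorphism X.cell A.cell \<Psi> \<Phi>" using \<Phi>(1) by (rule homeomorphism_symD)
  obtain G' where "homeomorphism A.cell (Comp n le c) G G'"
    using homeomorphism_compact_fun2[OF compactA G_cont \<open>G ` A.cell = Comp n le c\<close> G_inj] by blast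
  then have main: "homeomorphism X.cell (Comp n le c) (G \<circ> \<Psi>) (\<Phi> \<circ> G')"
    by (rule homeomorphism_compose[OF hom])
  have strata: "(G \<circ> \<Psi>) ` {y \<in> X.cell. X.zeros y = pipe_class n ` T} = Comp_stratum n le c T"
    if T: "proper_piping n le T" for T
  proof -
    \<comment> \<open>A piping is a union of classes, hence determined by the set of its classes, so
      equal patterns mean equal pipings.\<close>
    have union: "P = \<Union> (pipe_class n ` P)" if "proper_piping n le P" for P
    proof -
      have "\<forall>\<tau>\<in>P. pipe_class n \<tau> \<subseteq> P" using that by (simp add: proper_piping_def piping_def)
      then show ?thesis using class_self by auto
    qed
    have act: "A.zeros y = pipe_class n ` T \<longleftrightarrow> tight (seqv y) = T" if "y \<in> A.cell" for y
      unfolding zeros using union[OF T] union[OF tight_piping] that cell by metis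
    have po: "piping_of n le (G y) = tight (seqv y)" if "y \<in> A.cell" for y
      using piping_of_comp_map that cell by (simp add: G_def)
    show ?thesis
    proof (intro equalityI subsetI)
      fix p assume "p \<in> (G \<circ> \<Psi>) ` {y \<in> X.cell. X.zeros y = pipe_class n ` T}"
      then obtain w where w: "w \<in> X.cell" "X.zeros w = pipe_class n ` T" "p = G (\<Psi> w)" by auto
      have y: "\<Psi> w \<in> A.cell" "\<Phi> (\<Psi> w) = w" using \<Phi>(1) w(1) by (auto simp: homeomorphism_def)
      then have "piping_of n le p = T" using \<Phi>(2)[OF y(1)] w act[OF y(1)] po[OF y(1)] by simp
      moreover have "p \<in> Comp n le c" using y(1) w(3) \<open>G ` A.cell = Comp n le c\<close> by blast
      ultimately show "p \<in> Comp_stratum n le c T" by (simp add: Comp_stratum_def)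
    next
      fix p assume p: "p \<in> Comp_stratum n le c T"
      then have "p \<in> G ` A.cell" using \<open>G ` A.cell = Comp n le c\<close> by (simp add: Comp_stratum_def)
      then obtain y where y: "y \<in> A.cell" "p = G y" by blast
      then have "tight (seqv y) = T" using p po by (simp add: Comp_stratum_def)
      then have "X.zeros (\<Phi> y) = pipe_class n ` T" using \<Phi>(2)[OF y(1)] act[OF y(1)] by simp
      moreover have "\<Phi> y \<in> X.cell" "\<Psi> (\<Phi> y) = y" using \<Phi>(1) y(1) by (auto simp: homeomorphism_def)
      ultimately show "p \<in> (G \<circ> \<Psi>) ` {y \<in> X.cell. X.zeros y = pipe_class n ` T}"
        using y(2) by (intro image_eqI[of _ _ "\<Phi> y"]) auto
    qed
  qed
  show ?thesis using main strata by blast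
qed

end

section \<open>The affine cyclohedron\<close>

lemma boundary_complex_extreme:
  "w \<in> \<Union> (boundary_complex Q) \<Longrightarrow> w extreme_point_of Q"
  by (auto simp: boundary_complex_def extreme_point_of_face)

lemma dual_cyclohedron_finite:
  assumes "dual_cyclohedron n le Q \<phi>"
  shows "finite (pipe_class n ` {\<tau>. proper_pipe n le \<tau>})"
proof -
  have "polyhedron Q"
    using assms polytope_imp_polyhedron by (auto simp: dual_cyclohedron_def simplicial_polytope_def)
  moreover have "\<Union> (boundary_complex Q) \<subseteq> {v. v extreme_point_of Q}"
    using boundary_complex_extreme by blast
  ultimately have "finite (\<Union> (boundary_complex Q))"
    using finite_polyhedron_extreme_points finite_subset by blast
  moreover have "bij_betw \<phi> (pipe_class n ` {\<tau>. proper_pipe n le \<tau>}) (\<Union> (boundary_complex Q))"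
    using assms by (simp add: dual_cyclohedron_def)
  ultimately show ?thesis using bij_betw_finite by blast
qed

text \<open>By Krein-Milman it suffices to test extreme points. Each of them is a proper face of
  \<open>Q\<close>, unless \<open>Q\<close> is a single point, which is then 0.\<close>

lemma polar_dual_vertices:
  fixes Q :: "'a::euclidean_space set"
  assumes Q: "polytope Q" "0 \<in> Q"
  shows "polar_dual Q = {y \<in> span Q. \<forall>w\<in>\<Union> (boundary_complex Q). w \<bullet> y \<le> 1}"
proof -
  have "x \<bullet> y \<le> 1" if y: "\<forall>w\<in>\<Union> (boundary_complex Q). w \<bullet> y \<le> 1" and x: "x \<in> Q" for x y
  proof -
    have "w \<bullet> y \<le> 1" if w: "w extreme_point_of Q" for w
    proof (cases "Q = {w}")
      case True
      then show ?thesis using Q(2) by simp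
    next
      case False
      have "{w} face_of Q" using w by (simp add: face_of_singleton)
      moreover have "{v. v extreme_point_of {w}} = {w}" by (auto simp: extreme_point_of_def)
      ultimately have "{w} \<in> boundary_complex Q" using False unfolding boundary_complex_def by blast
      then show ?thesis using y by blast
    qed
    then have "convex hull {w. w extreme_point_of Q} \<subseteq> {x. y \<bullet> x \<le> 1}"
      by (intro hull_minimal convex_halfspace_le) (auto simp: inner_commute[of y])
    moreover have "Q = convex hull {w. w extreme_point_of Q}"
      using Q(1) by (intro Krein_Milman_Minkowski polytope_imp_compact polytope_imp_convex)
    ultimately have "y \<bullet> x \<le> 1" using x by blast
    then show ?thesis by (simp only: inner_commute)
  qed
  moreover have "w \<in> Q" if "w \<in> \<Union> (boundary_complex Q)" for w
    using boundary_complex_extreme[OF that] by (simp add: extreme_point_of_def)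
  ultimately show ?thesis unfolding polar_dual_def by blast
qed

text \<open>A small ball of \<open>span Q\<close> lies in \<open>Q\<close>; testing \<open>y\<close>
  against its own multiple on the sphere of that ball bounds the norm.\<close>

lemma polar_dual_bounded:
  fixes Q :: "'a::euclidean_space set"
  assumes "0 \<in> rel_interior Q"
  shows "bounded (polar_dual Q)"
proof -
  obtain r where r: "0 < r" "cball 0 r \<inter> affine hull Q \<subseteq> Q"
    using assms by (auto simp: mem_rel_interior_cball)
  have "0 \<in> Q" using assms rel_interior_subset by blast
  then have "0 \<in> affine hull Q" by (rule hull_inc)
  then have hull: "affine hull Q = span Q" by (rule affine_hull_span_0)
  have "norm y \<le> 1 / r" if y: "y \<in> polar_dual Q" for y
  proof (cases "y = 0")
    case False
    define x where "x = (r / norm y) *\<^sub>R y"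
    have "x \<in> cball 0 r" using r(1) False by (simp add: x_def)
    moreover have "x \<in> span Q" using y by (simp add: x_def polar_dual_def span_scale)
    ultimately have "x \<bullet> y \<le> 1" using r(2) hull y by (auto simp: polar_dual_def)
    moreover have "x \<bullet> y = r * norm y"
      using False by (simp add: x_def dot_square_norm power2_eq_square)
    ultimately show ?thesis using r(1) by (simp add: field_simps)
  qed (use r in simp)
  then show ?thesis unfolding bounded_iff by blast
qed

text \<open>Every proper face is exposed by a functional, which is normalised to have the value 1 on the face
  because 0 is a relative interior point.\<close>

lemma exposing_dual_point:
  fixes Q :: "'a::euclidean_space set"
  assumes Q: "polytope Q" and zero: "0 \<in> rel_interior Q" and F: "F face_of Q" "F \<noteq> Q"
  obtains y where "y \<in> polar_dual Q" "F = Q \<inter> {x. x \<bullet> y = 1}"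
proof (cases "F = {}")
  case True
  have "0 \<in> polar_dual Q" by (simp add: polar_dual_def span_zero)
  then show ?thesis using that[of 0] True by auto
next
  case False
  have Q0: "0 \<in> Q" using zero rel_interior_subset by blast
  have "F exposed_face_of Q"
    using F(1) exposed_face_of_polyhedron[OF polytope_imp_polyhedron[OF Q]] by blast
  then obtain a b where ab: "Q \<subseteq> {x. a \<bullet> x \<le> b}" "F = Q \<inter> {x. a \<bullet> x = b}"
    using False F(2) unfolding exposed_face_of by blast
  have "0 \<notin> F" using face_of_disjoint_rel_interior[OF F] zero by blast
  then have b: "0 < b" using ab Q0 by force
  \<comment> \<open>The exposing functional lives on the ambient space; its component in
    \<open>span Q\<close> has the same values on \<open>Q\<close> and belongs to the space of the
    polar dual.\<close>
  obtain y z where yz: "y \<in> span Q" "\<And>w. w \<in> span Q \<Longrightarrow> orthogonal z w" "a = y + z"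
    using orthogonal_subspace_decomp_exists[of Q a] by blast
  have dot: "x \<bullet> (y /\<^sub>R b) = (a \<bullet> x) / b" if "x \<in> Q" for x
    using yz(2)[of x] yz(3) that span_base[OF that]
    by (simp add: orthogonal_def inner_add_left inner_add_right inner_commute divide_inverse mult.commute)
  have "y /\<^sub>R b \<in> polar_dual Q"
    using yz(1) dot ab(1) b by (auto simp: polar_dual_def span_scale)
  moreover have "F = Q \<inter> {x. x \<bullet> (y /\<^sub>R b) = 1}" using ab(2) dot b by (auto simp: field_simps)
  ultimately show ?thesis using that by blast
qed

theorem theorem1p13:
  fixes n :: nat and le :: "int \<Rightarrow> int \<Rightarrow> bool" and c :: real
    and Q :: "'a::euclidean_space set" and \<phi> :: "int set set \<Rightarrow> 'a"
  assumes "affine_poset n le"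
    and "c > 0"
    and "dual_cyclohedron n le Q \<phi>"
  shows "\<exists>f g. homeomorphism (polar_dual Q) (Comp n le c) f g \<and>
    (\<forall>T. proper_piping n le T \<longrightarrow>
      f ` rel_interior (cyclohedron_face n Q \<phi> T) = Comp_stratum n le c T)"
proof -
  interpret affine_setting n le c
    using assms(1,2) dual_cyclohedron_finite[OF assms(3)] by unfold_locales
  have Q: "polytope Q" and aff: "aff_dim Q = int n - 1" and zero: "0 \<in> rel_interior Q"
    and bij: "bij_betw \<phi> classes (\<Union> (boundary_complex Q))"
    and complex: "(\<lambda>S. \<phi> ` S) ` piping_complex n le = boundary_complex Q"
    using assms(3) by (auto simp: dual_cyclohedron_def simplicial_polytope_def)
  have Q0: "0 \<in> Q" using zero rel_interior_subset by blast
  define U where "U = span Q"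
  \<comment> \<open>The inequalities cutting out the polar dual, one for each vertex of
    \<open>Q\<close> and hence for each class of pipes.\<close>
  define t where "t C y = 1 - \<phi> C \<bullet> y" for C y
  have vertices: "\<Union> (boundary_complex Q) = \<phi> ` classes" using bij by (simp add: bij_betw_def)
  have polar: "polar_dual Q = {y \<in> U. \<forall>C\<in>classes. 0 \<le> t C y}"
    unfolding polar_dual_vertices[OF Q Q0] vertices U_def t_def by auto
  have dim: "dim U + 1 = n"
  proof -
    have "aff_dim Q = int (dim Q)" by (rule aff_dim_zero) (simp add: hull_inc Q0)
    then show ?thesis using aff by (simp add: U_def)
  qed
  have t_cont: "continuous_on UNIV (t C)" for C unfolding t_def by (intro continuous_intros)
  have "compact (polar_dual Q)"
  proof -
    have "polar_dual Q = U \<inter> (\<Inter>C\<in>classes. {y. 0 \<le> t C y})" unfolding polar by auto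
    moreover have "closed {y. 0 \<le> t C y}" for C
      using t_cont by (intro closed_Collect_le) auto
    ultimately have "closed (polar_dual Q)"
      by (simp add: closed_Int closed_INT closed_subspace U_def)
    then show ?thesis using polar_dual_bounded[OF zero] by (simp add: compact_eq_bounded_closed)
  qed
  then have sX: "slack_system U classes t"
    unfolding polar
    by unfold_locales
      (auto simp: U_def t_def finite_classes inner_add_right algebra_simps subspace_imp_affine
        intro!: continuous_intros)
  interpret X: slack_system U classes t by (rule sX)
  have cell: "X.cell = polar_dual Q" by (simp add: X.cell_def polar)
  \<comment> \<open>The isomorphism turns a piping into the vertex set of a proper face. A
    functional exposing this face takes the value 1 at exactly these vertices, and their slacks are
    the ones that vanish.\<close>
  have patterns: "\<exists>y\<in>X.cell. X.zeros y = pipe_class n ` T" if T: "proper_piping n le T" for T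
  proof -
    have sub: "pipe_class n ` T \<subseteq> classes" using T by (auto simp: proper_piping_def)
    have "pipe_class n ` T \<in> piping_complex n le" using T unfolding piping_complex_def by blast
    then have "\<phi> ` (pipe_class n ` T) \<in> boundary_complex Q" using complex by blast
    then have "\<exists>F. \<phi> ` (pipe_class n ` T) = {v. v extreme_point_of F} \<and> F face_of Q \<and> F \<noteq> Q"
      unfolding boundary_complex_def by (rule CollectD)
    then obtain F where F: "F face_of Q" "F \<noteq> Q" "{v. v extreme_point_of F} = \<phi> ` (pipe_class n ` T)"
      by metis
    obtain y where y: "y \<in> polar_dual Q" "F = Q \<inter> {x. x \<bullet> y = 1}"
      using exposing_dual_point[OF Q zero F(1,2)] by blast
    have "C \<in> X.zeros y \<longleftrightarrow> C \<in> pipe_class n ` T" if C: "C \<in> classes" for C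
    proof -
      have "\<phi> C \<in> \<Union> (boundary_complex Q)" unfolding vertices using C by (rule imageI)
      then have ext: "\<phi> C extreme_point_of Q" by (rule boundary_complex_extreme)
      then have "\<phi> C \<in> Q" by (simp add: extreme_point_of_def)
      have "C \<in> X.zeros y \<longleftrightarrow> \<phi> C \<in> F"
        using C y(2) \<open>\<phi> C \<in> Q\<close> by (auto simp: X.zeros_def t_def)
      also have "\<dots> \<longleftrightarrow> \<phi> C extreme_point_of F" using extreme_point_of_face[OF F(1)] ext by simp
      also have "\<dots> \<longleftrightarrow> \<phi> C \<in> \<phi> ` (pipe_class n ` T)" using F(3) by blast
      also have "\<dots> \<longleftrightarrow> C \<in> pipe_class n ` T"
        by (rule inj_on_image_mem_iff[OF bij_betw_imp_inj_on[OF bij] C sub])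
      finally show ?thesis .
    qed
    moreover have "C \<notin> X.zeros y" "C \<notin> pipe_class n ` T" if "C \<notin> classes" for C
      using that sub by (auto simp only: X.zeros_def mem_Collect_eq)
    ultimately have "X.zeros y = pipe_class n ` T" by (intro set_eqI) metis
    then show ?thesis using y(1) cell by blast
  qed
  have faces: "rel_interior (cyclohedron_face n Q \<phi> T) = {y \<in> X.cell. X.zeros y = pipe_class n ` T}"
    if T: "proper_piping n le T" for T
  proof -
    have sub: "pipe_class n ` T \<subseteq> classes" using T by (auto simp: proper_piping_def)
    have hull: "(\<forall>x\<in>convex hull W. x \<bullet> y = 1) \<longleftrightarrow> (\<forall>x\<in>W. x \<bullet> y = 1)" for W and y :: 'a
    proof
      assume "\<forall>x\<in>W. x \<bullet> y = 1"
      then have "convex hull W \<subseteq> {x. y \<bullet> x = 1}"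
        by (intro hull_minimal convex_hyperplane) (auto simp: inner_commute)
      then show "\<forall>x\<in>convex hull W. x \<bullet> y = 1" by (auto simp: inner_commute)
    qed (simp add: hull_inc)
    have "cyclohedron_face n Q \<phi> T = {y \<in> X.cell. pipe_class n ` T \<subseteq> X.zeros y}"
      unfolding cyclohedron_face_def dual_face_def hull cell X.zeros_def t_def using sub by auto
    \<comment> \<open>A point with exactly this pattern is what \<open>rel_interior_face\<close>
      requires to identify the relative interior.\<close>
    moreover obtain a where "a \<in> X.cell" "X.zeros a = pipe_class n ` T" using patterns[OF T] by blast
    ultimately show ?thesis using X.rel_interior_face[of a] by simp
  qed
  have "subspace U" by (simp add: U_def)
  from Comp_homeomorphism[OF this dim sX patterns] show ?thesis
    unfolding cell[symmetric] using faces by (metis (no_types, lifting))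
qed

end
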